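(* Consider the Ricci flow evolving from a rotationally symmetric, asymptotically flat initial metric $\hat g$ on $\mathbb{R}^n$ as described in the context. If no minimal hypersphere is present initially, then none forms along the flow; that is, the metric coefficient $f(t,r)$ does not diverge in $\tilde D=[0,\tilde T)\times[0,\infty)$.
   Context: Weighted spaces: for an integer $k\ge0$, $\delta\in\mathbb{R}$, $\sigma(x)=\sqrt{1+|x|^2}$, $H^k_\delta$ is the space of $u\in H^k_{\rm loc}(\mathbb{R}^n)$ with $\sum_{|I|\le k}\int_{\mathbb{R}^n}|D^Iu|^2\sigma^{-2(\delta-|I|)-n}d^nx<\infty$. A metric $g$ on $\mathbb{R}^n$ is asymptotically flat of class $H^k_\delta$ if, in Cartesian coordinates, $g_{ij}-\delta_{ij},\,g^{ij}-\delta^{ij}\in H^k_\delta$. Setting: $n\ge3$; $\hat g$ is a rotationally symmetric metric on $\mathbb{R}^n$ containing no minimal hyperspheres (embedded $(n-1)$-spheres of zero mean curvature), asymptotically flat of class $H^k_\delta$ with $\delta<0$, $k>n/2+4$, written as $\hat g=a^2(r)dr^2+r^2g_{\rm can}$ with $g_{\rm can}$ the round metric on $S^{n-1}$. Let $\bar g(t)$, $t\in[0,T_M)$, be the maximal solution of the Ricci flow $\partial_t\bar g_{ij}=-2\bar R_{ij}$ with $\bar g(0)=\hat g$, with $\bar g_{ij}-\delta_{ij},\bar g^{ij}-\delta^{ij}\in C^1([0,T_M),H^{k-2}_\delta)$ and $\bar g$ smooth for $t>0$. It is rotationally symmetric: $\bar g=q^2(t,r)dr^2+h^2(t,r)g_{\rm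 can}$ with $q(0,r)=a(r)$, $h(0,r)=r$. Let $\tilde T\in(0,T_M]$ be the largest time such that for every $T<\tilde T$ there are constants $0<C^-\le1\le C^+$ with $C^-\le\partial_rh\le C^+$ on $[0,T]\times(0,\infty)$. For $t<\tilde T$ let $\rho(t,\cdot)$ be the inverse of $h(t,\cdot)$ and $f(t,r)=q(t,\rho(t,r))/\partial_rh(t,\rho(t,r))$, so that $\bar g(t)$ is isometric, via the diffeomorphism $(r,\theta)\mapsto(h(t,r),\theta)$, to $g(t)=f^2(t,r)dr^2+r^2g_{\rm can}$. Definition: the hyperspheres $r=$ const have mean curvature proportional to $1/(rf)$, and a minimal hypersphere is said to form along the flow iff $f(t,r)$ diverges in $\tilde D=[0,\tilde T)\times[0,\infty)$, i.e. $f$ is unbounded there. *)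

theory Defs
  imports "HOL-Analysis.Analysis"
begin

section \<open>Iterated derivatives and smooth functions\<close>

definition dderiv ::
  "'a::euclidean_space \<Rightarrow> ('a \<Rightarrow> 'b::real_normed_vector) \<Rightarrow> 'a \<Rightarrow> 'b" where
  "dderiv v f x = vector_derivative (\<lambda>s. f (x + s *\<^sub>R v)) (at 0)"

primrec dderivs ::
  "'a::euclidean_space list \<Rightarrow> ('a \<Rightarrow> 'b::real_normed_vector) \<Rightarrow> 'a \<Rightarrow> 'b" where
  "dderivs [] f = f"
| "dderivs (v # vs) f = dderiv v (dderivs vs f)"

text \<open>\<open>C\<^sup>\<infinity>\<close> on an open set: every iterated partial derivative is (Frechet) differentiable.\<close>

definition smooth_on ::
  "'a::euclidean_space set \<Rightarrow> ('a \<Rightarrow> 'b::real_normed_vector) \<Rightarrow> bool" where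
  "smooth_on U f \<longleftrightarrow> (\<forall>vs. set vs \<subseteq> Basis \<longrightarrow> dderivs vs f differentiable_on U)"

definition pd :: "'n::finite \<Rightarrow> (real^'n \<Rightarrow> 'b::real_normed_vector) \<Rightarrow> real^'n \<Rightarrow> 'b" where
  "pd i = dderiv (axis i 1)"

section \<open>Weighted Sobolev spaces\<close>

definition mi_order :: "('n::finite \<Rightarrow> nat) \<Rightarrow> nat" where
  "mi_order I = (\<Sum>i\<in>UNIV. I i)"

text \<open>The classical derivative \<open>D\<^sup>I \<phi>\<close>. It is applied to smooth functions only, for which the order
  of the partial derivatives, here an arbitrary one, does not matter.\<close>

definition mi_deriv :: "('n::finite \<Rightarrow> nat) \<Rightarrow> (real^'n \<Rightarrow> real) \<Rightarrow> real^'n \<Rightarrow> real" where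
  "mi_deriv I \<phi> = dderivs (map (\<lambda>i. axis i 1) (SOME l. \<forall>i. count_list l i = I i)) \<phi>"

definition test_function :: "(real^'n::finite \<Rightarrow> real) \<Rightarrow> bool" where
  "test_function \<phi> \<longleftrightarrow> smooth_on UNIV \<phi> \<and> compact (closure {x. \<phi> x \<noteq> 0})"

definition loc_integrable :: "(real^'n::finite \<Rightarrow> real) \<Rightarrow> bool" where
  "loc_integrable u \<longleftrightarrow>
     u \<in> borel_measurable lebesgue \<and> (\<forall>K. compact K \<longrightarrow> set_integrable lebesgue K u)"

definition has_weak_deriv ::
  "('n::finite \<Rightarrow> nat) \<Rightarrow> (real^'n \<Rightarrow> real) \<Rightarrow> (real^'n \<Rightarrow> real) \<Rightarrow> bool" where
  "has_weak_deriv I u v \<longleftrightarrow> loc_integrable u \<and> loc_integrable v \<and>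
     (\<forall>\<phi>. test_function \<phi> \<longrightarrow>
        (\<integral>x. u x * mi_deriv I \<phi> x \<partial>lebesgue) =
        (-1) ^ mi_order I * (\<integral>x. v x * \<phi> x \<partial>lebesgue))"

text \<open>Weak derivatives are unique up to null sets, so the choice does not affect the integrals
  below.\<close>

definition weak_deriv :: "('n::finite \<Rightarrow> nat) \<Rightarrow> (real^'n \<Rightarrow> real) \<Rightarrow> real^'n \<Rightarrow> real" where
  "weak_deriv I u = (SOME v. has_weak_deriv I u v)"

definition Hk_loc :: "nat \<Rightarrow> (real^'n::finite \<Rightarrow> real) set" where
  "Hk_loc k = {u. \<forall>I. mi_order I \<le> k \<longrightarrow>
     (\<exists>v. has_weak_deriv I u v \<and>
          (\<forall>K. compact K \<longrightarrow> set_integrable lebesgue K (\<lambda>x. (v x)\<^sup>2)))}"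

definition wt :: "real^'n::finite \<Rightarrow> real" where
  "wt x = sqrt (1 + (norm x)\<^sup>2)"

text \<open>The square of the norm of \<open>H\<^sup>k\<^sub>\<delta>\<close>; meaningful on \<^term>\<open>Hk_loc k\<close>.\<close>

definition Hk_sqnorm :: "nat \<Rightarrow> real \<Rightarrow> (real^'n::finite \<Rightarrow> real) \<Rightarrow> ennreal" where
  "Hk_sqnorm k \<delta> u = (\<Sum>I | mi_order I \<le> k.
     \<integral>\<^sup>+x. ennreal (\<bar>weak_deriv I u x\<bar>\<^sup>2 *
        wt x powr (- 2 * (\<delta> - real (mi_order I)) - real CARD('n))) \<partial>lebesgue)"

definition Hk :: "nat \<Rightarrow> real \<Rightarrow> (real^'n::finite \<Rightarrow> real) set" where
  "Hk k \<delta> = {u \<in> Hk_loc k. Hk_sqnorm k \<delta> u < \<infinity>}"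

definition time_ivl :: "ereal \<Rightarrow> real set" where
  "time_ivl T = {t. 0 \<le> t \<and> ereal t < T}"

text \<open>\<open>u \<in> C\<^sup>1([0,T), H\<^sup>k\<^sub>\<delta>)\<close>, with derivative \<open>v\<close>, which is one-sided at \<open>0\<close>.\<close>

definition C1_curve_Hk ::
  "nat \<Rightarrow> real \<Rightarrow> ereal \<Rightarrow> (real \<Rightarrow> real^'n::finite \<Rightarrow> real) \<Rightarrow> bool" where
  "C1_curve_Hk k \<delta> T u \<longleftrightarrow> (\<exists>v. \<forall>t \<in> time_ivl T.
     u t \<in> Hk k \<delta> \<and> v t \<in> Hk k \<delta> \<and>
     ((\<lambda>s. Hk_sqnorm k \<delta> (\<lambda>x. (u s x - u t x) / (s - t) - v t x)) \<longlongrightarrow> 0)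
        (at t within time_ivl T) \<and>
     ((\<lambda>s. Hk_sqnorm k \<delta> (\<lambda>x. v s x - v t x)) \<longlongrightarrow> 0) (at t within time_ivl T))"

section \<open>Metrics on Euclidean space and their curvature\<close>

text \<open>A metric is given by its matrix \<open>g\<^sub>i\<^sub>j\<close> in Cartesian coordinates. Elements of
  \<^term>\<open>Hk k \<delta>\<close> are determined only almost everywhere; for a metric whose components have enough
  Sobolev regularity, requiring continuity selects the continuous representative.\<close>

type_synonym 'n metric = "real^'n \<Rightarrow> real^'n^'n"

definition riemannian_metric :: "'n::finite metric \<Rightarrow> bool" where
  "riemannian_metric g \<longleftrightarrow> continuous_on UNIV g \<and>
     (\<forall>x. transpose (g x) = g x \<and> (\<forall>v. v \<noteq> 0 \<longrightarrow> v \<bullet> (g x *v v) > 0))"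

definition ginv :: "'n::finite metric \<Rightarrow> 'n metric" where
  "ginv g x = matrix_inv (g x)"

definition asymptotically_flat :: "nat \<Rightarrow> real \<Rightarrow> 'n::finite metric \<Rightarrow> bool" where
  "asymptotically_flat k \<delta> g \<longleftrightarrow> (\<forall>i j.
     (\<lambda>x. g x $ i $ j - mat 1 $ i $ j) \<in> Hk k \<delta> \<and>
     (\<lambda>x. ginv g x $ i $ j - mat 1 $ i $ j) \<in> Hk k \<delta>)"

text \<open>\<^term>\<open>christoffel g l i j\<close> is \<open>\<Gamma>\<^sup>l\<^sub>i\<^sub>j\<close>.\<close>

definition christoffel :: "'n::finite metric \<Rightarrow> 'n \<Rightarrow> 'n \<Rightarrow> 'n \<Rightarrow> real^'n \<Rightarrow> real" where
  "christoffel g l i j x = (1/2) * (\<Sum>m\<in>UNIV. ginv g x $ l $ m *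
     (pd i (\<lambda>y. g y $ m $ j) x + pd j (\<lambda>y. g y $ i $ m) x - pd m (\<lambda>y. g y $ i $ j) x))"

definition ricci :: "'n::finite metric \<Rightarrow> 'n \<Rightarrow> 'n \<Rightarrow> real^'n \<Rightarrow> real" where
  "ricci g i j x =
     (\<Sum>l\<in>UNIV. pd l (christoffel g l i j) x) - (\<Sum>l\<in>UNIV. pd j (christoffel g l i l) x)
     + (\<Sum>l\<in>UNIV. \<Sum>m\<in>UNIV. christoffel g l l m x * christoffel g m i j x)
     - (\<Sum>l\<in>UNIV. \<Sum>m\<in>UNIV. christoffel g l j m x * christoffel g m i l x)"

section \<open>Minimal hyperspheres\<close>

text \<open>The \<open>g\<close>-unit normal \<open>grad F / |grad F|\<close> to the level sets of \<open>F\<close>, and the mean curvature of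
  the level sets as its divergence.\<close>

definition gradient :: "(real^'n::finite \<Rightarrow> real) \<Rightarrow> real^'n \<Rightarrow> real^'n" where
  "gradient F x = (\<chi> i. pd i F x)"

definition unit_normal ::
  "'n::finite metric \<Rightarrow> (real^'n \<Rightarrow> real) \<Rightarrow> real^'n \<Rightarrow> real^'n" where
  "unit_normal g F x =
     (ginv g x *v gradient F x) /\<^sub>R sqrt (gradient F x \<bullet> (ginv g x *v gradient F x))"

definition mean_curvature :: "'n::finite metric \<Rightarrow> (real^'n \<Rightarrow> real) \<Rightarrow> real^'n \<Rightarrow> real" where
  "mean_curvature g F x =
     (\<Sum>i\<in>UNIV. pd i (\<lambda>y. unit_normal g F y $ i) x)
     + (\<Sum>i\<in>UNIV. \<Sum>j\<in>UNIV. christoffel g i i j x * unit_normal g F x $ j)"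

text \<open>Smoothness of a map on the sphere means that it extends smoothly to a neighbourhood.\<close>

definition embedded_hypersphere :: "(real^'n::finite) set \<Rightarrow> bool" where
  "embedded_hypersphere S \<longleftrightarrow> (\<exists>(\<Phi> :: real^'n \<Rightarrow> real^'n) U.
     open U \<and> sphere 0 1 \<subseteq> U \<and> smooth_on U \<Phi> \<and> inj_on \<Phi> (sphere 0 1) \<and>
     (\<forall>x \<in> sphere 0 1. \<forall>v. v \<bullet> x = 0 \<and> v \<noteq> 0 \<longrightarrow> dderiv v \<Phi> x \<noteq> 0) \<and>
     S = \<Phi> ` sphere 0 1)"

text \<open>Up to sign, the mean curvature at \<open>p\<close> does not depend on the local defining function, and
  every embedded hypersphere has local defining functions.\<close>

definition minimal_hypersphere :: "'n::finite metric \<Rightarrow> (real^'n) set \<Rightarrow> bool" where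
  "minimal_hypersphere g S \<longleftrightarrow> embedded_hypersphere S \<and>
     (\<forall>p \<in> S. \<exists>U F. open U \<and> p \<in> U \<and> smooth_on U F \<and> (\<forall>x \<in> U. gradient F x \<noteq> 0) \<and>
        S \<inter> U = {x \<in> U. F x = 0} \<and> mean_curvature g F p = 0)"

section \<open>Rotationally symmetric metrics\<close>

text \<open>\<open>g = q\<^sup>2(r) dr\<^sup>2 + h\<^sup>2(r) g\<^sub>c\<^sub>a\<^sub>n\<close> in Cartesian coordinates, where \<open>dr = x\<^sub>i dx\<^sup>i / r\<close> and
  \<open>r\<^sup>2 g\<^sub>c\<^sub>a\<^sub>n = \<delta>\<^sub>i\<^sub>j dx\<^sup>i dx\<^sup>j - dr\<^sup>2\<close>. The values at \<open>r = 0\<close> are the limits.\<close>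

definition rot_sym_form :: "'n::finite metric \<Rightarrow> (real \<Rightarrow> real) \<Rightarrow> (real \<Rightarrow> real) \<Rightarrow> bool" where
  "rot_sym_form g q h \<longleftrightarrow>
     continuous_on {0..} q \<and> continuous_on {0..} h \<and> (\<forall>r>0. q r > 0 \<and> h r > 0) \<and>
     (\<forall>x. x \<noteq> 0 \<longrightarrow> (\<forall>i j. g x $ i $ j =
        (q (norm x))\<^sup>2 * (x $ i * x $ j / (norm x)\<^sup>2) +
        (h (norm x))\<^sup>2 / (norm x)\<^sup>2 * (mat 1 $ i $ j - x $ i * x $ j / (norm x)\<^sup>2)))"

section \<open>The Ricci flow\<close>

definition AF_ricci_flow ::
  "nat \<Rightarrow> real \<Rightarrow> 'n::finite metric \<Rightarrow> ereal \<Rightarrow> (real \<Rightarrow> 'n metric) \<Rightarrow> bool" where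
  "AF_ricci_flow k \<delta> g0 T g \<longleftrightarrow>
     0 < T \<and> g 0 = g0 \<and>
     (\<forall>t \<in> time_ivl T. riemannian_metric (g t)) \<and>
     (\<forall>t \<in> time_ivl T. \<forall>x i j.
        ((\<lambda>s. g s x $ i $ j) has_real_derivative - 2 * ricci (g t) i j x)
          (at t within time_ivl T)) \<and>
     (\<forall>i j. C1_curve_Hk (k - 2) \<delta> T (\<lambda>t x. g t x $ i $ j - mat 1 $ i $ j) \<and>
            C1_curve_Hk (k - 2) \<delta> T (\<lambda>t x. ginv (g t) x $ i $ j - mat 1 $ i $ j)) \<and>
     smooth_on {p. 0 < fst p \<and> ereal (fst p) < T} (\<lambda>p. g (fst p) (snd p))"

definition maximal_AF_ricci_flow ::
  "nat \<Rightarrow> real \<Rightarrow> 'n::finite metric \<Rightarrow> ereal \<Rightarrow> (real \<Rightarrow> 'n metric) \<Rightarrow> bool" where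
  "maximal_AF_ricci_flow k \<delta> g0 T g \<longleftrightarrow> AF_ricci_flow k \<delta> g0 T g \<and>
     (\<forall>T' g'. AF_ricci_flow k \<delta> g0 T' g' \<and> (\<forall>t \<in> time_ivl T \<inter> time_ivl T'. g' t = g t)
        \<longrightarrow> T' \<le> T)"

text \<open>\<open>\<partial>\<^sub>r h(t,r)\<close> for \<open>r \<ge> 0\<close>, one-sided at \<open>r = 0\<close>.\<close>

definition dr :: "(real \<Rightarrow> real \<Rightarrow> real) \<Rightarrow> real \<Rightarrow> real \<Rightarrow> real" where
  "dr h t r = vector_derivative (h t) (at r within {0..})"

definition slope_bounded_until :: "(real \<Rightarrow> real \<Rightarrow> real) \<Rightarrow> ereal \<Rightarrow> bool" where
  "slope_bounded_until h T' \<longleftrightarrow> (\<forall>T \<in> time_ivl T'. \<exists>Cm Cp. 0 < Cm \<and> Cm \<le> 1 \<and> 1 \<le> Cp \<and>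
     (\<forall>t \<in> {0..T}. \<forall>r>0. Cm \<le> dr h t r \<and> dr h t r \<le> Cp))"

definition largest_slope_time :: "(real \<Rightarrow> real \<Rightarrow> real) \<Rightarrow> ereal \<Rightarrow> ereal \<Rightarrow> bool" where
  "largest_slope_time h TM T \<longleftrightarrow>
     0 < T \<and> T \<le> TM \<and> slope_bounded_until h T \<and>
     (\<forall>T'. 0 < T' \<and> T' \<le> TM \<and> slope_bounded_until h T' \<longrightarrow> T' \<le> T)"

text \<open>Via \<open>(r,\<theta>) \<mapsto> (h(t,r),\<theta>)\<close>, with inverse given by \<open>rho h t\<close>, the metric
  \<open>q\<^sup>2 dr\<^sup>2 + h\<^sup>2 g\<^sub>c\<^sub>a\<^sub>n\<close> is isometric to \<open>f\<^sup>2 dr\<^sup>2 + r\<^sup>2 g\<^sub>c\<^sub>a\<^sub>n\<close> with \<open>f\<close> as follows.\<close>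

definition rho :: "(real \<Rightarrow> real \<Rightarrow> real) \<Rightarrow> real \<Rightarrow> real \<Rightarrow> real" where
  "rho h t = inv_into {0..} (h t)"

definition f_coeff ::
  "(real \<Rightarrow> real \<Rightarrow> real) \<Rightarrow> (real \<Rightarrow> real \<Rightarrow> real) \<Rightarrow> real \<Rightarrow> real \<Rightarrow> real" where
  "f_coeff q h t r = q t (rho h t r) / dr h t (rho h t r)"

text \<open>In \<open>f\<^sup>2 dr\<^sup>2 + r\<^sup>2 g\<^sub>c\<^sub>a\<^sub>n\<close> the hyperspheres \<open>r = const\<close> have mean curvature proportional to
  \<open>1 / (r f)\<close>; the formation of a minimal hypersphere along the flow is by definition the
  divergence of \<open>f\<close> on \<open>[0,T) \<times> [0,\<infinity>)\<close>.\<close>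

definition minimal_hypersphere_forms :: "(real \<Rightarrow> real \<Rightarrow> real) \<Rightarrow> ereal \<Rightarrow> bool" where
  "minimal_hypersphere_forms f T \<longleftrightarrow> \<not> bounded ((\<lambda>(t, r). f t r) ` (time_ivl T \<times> {0..}))"

end

theory Submission
  imports Defs
begin

text \<open>Write \<open>n\<close> for the dimension. Along the flow \<open>f = 1 / y\<close>, where \<open>y = (\<partial>h/\<partial>r) / q\<close> is the derivative of \<open>h\<close> with
respect to arc length, so the theorem asks for a positive lower bound of \<open>y\<close>. Ricci flow makes \<open>y\<close>
satisfy
\<open>y\<^sub>t = L y + (n-2) (1 - y\<^sup>2) y / h\<^sup>2\<close>, \<open>L = \<partial>\<^sub>s\<^sup>2 + (n-3) (y/h) \<partial>\<^sub>s\<close>,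
where \<open>\<partial>\<^sub>s = q\<^sup>-\<^sup>1 \<partial>\<^sub>r\<close> (\<open>ricci_rotationally_symmetric\<close>, \<open>ricci_flow_slope_evolution\<close>). The reaction
term is positive for \<open>0 < y < 1\<close>, so the minimum principle suggests that a lower bound \<open>c \<le> 1/2\<close>
which holds near the initial time is kept.

The half-line is not compact, and its two ends are handled by barriers:
\<open>(\<partial>\<^sub>t - L) h\<^sup>2 = - 2 (n-2)\<close>, so \<open>h\<^sup>2 + 2 n t\<close> is a strict supersolution that is large at infinity, and \<open>(\<partial>\<^sub>t - L) h\<^sup>-\<^sup>1 = h\<^sup>-\<^sup>3 ((n-2) - 3 y\<^sup>2)\<close>, so wherever \<open>y < 1/2\<close> also \<open>1/h\<close>
is a supersolution, and it is large at the origin. Here the two-sided bound on the slope of \<open>h\<close> before the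
time \<open>Ttilde\<close> enters: it makes \<open>h\<close> comparable with \<open>r\<close>. Since \<open>\<epsilon>\<close> times the barriers may be added
and \<open>\<epsilon>\<close> sent to zero, \<open>slope_lower_bound\<close> needs the initial bound \<open>c \<le> y\<close> only locally uniformly on
\<open>(0,\<infinity>)\<close>, and \<open>c\<close> does not deteriorate as \<open>t\<close> tends to \<open>Ttilde\<close>.

It remains to bound \<open>y\<close> below for small times. There \<open>q y = \<partial>h/\<partial>r\<close> is bounded below, so it is
enough to bound \<open>q\<close> above: at \<open>t = 0\<close> on all of \<open>[0,\<infinity>)\<close>, and uniformly on compact subsets of
\<open>(0,\<infinity>)\<close> for \<open>t\<close> near \<open>0\<close>. Both follow from the weighted Sobolev conditions. As \<open>q\<^sup>2\<close> is a radial
function, this is the one-dimensional fact that a weak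
derivative controls the oscillation. It is obtained by duality, testing the weak derivatives of
the components \<open>g\<^sub>i\<^sub>j\<close> against suitable radial fields (\<open>radial_oscillation_bound\<close>), and
holds for every choice of these weak derivatives. Applied at \<open>t = 0\<close> to the difference
of \<open>g\<close> and the Euclidean metric it bounds \<open>a\<close>, by an integral that converges at infinity because \<open>\<delta> < 0\<close>; applied to \<open>g(t) - g(0)\<close>, whose
weak derivative is \<open>O(t)\<close>, it gives the convergence of \<open>q\<close> to \<open>a\<close>.\<close>

section \<open>A minimum principle for the slope\<close>

text \<open>The right-hand side \<open>L y + (N-2) (1 - y\<^sup>2) y / h\<^sup>2\<close> of the evolution equation of the slope, written with
the \<open>r\<close>-derivatives \<open>q1\<close>, \<open>y1\<close> and \<open>y2\<close> instead of arc length derivatives.\<close>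

definition slope_rhs :: "real \<Rightarrow> real \<Rightarrow> real \<Rightarrow> real \<Rightarrow> real \<Rightarrow> real \<Rightarrow> real \<Rightarrow> real" where
  "slope_rhs N h q q1 y y1 y2 = y2 / q\<^sup>2 - q1 * y1 / q^3
     + (N - 3) * y * y1 / (h * q) + (N - 2) * (1 - y\<^sup>2) * y / h\<^sup>2"

lemma interior_min_time:
  fixes f :: "real \<Rightarrow> real"
  assumes "(f has_real_derivative D) (at t)" "s < t" "\<And>u. s \<le> u \<Longrightarrow> u \<le> t \<Longrightarrow> f t \<le> f u"
  shows "D \<le> 0"
proof (rule ccontr)
  assume "\<not> D \<le> 0"
  then obtain d where d: "d > 0" "\<And>u. 0 < u \<Longrightarrow> u < d \<Longrightarrow> f (t - u) < f t"
    using DERIV_pos_inc_left[OF assms(1)] by auto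
  define u where "u = min (d/2) (t - s)"
  have "f (t - u) < f t" by (rule d(2)) (use d(1) assms(2) in \<open>auto simp: u_def min_def\<close>)
  moreover have "f t \<le> f (t - u)" by (rule assms(3)) (use d(1) assms(2) in \<open>auto simp: u_def\<close>)
  ultimately show False by simp
qed

lemma interior_min_space:
  fixes f f' :: "real \<Rightarrow> real"
  assumes f: "\<And>x. a < x \<Longrightarrow> x < b \<Longrightarrow> (f has_real_derivative f' x) (at x)"
    and f': "(f' has_real_derivative D) (at r)"
    and r: "a < r" "r < b" and min: "\<And>x. a < x \<Longrightarrow> x < b \<Longrightarrow> f r \<le> f x"
  shows "f' r = 0" "D \<ge> 0"
proof -
  define e where "e = min (r - a) (b - r)"
  have e: "e > 0" using r by (auto simp: e_def)
  show z: "f' r = 0"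
    by (rule DERIV_local_min[OF f[OF r] e]) (use min in \<open>auto simp: e_def\<close>)
  show "D \<ge> 0"
  proof (rule ccontr)
    assume "\<not> D \<ge> 0"
    then obtain d where d: "d > 0" "\<And>u. 0 < u \<Longrightarrow> u < d \<Longrightarrow> f' (r + u) < f' r"
      using DERIV_neg_dec_right[OF f'] by auto
    define u where "u = min (d/2) (e/2)"
    have u: "0 < u" "u < d" "u < e" using d(1) e by (auto simp: u_def)
    have "\<exists>x. r < x \<and> x < r + u \<and> f (r + u) - f r = (r + u - r) * f' x"
      by (rule MVT2) (use u r in \<open>auto simp: e_def intro!: f\<close>)
    then obtain x where x: "r < x" "x < r + u" "f (r + u) - f r = u * f' x" by auto
    have "f' x < 0" using d(2)[of "x - r"] x u z by auto
    then have "f (r + u) < f r" using x u by (smt (verit) mult_pos_neg)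
    moreover have "f r \<le> f (r + u)" by (rule min) (use u r in \<open>auto simp: e_def\<close>)
    ultimately show False by simp
  qed
qed

text \<open>The computation behind the minimum principle. With \<open>h\<^sub>t\<close> and \<open>y\<^sub>t\<close> replaced by the right-hand sides of
their evolution equations, the left-hand side is the time derivative of
\<open>z = y + \<epsilon> (h\<^sup>2 + 2 N t) + \<epsilon> / h\<close>. On the right, the terms up to the one with the factor \<open>N - 3\<close>
are \<open>L z\<close>, written with the second and first \<open>r\<close>-derivatives of \<open>z\<close>, and the rest is nonnegative when
\<open>0 < y \<le> 1/2\<close> and \<open>N \<ge> 3\<close>.\<close>

lemma barrier_identity:
  fixes N h q y y1 y2 q1 e :: real
  assumes "h \<noteq> 0" "q \<noteq> 0"
  shows "slope_rhs N h q q1 y y1 y2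
      + e * (2 * h * (y1 / q - (N - 2) * (1 - y\<^sup>2) / h) + 2 * N)
      - e * (y1 / q - (N - 2) * (1 - y\<^sup>2) / h) / h\<^sup>2
    = (y2 + e * (2 * q\<^sup>2 * y\<^sup>2 + 2 * h * q1 * y + 2 * h * q * y1)
        - e * (q1 * y / h\<^sup>2 + q * y1 / h\<^sup>2 - 2 * q\<^sup>2 * y\<^sup>2 / h^3)) / q\<^sup>2
      - (q1 / q^3) * (y1 + e * (2 * h * (q * y)) - e * (q * y) / h\<^sup>2)
      + (N - 3) * (y / (h * q)) * (y1 + e * (2 * h * (q * y)) - e * (q * y) / h\<^sup>2)
      + (N - 2) * (1 - y\<^sup>2) * y / h\<^sup>2 + e * (2 * N - 2 * (N - 2))
      + e / h^3 * (N - 2 - 3 * y\<^sup>2)"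
proof -
  define u p where "u = inverse h" "p = inverse q"
  have "h * u = 1" "q * p = 1" using assms by (auto simp: u_p_def)
  then show ?thesis
    unfolding slope_rhs_def divide_inverse inverse_mult_distrib power_inverse[symmetric] u_p_def[symmetric]
    by algebra
qed

text \<open>The minimum principle for the slope. If \<open>z = y + \<epsilon> (h\<^sup>2 + 2 N t) + \<epsilon> / h\<close> were below \<open>c\<close>
somewhere, it would attain a minimum below \<open>c\<close> on a compact rectangle, away from the spatial ends, where
one of the two barriers alone exceeds \<open>c\<close>, and after the initial time slab. At that
point \<open>z\<^sub>t \<le> 0 \<le> L z\<close>, against the strict inequality of the barrier identity. Letting \<open>\<epsilon>\<close>
tend to zero gives the bound for \<open>y\<close>.\<close>

lemma slope_lower_bound:
  fixes h q y q1 y1 y2 :: "real \<Rightarrow> real \<Rightarrow> real" and N Cm Cp c T :: real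
  assumes N: "N \<ge> 3" and c: "0 < c" "c \<le> 1/2" and C: "0 < Cm"
    and pos: "\<And>t r. 0 < t \<Longrightarrow> t \<le> T \<Longrightarrow> 0 < r \<Longrightarrow> q t r > 0 \<and> y t r > 0"
    and h_bnd: "\<And>t r. 0 < t \<Longrightarrow> t \<le> T \<Longrightarrow> 0 < r \<Longrightarrow> Cm * r \<le> h t r \<and> h t r \<le> Cp * r"
    and h_r: "\<And>t r. 0 < t \<Longrightarrow> t \<le> T \<Longrightarrow> 0 < r \<Longrightarrow>
                (h t has_real_derivative q t r * y t r) (at r)"
    and q_r: "\<And>t r. 0 < t \<Longrightarrow> t \<le> T \<Longrightarrow> 0 < r \<Longrightarrow> (q t has_real_derivative q1 t r) (at r)"
    and y_r: "\<And>t r. 0 < t \<Longrightarrow> t \<le> T \<Longrightarrow> 0 < r \<Longrightarrow> (y t has_real_derivative y1 t r) (at r)"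
    and y_rr: "\<And>t r. 0 < t \<Longrightarrow> t \<le> T \<Longrightarrow> 0 < r \<Longrightarrow> (y1 t has_real_derivative y2 t r) (at r)"
    and h_t: "\<And>t r. 0 < t \<Longrightarrow> t \<le> T \<Longrightarrow> 0 < r \<Longrightarrow> ((\<lambda>t. h t r) has_real_derivative
                y1 t r / q t r - (N - 2) * (1 - (y t r)\<^sup>2) / h t r) (at t)"
    and y_t: "\<And>t r. 0 < t \<Longrightarrow> t \<le> T \<Longrightarrow> 0 < r \<Longrightarrow> ((\<lambda>t. y t r) has_real_derivative
                slope_rhs N (h t r) (q t r) (q1 t r) (y t r) (y1 t r) (y2 t r)) (at t)"
    and cont_h: "continuous_on ({0<..T} \<times> {0<..}) (\<lambda>(t, r). h t r)"
    and cont_y: "continuous_on ({0<..T} \<times> {0<..}) (\<lambda>(t, r). y t r)"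
    and init: "\<And>R. R > 1 \<Longrightarrow> \<exists>t1>0. \<forall>t r. 0 < t \<and> t \<le> t1 \<and> t \<le> T \<and> 1/R \<le> r \<and> r \<le> R \<longrightarrow> c \<le> y t r"
    and t0: "0 < t0" "t0 \<le> T" and r0: "0 < r0"
  shows "c \<le> y t0 r0"
proof -
  have hpos: "h t r > 0" if "0 < t" "t \<le> T" "0 < r" for t r
    using h_bnd[OF that] C that by (smt (verit) mult_pos_pos)
  have Cp: "Cp > 0"
    using h_bnd[OF t0 r0] hpos[OF t0 r0] r0 by (smt (verit) zero_less_mult_pos2)
  define z where "z e t r = y t r + e * ((h t r)\<^sup>2 + 2 * N * t) + e / h t r" for e t r
  have main: "c \<le> z e t0 r0" if e: "e > 0" for e
  proof (rule ccontr)
    assume neg: "\<not> c \<le> z e t0 r0"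
    \<comment> \<open>Beyond \<open>R\<close> the barrier \<open>\<epsilon> h\<^sup>2\<close> alone exceeds \<open>c\<close>, and below \<open>1/R\<close> the barrier \<open>\<epsilon> / h\<close>.\<close>
    define R where "R = 2 + r0 + 1 / r0 + sqrt (c / e) / Cm + Cp * c / e"
    have nn: "0 < 1/r0" "0 \<le> sqrt (c / e) / Cm" "0 \<le> Cp * c / e"
      using e c C Cp r0 by auto
    then have R: "R > 1" "r0 < R" "1 / r0 < R" "sqrt (c / e) / Cm < R" "Cp * c / e < R"
      using r0 unfolding R_def by linarith+
    have r0': "1 / R < r0" using R r0 by (simp add: field_simps)
    obtain t1 where t1: "t1 > 0"
      "\<And>t r. 0 < t \<Longrightarrow> t \<le> t1 \<Longrightarrow> t \<le> T \<Longrightarrow> 1/R \<le> r \<Longrightarrow> r \<le> R \<Longrightarrow> c \<le> y t r"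
      using init[OF R(1)] by auto
    have zy: "y t r \<le> z e t r" if "0 < t" "t \<le> T" "0 < r" for t r
    proof -
      have "0 \<le> e * ((h t r)\<^sup>2 + 2 * N * t)" "0 \<le> e / h t r"
        using e that N hpos[OF that] by auto
      then show ?thesis by (simp add: z_def)
    qed
    have "t1 < t0"
    proof (rule ccontr)
      assume "\<not> t1 < t0"
      then have "c \<le> y t0 r0" using t1(2)[of t0 r0] t0 r0' R by auto
      then show False using zy[OF t0 r0] neg by linarith
    qed
    define K where "K = {t1..T} \<times> {1/R..R}"
    have Ksub: "K \<subseteq> {0<..T} \<times> {0<..}"
      unfolding K_def using t1(1) R(1) by (auto simp: field_simps intro: less_le_trans[of 0 "1/R"])
    have "continuous_on K (\<lambda>p. z e (fst p) (snd p))"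
    proof -
      have "continuous_on K (\<lambda>p. h (fst p) (snd p))" "continuous_on K (\<lambda>p. y (fst p) (snd p))"
        using continuous_on_subset[OF cont_h Ksub] continuous_on_subset[OF cont_y Ksub]
        by (simp_all add: case_prod_beta')
      moreover have "h (fst p) (snd p) \<noteq> 0" if "p \<in> K" for p
        using hpos[of "fst p" "snd p"] Ksub that by (cases p) fastforce
      ultimately show ?thesis unfolding z_def by (intro continuous_intros) auto
    qed
    moreover have "compact K" unfolding K_def by (intro compact_Times compact_Icc)
    moreover have inK: "(t0, r0) \<in> K" using t0 \<open>t1 < t0\<close> r0' R by (auto simp: K_def)
    ultimately obtain p where p: "p \<in> K" "\<And>p'. p' \<in> K \<Longrightarrow> z e (fst p) (snd p) \<le> z e (fst p') (snd p')"
      using continuous_attains_inf[of K "\<lambda>p. z e (fst p) (snd p)"] by blast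
    obtain t r where tr: "p = (t, r)" by (cases p)
    have tr_in: "t1 \<le> t" "t \<le> T" "1/R \<le> r" "r \<le> R" using p(1) by (auto simp: K_def tr)
    have t: "0 < t" and r: "0 < r" using Ksub p(1) tr by auto
    note P = t tr_in(2) r
    have min: "z e t r \<le> z e t' r'" if "t1 \<le> t'" "t' \<le> T" "1/R \<le> r'" "r' \<le> R" for t' r'
      using p(2)[of "(t', r')"] that by (auto simp: K_def tr)
    have zc: "z e t r < c" using min[of t0 r0] inK neg by (auto simp: K_def)
    have yc: "y t r < c" using zy[OF P] zc by simp
    have "t1 < t" using t1(2)[of t r] t tr_in yc by (cases "t1 < t") auto
    have barrier: "c \<le> z e t r" if "c \<le> e * (h t r)\<^sup>2 \<or> c \<le> e / h t r"
    proof -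
      have "0 < y t r" "0 \<le> e * (h t r)\<^sup>2" "0 \<le> e * (2 * N * t)" "0 \<le> e / h t r"
        using pos[OF P] e N t hpos[OF P] by auto
      then show ?thesis using that unfolding z_def distrib_left by linarith
    qed
    have "r \<noteq> R"
    proof
      assume "r = R"
      then have "sqrt (c / e) \<le> Cm * r" using R(4) C by (simp add: field_simps)
      also have "\<dots> \<le> h t r" using h_bnd[OF P] by simp
      finally have "c / e \<le> (h t r)\<^sup>2" by (rule sqrt_le_D)
      then have "c \<le> e * (h t r)\<^sup>2" using e by (simp add: field_simps)
      then show False using barrier zc by auto
    qed
    have "r \<noteq> 1/R"
    proof
      assume "r = 1/R"
      then have "h t r \<le> Cp / R" using h_bnd[OF P] by simp
      also have "\<dots> \<le> e / c" using R(1,5) e c by (simp add: field_simps)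
      finally have "c \<le> e / h t r" using hpos[OF P] c by (simp add: field_simps)
      then show False using barrier zc by auto
    qed
    with \<open>r \<noteq> R\<close> tr_in have rr: "1/R < r" "r < R" by auto
    define ht where "ht = y1 t r / q t r - (N - 2) * (1 - (y t r)\<^sup>2) / h t r"
    define yt where "yt = slope_rhs N (h t r) (q t r) (q1 t r) (y t r) (y1 t r) (y2 t r)"
    define z1 where "z1 r = y1 t r + e * (2 * h t r * (q t r * y t r)) - e * (q t r * y t r) / (h t r)\<^sup>2" for r
    define z2 where "z2 = y2 t r + e * (2 * (q t r)\<^sup>2 * (y t r)\<^sup>2 + 2 * h t r * q1 t r * y t r
         + 2 * h t r * q t r * y1 t r)
       - e * (q1 t r * y t r / (h t r)\<^sup>2 + q t r * y1 t r / (h t r)\<^sup>2 - 2 * (q t r)\<^sup>2 * (y t r)\<^sup>2 / (h t r)^3)"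
    have h0: "h t r > 0" "q t r > 0" "y t r > 0" using hpos[OF P] pos[OF P] by auto
    have dt: "((\<lambda>t. z e t r) has_real_derivative yt + e * (2 * h t r * ht + 2 * N) - e * ht / (h t r)\<^sup>2) (at t)"
    proof -
      have *: "((\<lambda>t. h t r) has_real_derivative ht) (at t)" "((\<lambda>t. y t r) has_real_derivative yt) (at t)"
        using h_t[OF P] y_t[OF P] by (simp_all add: ht_def yt_def)
      have **: "h t r \<noteq> 0" using h0 by simp
      show ?thesis unfolding z_def
        by (rule derivative_eq_intros * ** refl)+
          (use h0 in \<open>auto simp: field_simps power2_eq_square\<close>)
    qed
    have dr: "(z e t has_real_derivative z1 x) (at x)" if x: "0 < x" for x
    proof -
      have **: "h t x \<noteq> 0" using hpos[OF P(1,2) x] by simp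
      show ?thesis unfolding z_def z1_def
      by (rule derivative_eq_intros ** h_r[OF P(1,2) x] y_r[OF P(1,2) x] refl)+
        (use hpos[OF P(1,2) x] in \<open>auto simp: field_simps power2_eq_square\<close>)
    qed
    have drr: "(z1 has_real_derivative z2) (at r)"
    proof -
      have **: "(h t r)\<^sup>2 \<noteq> 0" using h0 by simp
      show ?thesis unfolding z1_def z2_def
      by (rule derivative_eq_intros ** h_r[OF P] y_r[OF P] q_r[OF P] y_rr[OF P] refl)+
        (use h0 in \<open>auto simp: field_simps power2_eq_square power3_eq_cube\<close>)
    qed
    have "yt + e * (2 * h t r * ht + 2 * N) - e * ht / (h t r)\<^sup>2 \<le> 0"
      by (rule interior_min_time[OF dt \<open>t1 < t\<close>]) (use min tr_in in auto)
    moreover have Rp: "0 < 1/R" using R by auto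
    have "z1 r = 0" "z2 \<ge> 0"
      using interior_min_space[of "1/R" R "z e t" z1 z2 r] dr drr rr min tr_in Rp by force+
    moreover have "yt + e * (2 * h t r * ht + 2 * N) - e * ht / (h t r)\<^sup>2
       = z2 / (q t r)\<^sup>2 - (q1 t r / (q t r)^3) * z1 r + (N - 3) * (y t r / (h t r * q t r)) * z1 r
         + (N - 2) * (1 - (y t r)\<^sup>2) * y t r / (h t r)\<^sup>2 + e * (2 * N - 2 * (N - 2))
         + e / (h t r)^3 * (N - 2 - 3 * (y t r)\<^sup>2)"
      unfolding yt_def ht_def z1_def z2_def by (rule barrier_identity) (use h0 in auto)
    moreover have "(y t r)\<^sup>2 \<le> (1/2)\<^sup>2" using yc c h0 by (intro power_mono) auto
    then have "(y t r)\<^sup>2 \<le> 1/4" by (simp add: power2_eq_square)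
    then have "(N - 2) * (1 - (y t r)\<^sup>2) * y t r / (h t r)\<^sup>2 \<ge> 0"
        "e / (h t r)^3 * (N - 2 - 3 * (y t r)\<^sup>2) \<ge> 0"
      using h0 N e by (auto intro!: divide_nonneg_nonneg mult_nonneg_nonneg)
    moreover have "e * (2 * N - 2 * (N - 2)) > 0" using e by simp
    moreover have "z2 / (q t r)\<^sup>2 \<ge> 0" using \<open>z2 \<ge> 0\<close> by simp
    ultimately show False using \<open>z1 r = 0\<close> by (simp del: times_divide_eq_right times_divide_eq_left)
  qed
  have "((\<lambda>e. z e t0 r0) \<longlongrightarrow> y t0 r0 + 0 * ((h t0 r0)\<^sup>2 + 2 * N * t0) + 0 / h t0 r0) (at_right 0)"
    unfolding z_def using hpos[OF t0 r0] by (intro tendsto_intros) auto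
  then have "((\<lambda>e. z e t0 r0) \<longlongrightarrow> y t0 r0) (at_right 0)" by simp
  then show ?thesis
    by (rule tendsto_lowerbound) (auto simp: eventually_at_right_less eventually_at_filter main)
qed

section \<open>Ricci curvature of rotationally symmetric metrics\<close>

lemma dderiv_cong:
  assumes "open U" "x \<in> U" "\<And>y. y \<in> U \<Longrightarrow> F y = G y"
  shows "dderiv v F x = dderiv v G x"
proof -
  have "((\<lambda>s. x + s *\<^sub>R v) \<longlongrightarrow> x + 0 *\<^sub>R v) (nhds (0::real))"
    by (intro tendsto_intros filterlim_ident)
  then have "\<forall>\<^sub>F s in nhds (0::real). x + s *\<^sub>R v \<in> U"
    using assms(1,2) by (auto simp: tendsto_def)
  then have ev: "\<forall>\<^sub>F s in nhds (0::real). F (x + s *\<^sub>R v) = G (x + s *\<^sub>R v)"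
    by eventually_elim (rule assms(3))
  then have "((\<lambda>s. F (x + s *\<^sub>R v)) has_vector_derivative D) (at 0) \<longleftrightarrow>
     ((\<lambda>s. G (x + s *\<^sub>R v)) has_vector_derivative D) (at 0)" for D
    by (intro has_vector_derivative_cong_ev refl) (use assms in \<open>auto elim: eventually_mono\<close>)
  then show ?thesis unfolding dderiv_def vector_derivative_def by simp
qed

lemma dderiv_eq:
  assumes "(F has_derivative F') (at x)"
  shows "dderiv v F x = F' v"
proof -
  have "((\<lambda>s. F (x + s *\<^sub>R v)) has_derivative (\<lambda>s. F' (s *\<^sub>R v))) (at 0)"
    by (rule has_derivative_compose[of "\<lambda>s. x + s *\<^sub>R v" "\<lambda>s. s *\<^sub>R v" _ _ F])
      (auto intro!: derivative_eq_intros simp: assms)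
  moreover have "F' (s *\<^sub>R v) = s *\<^sub>R F' v" for s
    using assms has_derivative_bounded_linear linear_simps(5) by blast
  ultimately show ?thesis
    unfolding dderiv_def by (intro vector_derivative_at) (simp add: has_vector_derivative_def)
qed

lemma pd_eqI:
  fixes F :: "real^'n::finite \<Rightarrow> real"
  assumes "((\<lambda>s. F (x + s *\<^sub>R axis i 1)) has_real_derivative D) (at 0)"
  shows "pd i F x = D"
  using assms unfolding pd_def dderiv_def
  by (intro vector_derivative_at) (simp add: has_real_derivative_iff_has_vector_derivative)

lemma pd_cong:
  fixes F G :: "real^'n::finite \<Rightarrow> real"
  assumes "open U" "x \<in> U" "\<And>y. y \<in> U \<Longrightarrow> F y = G y"
  shows "pd i F x = pd i G x"
  unfolding pd_def by (rule dderiv_cong[OF assms])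

text \<open>The Kronecker symbol, kept opaque so that the simplifier contracts sums against it instead of splitting cases.\<close>

definition kd :: "'n \<Rightarrow> 'n \<Rightarrow> real" where
  "kd i j = (if i = j then 1 else 0)"

lemma kd_sym: "kd i j = kd j i"
  by (auto simp: kd_def)

lemma sum_kd [simp]:
  fixes i :: "'n::finite"
  shows "(\<Sum>l\<in>UNIV. kd l i * f l) = f i" "(\<Sum>l\<in>UNIV. kd i l * f l) = f i"
    "(\<Sum>l\<in>UNIV. f l * kd l i) = f i" "(\<Sum>l\<in>UNIV. f l * kd i l) = f i"
  by (simp_all add: kd_def if_distrib if_distribR cong: if_cong)

lemma sum_kd_diag [simp]: "(\<Sum>l\<in>(UNIV::'n::finite set). kd l l) = real CARD('n)"
  by (simp add: kd_def)

lemma sum_coord_sq: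
  fixes x :: "real^'n::finite"
  shows "(\<Sum>l\<in>UNIV. x $ l * x $ l) = (norm x)\<^sup>2"
  by (simp add: norm_vec_def L2_set_def sum_nonneg power2_eq_square)

lemma coord_deriv [derivative_intros]:
  fixes x :: "real^'n::finite"
  shows "((\<lambda>s. (x + s *\<^sub>R axis i 1) $ j) has_real_derivative kd i j) (at s)"
  by (auto intro!: derivative_eq_intros simp: axis_def kd_def)

lemma radial_deriv:
  fixes x :: "real^'n::finite"
  assumes "x \<noteq> 0" "(f has_real_derivative f1) (at (norm x))"
  shows "((\<lambda>s. f (norm (x + s *\<^sub>R axis i 1))) has_real_derivative f1 * (x $ i / norm x)) (at 0)"
proof -
  have n: "(norm has_derivative (\<lambda>v. v \<bullet> sgn x)) (at (x + 0 *\<^sub>R axis i (1::real)))"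
    using has_derivative_norm[OF assms(1)] by simp
  have "((\<lambda>s::real. x + s *\<^sub>R axis i (1::real)) has_derivative (\<lambda>s. s *\<^sub>R axis i 1)) (at 0)"
    by (auto intro!: derivative_eq_intros)
  from has_derivative_compose[OF this n]
  have "((\<lambda>s. norm (x + s *\<^sub>R axis i 1)) has_real_derivative (x $ i / norm x)) (at 0)"
    unfolding has_field_derivative_def
    by (rule has_derivative_eq_rhs) (auto simp: inner_axis' sgn_div_norm divide_inverse)
  then show ?thesis
    using assms(2) by (intro DERIV_chain'[where f="\<lambda>s. norm (x + s *\<^sub>R axis i 1)"]) auto
qed

text \<open>A one-sided inverse of a square matrix is two-sided, hence equal to the chosen inverse.\<close>

lemma matrix_inv_eqI:
  fixes A B :: "real^'n::finite^'n"
  assumes "A ** B = mat 1"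
  shows "matrix_inv A = B"
proof -
  have inv: "A ** B = mat 1 \<and> B ** A = mat 1"
    using assms matrix_left_right_inverse by auto
  then have "A ** matrix_inv A = mat 1 \<and> matrix_inv A ** A = mat 1"
    unfolding matrix_inv_def by (rule someI)
  then show ?thesis
    using inv by (metis matrix_mul_assoc matrix_mul_lid matrix_mul_rid)
qed

lemma mat_1_nth: "mat 1 $ i $ j = kd i j"
  by (simp add: mat_def kd_def)

text \<open>Metrics \<open>A \<delta>\<^sub>i\<^sub>j + B x\<^sub>i x\<^sub>j\<close> are rank-one perturbations of a multiple of the identity, so the inverse
is of the same form (Sherman--Morrison); \<open>A + |x|\<^sup>2 B\<close> is the eigenvalue in the radial direction.\<close>

lemma ginv_radial:
  fixes g :: "'n::finite metric"
  assumes g: "\<And>i j. g x $ i $ j = A * kd i j + B * x $ i * x $ j"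
    and nz: "A \<noteq> 0" "A + (norm x)\<^sup>2 * B \<noteq> 0"
  shows "ginv g x $ i $ j = kd i j / A - B / (A * (A + (norm x)\<^sup>2 * B)) * x $ i * x $ j"
proof -
  define C where "C = A + (norm x)\<^sup>2 * B"
  have C: "C \<noteq> 0" using nz by (simp add: C_def)
  define M :: "real^'n^'n" where "M = (\<chi> i j. kd i j / A - B / (A * C) * x $ i * x $ j)"
  have "g x ** M = mat 1"
  proof (simp add: vec_eq_iff matrix_matrix_mult_def mat_1_nth, intro allI)
    fix i j
    have "(\<Sum>k\<in>UNIV. g x $ i $ k * M $ k $ j) =
      (\<Sum>k\<in>UNIV. kd i k * (kd k j - B / C * x $ k * x $ j) + (kd k j * (B / A * x $ i * x $ k))
        - B / A * (B / C) * x $ i * x $ j * (x $ k * x $ k))"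
      using nz C by (intro sum.cong refl) (simp add: g M_def field_simps)
    also have "\<dots> = kd i j - B / C * x $ i * x $ j + B / A * x $ i * x $ j
        - B / A * (B / C) * x $ i * x $ j * (norm x)\<^sup>2"
      by (simp only: sum.distrib sum_subtractf sum_distrib_left[symmetric] sum_coord_sq sum_kd)
    also have "\<dots> = kd i j + B * x $ i * x $ j / (A * C) * (C - A - (norm x)\<^sup>2 * B)"
      using nz C by (simp add: field_simps)
    finally show "(\<Sum>k\<in>UNIV. g x $ i $ k * M $ k $ j) = kd i j" by (simp add: C_def)
  qed
  then show ?thesis
    unfolding ginv_def C_def[symmetric] by (simp add: matrix_inv_eqI M_def)
qed

lemma pd_metric_radial:
  fixes g :: "'n::finite metric"
  assumes g: "\<And>y i j. y \<noteq> 0 \<Longrightarrow> g y $ i $ j = A (norm y) * kd i j + B (norm y) * y $ i * y $ j"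
    and x: "x \<noteq> 0" and d: "(A has_real_derivative A1) (at (norm x))"
      "(B has_real_derivative B1) (at (norm x))"
  shows "pd m (\<lambda>y. g y $ i $ j) x = A1 / norm x * x $ m * kd i j + B1 / norm x * x $ m * x $ i * x $ j
    + B (norm x) * (kd m i * x $ j + kd m j * x $ i)"
proof -
  have "pd m (\<lambda>y. g y $ i $ j) x = pd m (\<lambda>y. A (norm y) * kd i j + B (norm y) * y $ i * y $ j) x"
    by (rule pd_cong[of "- {0}"]) (use x g in auto)
  also have "\<dots> = A1 / norm x * x $ m * kd i j + B1 / norm x * x $ m * x $ i * x $ j
    + B (norm x) * (kd m i * x $ j + kd m j * x $ i)"
    by (rule pd_eqI) (auto intro!: derivative_eq_intros radial_deriv[OF x d(1)] radial_deriv[OF x d(2)]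
        simp: algebra_simps simp del: vector_add_component vector_scaleR_component)
  finally show ?thesis .
qed

lemma christoffel_identity:
  fixes r A B A1 B1 C a b c kij klj kli :: real
  assumes "C = A + r\<^sup>2 * B" "r \<noteq> 0" "A \<noteq> 0" "C \<noteq> 0"
  shows "(1/2) * ((A1 / r * (a * klj + b * kli - c * kij) + B1 / r * a * b * c + 2 * B * kij * c) / A
     - B / (A * C) * c * (A1 / r * a * b + A1 / r * b * a + (- A1 / r * kij + B1 / r * a * b + 2 * B * kij) * r\<^sup>2))
    = A1 / (2 * r * A) * (a * klj + b * kli) + (B - A1 / (2 * r)) / C * c * kij
     + (A * B1 - 2 * A1 * B) / (2 * r * A * C) * a * b * c"
proof -
  have B: "B = (C - A) / r\<^sup>2" using assms by simp
  show ?thesis using assms(2-) unfolding B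
    by (simp add: divide_simps) (simp add: algebra_simps power2_eq_square)
qed
text \<open>By rotational symmetry \<open>\<Gamma>\<^sup>l\<^sub>i\<^sub>j\<close> is a combination of \<open>x\<^sub>i \<delta>\<^sub>l\<^sub>j + x\<^sub>j \<delta>\<^sub>l\<^sub>i\<close>, \<open>x\<^sub>l \<delta>\<^sub>i\<^sub>j\<close> and
\<open>x\<^sub>i x\<^sub>j x\<^sub>l\<close> with radial coefficients, which are read off after contracting with the inverse metric.\<close>

lemma christoffel_radial:
  fixes g :: "'n::finite metric"
  assumes g: "\<And>y i j. y \<noteq> 0 \<Longrightarrow> g y $ i $ j = A (norm y) * kd i j + B (norm y) * y $ i * y $ j"
    and x: "x \<noteq> 0" and r: "r = norm x"
    and d: "(A has_real_derivative A1) (at r)" "(B has_real_derivative B1) (at r)"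
    and nz: "A r \<noteq> 0" "A r + r\<^sup>2 * B r \<noteq> 0"
  shows "christoffel g l i j x =
      A1 / (2 * r * A r) * (x $ i * kd l j + x $ j * kd l i)
    + (B r - A1 / (2 * r)) / (A r + r\<^sup>2 * B r) * x $ l * kd i j
    + (A r * B1 - 2 * A1 * B r) / (2 * r * A r * (A r + r\<^sup>2 * B r)) * x $ i * x $ j * x $ l"
proof -
  define C where "C = A r + r\<^sup>2 * B r"
  have C: "C \<noteq> 0" using nz by (simp add: C_def)
  have r0: "r \<noteq> 0" using x r by simp
  define X where "X m = A1 / r * (x $ i * kd m j + x $ j * kd m i - x $ m * kd i j)
      + B1 / r * x $ i * x $ j * x $ m + 2 * B r * kd i j * x $ m" for m
  have X: "pd i (\<lambda>y. g y $ m $ j) x + pd j (\<lambda>y. g y $ i $ m) x - pd m (\<lambda>y. g y $ i $ j) x = X m" for m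
  proof -
    have PD: "pd m (\<lambda>y. g y $ i $ j) x = A1 / r * x $ m * kd i j + B1 / r * x $ m * x $ i * x $ j
        + B r * (kd m i * x $ j + kd m j * x $ i)" for m i j
      unfolding r by (rule pd_metric_radial[where A=A and B=B]) (use g x d r in auto)
    show ?thesis
      unfolding PD X_def by (simp add: kd_sym[of i m] kd_sym[of j m] kd_sym[of j i] algebra_simps)
  qed
  have gi: "ginv g x $ l $ m = kd l m / A r - B r / (A r * C) * x $ l * x $ m" for m
    unfolding C_def r by (rule ginv_radial) (use g x nz r in auto)
  have "(\<Sum>m\<in>UNIV. x $ m * X m) = (\<Sum>m\<in>UNIV. A1 / r * x $ i * (x $ m * kd m j) + A1 / r * x $ j * (x $ m * kd m i)
      + (- A1 / r * kd i j + B1 / r * x $ i * x $ j + 2 * B r * kd i j) * (x $ m * x $ m))"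
    by (intro sum.cong refl) (simp add: X_def algebra_simps)
  also have "\<dots> = A1 / r * x $ i * x $ j + A1 / r * x $ j * x $ i
      + (- A1 / r * kd i j + B1 / r * x $ i * x $ j + 2 * B r * kd i j) * r\<^sup>2"
    by (simp add: sum.distrib sum_distrib_left[symmetric] sum_coord_sq r del: times_divide_eq_left)
  finally have S: "(\<Sum>m\<in>UNIV. x $ m * X m) = \<dots>" .
  have "christoffel g l i j x = (1/2) * (\<Sum>m\<in>UNIV. kd l m * (X m / A r) - B r / (A r * C) * x $ l * (x $ m * X m))"
    unfolding christoffel_def X gi by (intro arg_cong2[where f="(*)"] sum.cong refl) (simp add: algebra_simps)
  also have "\<dots> = (1/2) * (X l / A r - B r / (A r * C) * x $ l * (\<Sum>m\<in>UNIV. x $ m * X m))"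
    by (simp only: sum_subtractf sum_distrib_left[symmetric] sum_kd)
  also have "\<dots> = A1 / (2 * r * A r) * (x $ i * kd l j + x $ j * kd l i)
    + (B r - A1 / (2 * r)) / C * x $ l * kd i j
    + (A r * B1 - 2 * A1 * B r) / (2 * r * A r * C) * x $ i * x $ j * x $ l"
    unfolding S unfolding X_def by (rule christoffel_identity[OF C_def r0 nz(1) C])
  finally show ?thesis unfolding C_def .
qed

text \<open>One contraction in the quadratic terms of the Ricci curvature, with one factor left arbitrary.\<close>

lemma sum_christoffel_product:
  fixes x :: "real^'n::finite"
  shows "(\<Sum>m\<in>UNIV. \<Phi> m * (P * (x $ i * kd m l + x $ l * kd m i) + Q * x $ m * kd i l + S * x $ i * x $ l * x $ m))
    = P * (x $ i * \<Phi> l + x $ l * \<Phi> i) + (Q * kd i l + S * x $ i * x $ l) * (\<Sum>m\<in>UNIV. \<Phi> m * x $ m)"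
proof -
  have "(\<Sum>m\<in>UNIV. \<Phi> m * (P * (x $ i * kd m l + x $ l * kd m i) + Q * x $ m * kd i l + S * x $ i * x $ l * x $ m))
    = (\<Sum>m\<in>UNIV. P * x $ i * (\<Phi> m * kd m l) + P * x $ l * (\<Phi> m * kd m i) + (Q * kd i l + S * x $ i * x $ l) * (\<Phi> m * x $ m))"
    by (intro sum.cong refl) (simp add: algebra_simps)
  also have "\<dots> = P * x $ i * \<Phi> l + P * x $ l * \<Phi> i + (Q * kd i l + S * x $ i * x $ l) * (\<Sum>m\<in>UNIV. \<Phi> m * x $ m)"
    by (simp add: sum.distrib sum_distrib_left[symmetric] mult.assoc)
  finally show ?thesis by (simp add: algebra_simps)
qed

text \<open>The Ricci curvature of a connection of the form found in \<open>christoffel_radial\<close>. The trace of the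
connection is \<open>V x\<^sub>i\<close>, and each of the four sums that define the curvature reduces to multiples of
\<open>\<delta>\<^sub>i\<^sub>j\<close> and \<open>x\<^sub>i x\<^sub>j\<close>.\<close>

lemma ricci_radial:
  fixes g :: "'n::finite metric"
  assumes \<Gamma>: "\<And>y l i j. y \<noteq> 0 \<Longrightarrow> christoffel g l i j y =
       P (norm y) * (y $ i * kd l j + y $ j * kd l i) + Q (norm y) * y $ l * kd i j
       + S (norm y) * y $ i * y $ j * y $ l"
    and x: "x \<noteq> 0" and r: "r = norm x"
    and d: "(P has_real_derivative P1) (at r)" "(Q has_real_derivative Q1) (at r)"
      "(S has_real_derivative S1) (at r)"
    and V: "V = (real CARD('n) + 1) * P r + Q r + r\<^sup>2 * S r"
    and V1: "V1 = (real CARD('n) + 1) * P1 + Q1 + 2 * r * S r + r\<^sup>2 * S1"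
  shows "ricci g i j x =
      (2 * P r + r * Q1 + real CARD('n) * Q r - V + V * Q r * r\<^sup>2 - 2 * P r * Q r * r\<^sup>2) * kd i j
    + (2 * P1 / r + r * S1 + (real CARD('n) + 2) * S r - V1 / r + V * (2 * P r + S r * r\<^sup>2)
       - ((real CARD('n) + 3) * (P r)\<^sup>2 + 2 * P r * Q r + 4 * P r * S r * r\<^sup>2 + (Q r)\<^sup>2
          + 2 * Q r * S r * r\<^sup>2 + (S r)\<^sup>2 * r^4)) * x $ i * x $ j"
proof -
  define n where "n = real CARD('n)"
  have r0: "r \<noteq> 0" using x r by simp
  have nr: "(\<Sum>l\<in>UNIV. x $ l * x $ l) = r\<^sup>2" by (simp add: sum_coord_sq r)
  have G: "christoffel g l i j x = P r * (x $ i * kd l j + x $ j * kd l i) + Q r * x $ l * kd i j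
       + S r * x $ i * x $ j * x $ l" for l i j
    using \<Gamma>[OF x] r by simp
  have pdG: "pd m (christoffel g l i j) x = P1 / r * x $ m * (x $ i * kd l j + x $ j * kd l i)
      + P r * (kd m i * kd l j + kd m j * kd l i) + Q1 / r * x $ m * x $ l * kd i j + Q r * kd m l * kd i j
      + S1 / r * x $ m * x $ i * x $ j * x $ l
      + S r * (kd m i * x $ j * x $ l + kd m j * x $ i * x $ l + kd m l * x $ i * x $ j)" for m l i j
  proof -
    have "pd m (christoffel g l i j) x = pd m (\<lambda>y. P (norm y) * (y $ i * kd l j + y $ j * kd l i) + Q (norm y) * y $ l * kd i j
       + S (norm y) * y $ i * y $ j * y $ l) x"
      by (rule pd_cong[of "- {0}"]) (use x \<Gamma> in auto)
    also have "\<dots> = P1 / r * x $ m * (x $ i * kd l j + x $ j * kd l i)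
      + P r * (kd m i * kd l j + kd m j * kd l i) + Q1 / r * x $ m * x $ l * kd i j + Q r * kd m l * kd i j
      + S1 / r * x $ m * x $ i * x $ j * x $ l
      + S r * (kd m i * x $ j * x $ l + kd m j * x $ i * x $ l + kd m l * x $ i * x $ j)"
      by (rule pd_eqI) (auto intro!: derivative_eq_intros d[unfolded r, THEN radial_deriv[OF x]]
        simp: r algebra_simps simp del: vector_add_component vector_scaleR_component)
    finally show ?thesis .
  qed
  have div: "(\<Sum>l\<in>UNIV. pd l (christoffel g l i j) x) = 
      2 * P1 / r * x $ i * x $ j + 2 * P r * kd i j + r * Q1 * kd i j + n * Q r * kd i j
      + r * S1 * x $ i * x $ j + (n + 2) * S r * x $ i * x $ j"
  proof -
    have "(\<Sum>l\<in>UNIV. pd l (christoffel g l i j) x) =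
      (\<Sum>l\<in>UNIV. P1 / r * x $ i * (x $ l * kd l j) + P1 / r * x $ j * (x $ l * kd l i) + 2 * P r * (kd l i * kd l j)
         + (Q1 / r * kd i j + S1 / r * x $ i * x $ j) * (x $ l * x $ l) + (Q r * kd i j + S r * x $ i * x $ j) * kd l l
         + S r * x $ j * (kd l i * x $ l) + S r * x $ i * (kd l j * x $ l))"
      by (intro sum.cong refl) (simp add: pdG algebra_simps)
    also have "\<dots> = P1 / r * x $ i * x $ j + P1 / r * x $ j * x $ i + 2 * P r * kd i j
         + (Q1 / r * kd i j + S1 / r * x $ i * x $ j) * r\<^sup>2 + (Q r * kd i j + S r * x $ i * x $ j) * n
         + S r * x $ j * x $ i + S r * x $ i * x $ j"
      by (simp only: sum.distrib sum_distrib_left[symmetric] nr n_def sum_kd sum_kd_diag)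
    also have "\<dots> = 2 * P1 / r * x $ i * x $ j + 2 * P r * kd i j + r * Q1 * kd i j + n * Q r * kd i j
      + r * S1 * x $ i * x $ j + (n + 2) * S r * x $ i * x $ j"
      using r0 by (simp add: field_simps power2_eq_square)
    finally show ?thesis .
  qed
  have tr: "(\<Sum>l\<in>UNIV. christoffel g l i l x) = V * x $ i" for i
  proof -
    have "(\<Sum>l\<in>UNIV. christoffel g l i l x) = (\<Sum>l\<in>UNIV. P r * x $ i * kd l l + P r * (x $ l * kd l i)
       + Q r * (x $ l * kd i l) + S r * x $ i * (x $ l * x $ l))"
      by (intro sum.cong refl) (simp add: G algebra_simps)
    also have "\<dots> = V * x $ i"
      by (simp only: sum.distrib sum_distrib_left[symmetric] nr V sum_kd sum_kd_diag) (simp add: algebra_simps)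
    finally show ?thesis .
  qed
  have dtr: "(\<Sum>l\<in>UNIV. pd j (christoffel g l i l) x) = V * kd i j + V1 / r * x $ i * x $ j"
  proof -
    have "(\<Sum>l\<in>UNIV. pd j (christoffel g l i l) x) = (\<Sum>l\<in>UNIV. (P1 / r * x $ j * x $ i + P r * kd i j) * kd l l
        + P1 / r * x $ j * (x $ l * kd l i) + P r * (kd j l * kd l i) + Q1 / r * x $ j * (x $ l * kd i l)
        + Q r * (kd j l * kd i l) + (S1 / r * x $ j * x $ i + S r * kd i j) * (x $ l * x $ l)
        + S r * x $ i * (kd j l * x $ l) + S r * x $ i * (kd j l * x $ l))"
      by (intro sum.cong refl) (simp add: pdG kd_sym[of j i] algebra_simps)
    also have "\<dots> = (P1 / r * x $ j * x $ i + P r * kd i j) * n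
        + P1 / r * x $ j * x $ i + P r * kd j i + Q1 / r * x $ j * x $ i
        + Q r * kd i j + (S1 / r * x $ j * x $ i + S r * kd i j) * r\<^sup>2
        + S r * x $ i * x $ j + S r * x $ i * x $ j"
      by (simp only: sum.distrib sum_distrib_left[symmetric] nr n_def sum_kd sum_kd_diag)
    also have "\<dots> = V * kd i j + V1 / r * x $ i * x $ j"
      using r0 by (simp add: V V1 n_def[symmetric] kd_sym[of j i] field_simps power2_eq_square)
    finally show ?thesis .
  qed
  have rad: "(\<Sum>l\<in>UNIV. x $ l * christoffel g l i j x) = 2 * P r * x $ i * x $ j + Q r * r\<^sup>2 * kd i j
       + S r * r\<^sup>2 * x $ i * x $ j" for i j
  proof -
    have "(\<Sum>l\<in>UNIV. x $ l * christoffel g l i j x) = (\<Sum>l\<in>UNIV. P r * x $ i * (x $ l * kd l j)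
       + P r * x $ j * (x $ l * kd l i) + (Q r * kd i j + S r * x $ i * x $ j) * (x $ l * x $ l))"
      by (intro sum.cong refl) (simp add: G algebra_simps)
    also have "\<dots> = 2 * P r * x $ i * x $ j + Q r * r\<^sup>2 * kd i j + S r * r\<^sup>2 * x $ i * x $ j"
      by (simp only: sum.distrib sum_distrib_left[symmetric] nr sum_kd) (simp add: algebra_simps)
    finally show ?thesis .
  qed
  have rad2: "(\<Sum>m\<in>UNIV. christoffel g l j m x * x $ m) = (P r + Q r + S r * r\<^sup>2) * x $ j * x $ l
        + P r * r\<^sup>2 * kd l j" for l
  proof -
    have "(\<Sum>m\<in>UNIV. christoffel g l j m x * x $ m) = (\<Sum>m\<in>UNIV. P r * x $ j * (kd l m * x $ m)
       + (P r * kd l j + S r * x $ j * x $ l) * (x $ m * x $ m) + Q r * x $ l * (kd j m * x $ m))"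
      by (intro sum.cong refl) (simp add: G algebra_simps)
    also have "\<dots> = (P r + Q r + S r * r\<^sup>2) * x $ j * x $ l + P r * r\<^sup>2 * kd l j"
      by (simp only: sum.distrib sum_distrib_left[symmetric] nr sum_kd) (simp add: algebra_simps)
    finally show ?thesis .
  qed
  have quad1: "(\<Sum>l\<in>UNIV. \<Sum>m\<in>UNIV. christoffel g l l m x * christoffel g m i j x)
     = V * (2 * P r * x $ i * x $ j + Q r * r\<^sup>2 * kd i j + S r * r\<^sup>2 * x $ i * x $ j)"
  proof -
    have "(\<Sum>l\<in>UNIV. \<Sum>m\<in>UNIV. christoffel g l l m x * christoffel g m i j x)
      = (\<Sum>m\<in>UNIV. \<Sum>l\<in>UNIV. christoffel g l l m x * christoffel g m i j x)"
      by (rule sum.swap)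
    also have "\<dots> = (\<Sum>m\<in>UNIV. (\<Sum>l\<in>UNIV. christoffel g l m l x) * christoffel g m i j x)"
      unfolding sum_distrib_right
      by (intro sum.cong refl arg_cong2[where f="(*)"]) (simp add: G kd_sym algebra_simps)
    also have "\<dots> = V * (\<Sum>m\<in>UNIV. x $ m * christoffel g m i j x)"
      unfolding tr by (simp add: sum_distrib_left mult.assoc)
    finally show ?thesis unfolding rad .
  qed
  have quad2: "(\<Sum>l\<in>UNIV. \<Sum>m\<in>UNIV. christoffel g l j m x * christoffel g m i l x)
     = ((n + 3) * (P r)\<^sup>2 + 2 * P r * Q r + 4 * P r * S r * r\<^sup>2 + (Q r)\<^sup>2
          + 2 * Q r * S r * r\<^sup>2 + (S r)\<^sup>2 * r^4) * x $ i * x $ j + 2 * P r * Q r * r\<^sup>2 * kd i j"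
  proof -
    have "(\<Sum>m\<in>UNIV. christoffel g l j m x * christoffel g m i l x) =
        P r * (x $ i * christoffel g l j l x + x $ l * christoffel g l j i x)
        + (Q r * kd i l + S r * x $ i * x $ l) * (\<Sum>m\<in>UNIV. christoffel g l j m x * x $ m)" for l
      unfolding G[of _ i l] by (rule sum_christoffel_product)
    then have "(\<Sum>l\<in>UNIV. \<Sum>m\<in>UNIV. christoffel g l j m x * christoffel g m i l x) =
      (\<Sum>l\<in>UNIV. P r * x $ i * christoffel g l j l x + P r * (x $ l * christoffel g l j i x)
         + Q r * (P r + Q r + S r * r\<^sup>2) * x $ j * (kd i l * x $ l) + Q r * P r * r\<^sup>2 * (kd i l * kd l j)
         + S r * x $ i * (P r + Q r + S r * r\<^sup>2) * x $ j * (x $ l * x $ l) + S r * x $ i * P r * r\<^sup>2 * (x $ l * kd l j))"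
      unfolding rad2 by (intro sum.cong refl) (simp add: algebra_simps)
    also have "\<dots> = P r * x $ i * (V * x $ j) + P r * (2 * P r * x $ j * x $ i + Q r * r\<^sup>2 * kd j i
       + S r * r\<^sup>2 * x $ j * x $ i)
         + Q r * (P r + Q r + S r * r\<^sup>2) * x $ j * x $ i + Q r * P r * r\<^sup>2 * kd i j
         + S r * x $ i * (P r + Q r + S r * r\<^sup>2) * x $ j * r\<^sup>2 + S r * x $ i * P r * r\<^sup>2 * x $ j"
      by (simp only: sum.distrib sum_distrib_left[symmetric] nr rad tr sum_kd)
    finally show ?thesis
      by (simp add: V n_def[symmetric] kd_sym[of j i] algebra_simps power2_eq_square power4_eq_xxxx)
  qed
  show ?thesis
    unfolding ricci_def div dtr quad1 quad2 n_def[symmetric]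
    by (simp add: algebra_simps)
qed

text \<open>The coefficients of \<open>ricci_radial\<close> for \<open>q\<^sup>2 dr\<^sup>2 + h\<^sup>2 g\<^sub>c\<^sub>a\<^sub>n\<close>. With \<open>\<nu> = x / r\<close> and the projection \<open>\<Pi>\<close> onto
its orthogonal complement, \<open>\<Gamma>\<^sup>l\<^sub>i\<^sub>j = a \<nu>\<^sub>i \<nu>\<^sub>j \<nu>\<^sub>l + b (\<nu>\<^sub>i \<Pi>\<^sub>j\<^sub>l + \<nu>\<^sub>j \<Pi>\<^sub>i\<^sub>l) + c \<nu>\<^sub>l \<Pi>\<^sub>i\<^sub>j\<close>,
which gives \<open>P\<close>, \<open>Q\<close> and \<open>S\<close>. The first value is the curvature in directions tangent to the
spheres, the second one the difference of the radial and the tangential curvatures divided by \<open>r\<^sup>2\<close>.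
As \<open>y1\<close> is the \<open>r\<close>-derivative of \<open>h1 / q\<close>, \<open>y1 / q\<close> is the second derivative of \<open>h\<close> with respect to
arc length.\<close>

lemma ricci_identities:
  fixes n r h q h1 q1 h2 q2 :: real
  assumes nz: "r \<noteq> 0" "h \<noteq> 0" "q \<noteq> 0"
  defines "a \<equiv> q1 / q" and "b \<equiv> h1 / h - 1 / r" and "c \<equiv> 1 / r - h * h1 / (r\<^sup>2 * q\<^sup>2)"
    and "a1 \<equiv> q2 / q - q1\<^sup>2 / q\<^sup>2" and "b1 \<equiv> h2 / h - h1\<^sup>2 / h\<^sup>2 + 1 / r\<^sup>2"
    and "c1 \<equiv> - 1 / r\<^sup>2 - (h1\<^sup>2 + h * h2) / (r\<^sup>2 * q\<^sup>2) + 2 * h * h1 / (r^3 * q\<^sup>2)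
           + 2 * h * h1 * q1 / (r\<^sup>2 * q^3)"
  defines "P \<equiv> b / r" and "Q \<equiv> c / r" and "S \<equiv> (a - 2 * b - c) / r^3"
    and "P1 \<equiv> b1 / r - b / r\<^sup>2" and "Q1 \<equiv> c1 / r - c / r\<^sup>2"
    and "S1 \<equiv> (a1 - 2 * b1 - c1) / r^3 - 3 * (a - 2 * b - c) / r^4"
  defines "V \<equiv> (n + 1) * P + Q + r\<^sup>2 * S" and "V1 \<equiv> (n + 1) * P1 + Q1 + 2 * r * S + r\<^sup>2 * S1"
    and "y1 \<equiv> (h2 - h1 * q1 / q) / q"
  shows "2 * P + r * Q1 + n * Q - V + V * Q * r\<^sup>2 - 2 * P * Q * r\<^sup>2
      = ((n - 2) * (1 - (h1 / q)\<^sup>2) - h * y1 / q) / r\<^sup>2" (is ?normal)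
    and "2 * P1 / r + r * S1 + (n + 2) * S - V1 / r + V * (2 * P + S * r\<^sup>2)
       - ((n + 3) * P\<^sup>2 + 2 * P * Q + 4 * P * S * r\<^sup>2 + Q\<^sup>2 + 2 * Q * S * r\<^sup>2 + S\<^sup>2 * r^4)
      = (- (n - 1) * q * y1 / h - ((n - 2) * (1 - (h1 / q)\<^sup>2) - h * y1 / q) / r\<^sup>2) / r\<^sup>2" (is ?tangent)
proof -
  define u p w where "u = inverse h" "p = inverse q" "w = inverse r"
  have inv: "h * u = 1" "q * p = 1" "r * w = 1" using nz by (auto simp: u_p_w_def)
  show ?normal
    unfolding V_def V1_def P_def Q_def S_def P1_def Q1_def S1_def a_def b_def c_def a1_def b1_def c1_def y1_def
      divide_inverse inverse_mult_distrib power_inverse[symmetric] u_p_w_def[symmetric]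
    using inv by algebra
  show ?tangent
    unfolding V_def V1_def P_def Q_def S_def P1_def Q1_def S1_def a_def b_def c_def a1_def b1_def c1_def y1_def
      divide_inverse inverse_mult_distrib power_inverse[symmetric] u_p_w_def[symmetric]
    using inv by algebra
qed

text \<open>The classical formula for warped products: in terms of the arc length \<open>s\<close> the radial Ricci curvature is
\<open>- (n-1) h\<^sub>s\<^sub>s / h\<close> and the tangential one is \<open>((n-2) (1 - h\<^sub>s\<^sup>2) - h h\<^sub>s\<^sub>s) / h\<^sup>2\<close>; the factors
\<open>q\<^sup>2\<close> and \<open>h\<^sup>2 / r\<^sup>2\<close> of the metric turn them into Cartesian components.\<close>

lemma ricci_rotationally_symmetric:
  fixes g :: "'n::finite metric" and q h :: "real \<Rightarrow> real"
  assumes g: "\<And>y i j. y \<noteq> 0 \<Longrightarrow> g y $ i $ j = (q (norm y))\<^sup>2 * (y $ i * y $ j / (norm y)\<^sup>2)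
        + (h (norm y))\<^sup>2 / (norm y)\<^sup>2 * (kd i j - y $ i * y $ j / (norm y)\<^sup>2)"
    and pos: "\<And>r. r > 0 \<Longrightarrow> q r > 0 \<and> h r > 0"
    and h1: "\<And>r. r > 0 \<Longrightarrow> (h has_real_derivative h1 r) (at r)"
    and h2: "\<And>r. r > 0 \<Longrightarrow> (h1 has_real_derivative h2 r) (at r)"
    and q1: "\<And>r. r > 0 \<Longrightarrow> (q has_real_derivative q1 r) (at r)"
    and q2: "\<And>r. r > 0 \<Longrightarrow> (q1 has_real_derivative q2 r) (at r)"
    and x: "x \<noteq> 0" and r: "r = norm x" and y1: "y1 = (h2 r - h1 r * q1 r / q r) / q r"
  shows "ricci g i j x = - (real CARD('n) - 1) * q r * y1 / h r * (x $ i * x $ j / r\<^sup>2)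
    + ((real CARD('n) - 2) * (1 - (h1 r / q r)\<^sup>2) - h r * y1 / q r) / r\<^sup>2 * (kd i j - x $ i * x $ j / r\<^sup>2)"
proof -
  define A B where "A r = (h r)\<^sup>2 / r\<^sup>2" and "B r = ((q r)\<^sup>2 - A r) / r\<^sup>2" for r
  define A1 B1 where "A1 r = 2 * h r * h1 r / r\<^sup>2 - 2 * (h r)\<^sup>2 / r^3"
    and "B1 r = (2 * q r * q1 r - A1 r) / r\<^sup>2 - 2 * ((q r)\<^sup>2 - A r) / r^3" for r
  define a b c where "a r = q1 r / q r" and "b r = h1 r / h r - 1 / r"
    and "c r = 1 / r - h r * h1 r / (r\<^sup>2 * (q r)\<^sup>2)" for r
  define a1 b1 c1 where "a1 r = q2 r / q r - (q1 r)\<^sup>2 / (q r)\<^sup>2"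
    and "b1 r = h2 r / h r - (h1 r)\<^sup>2 / (h r)\<^sup>2 + 1 / r\<^sup>2"
    and "c1 r = - 1 / r\<^sup>2 - ((h1 r)\<^sup>2 + h r * h2 r) / (r\<^sup>2 * (q r)\<^sup>2) + 2 * h r * h1 r / (r^3 * (q r)\<^sup>2)
      + 2 * h r * h1 r * q1 r / (r\<^sup>2 * (q r)^3)" for r
  note abc = a_def b_def c_def a1_def b1_def c1_def
  define P Q S where "P r = b r / r" and "Q r = c r / r" and "S r = (a r - 2 * b r - c r) / r^3" for r
  have r0: "r > 0" using x r by simp
  have nz: "r \<noteq> 0" "h r \<noteq> 0" "q r \<noteq> 0" using r0 pos[OF r0] by auto
  have AB: "g y $ i $ j = A (norm y) * kd i j + B (norm y) * y $ i * y $ j" if "y \<noteq> 0" for y i j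
    using that by (simp add: g A_def B_def field_simps)
  have C: "A r + r\<^sup>2 * B r = (q r)\<^sup>2" if "r > 0" for r
    using that by (simp add: B_def)
  have dA: "(A has_real_derivative A1 r) (at r)" if "r > 0" for r
  proof -
    have *: "r\<^sup>2 \<noteq> 0" using that by simp
    show ?thesis unfolding A_def A1_def
      by (rule derivative_eq_intros h1[OF that] * refl)+
        (use that in \<open>simp add: field_simps power2_eq_square power3_eq_cube\<close>)
  qed
  have dB: "(B has_real_derivative B1 r) (at r)" if "r > 0" for r
  proof -
    have *: "r\<^sup>2 \<noteq> 0" using that by simp
    show ?thesis unfolding B_def B1_def
      by (rule derivative_eq_intros q1[OF that] dA[OF that] * refl)+
        (use that in \<open>simp add: field_simps power2_eq_square power3_eq_cube\<close>)
  qed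
  have \<Gamma>: "christoffel g l i j y = P (norm y) * (y $ i * kd l j + y $ j * kd l i) + Q (norm y) * y $ l * kd i j
       + S (norm y) * y $ i * y $ j * y $ l" if y: "y \<noteq> 0" for y l i j
  proof -
    define s where "s = norm y"
    have s: "s > 0" using y by (simp add: s_def)
    have nz: "s \<noteq> 0" "h s \<noteq> 0" "q s \<noteq> 0" using s pos[OF s] by auto
    have As: "A s \<noteq> 0" using nz by (simp add: A_def)
    have "christoffel g l i j y =
      A1 s / (2 * s * A s) * (y $ i * kd l j + y $ j * kd l i)
    + (B s - A1 s / (2 * s)) / (A s + s\<^sup>2 * B s) * y $ l * kd i j
    + (A s * B1 s - 2 * A1 s * B s) / (2 * s * A s * (A s + s\<^sup>2 * B s)) * y $ i * y $ j * y $ l"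
      by (rule christoffel_radial) (use AB y s nz As in \<open>auto simp: s_def[symmetric] C intro!: dA dB\<close>)
    moreover have "A1 s / (2 * s * A s) = P s"
      using nz by (simp add: A1_def A_def P_def abc field_simps power2_eq_square power3_eq_cube)
    moreover have "(B s - A1 s / (2 * s)) / (A s + s\<^sup>2 * B s) = Q s"
      unfolding C[OF s] using nz
      by (simp add: A1_def A_def Q_def B_def abc divide_simps) (simp add: algebra_simps eval_nat_numeral)
    moreover have "(A s * B1 s - 2 * A1 s * B s) / (2 * s * A s * (A s + s\<^sup>2 * B s)) = S s"
      unfolding C[OF s] using nz
      by (simp add: A1_def A_def B1_def S_def B_def abc divide_simps) (simp add: algebra_simps eval_nat_numeral)
    ultimately show ?thesis by (simp only: s_def)
  qed
  have nzq: "r\<^sup>2 * (q r)\<^sup>2 \<noteq> 0" "r ^ 3 \<noteq> 0" using nz by auto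
  have da: "(a has_real_derivative a1 r) (at r)"
    unfolding abc by (rule derivative_eq_intros q1[OF r0] q2[OF r0] nz refl)+
      (use nz in \<open>simp add: field_simps power2_eq_square power3_eq_cube\<close>)
  have db: "(b has_real_derivative b1 r) (at r)"
    unfolding abc by (rule derivative_eq_intros h1[OF r0] h2[OF r0] nz refl)+
      (use nz in \<open>simp add: field_simps power2_eq_square power3_eq_cube\<close>)
  have dc: "(c has_real_derivative c1 r) (at r)"
    unfolding abc by (rule derivative_eq_intros h1[OF r0] h2[OF r0] q1[OF r0] nz nzq refl)+
      (use nz in \<open>simp add: divide_simps, simp add: algebra_simps eval_nat_numeral\<close>)
  have dP: "(P has_real_derivative b1 r / r - b r / r\<^sup>2) (at r)"
    unfolding P_def by (rule derivative_eq_intros db nz refl)+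
      (use nz in \<open>simp add: diff_divide_distrib power2_eq_square\<close>)
  have dQ: "(Q has_real_derivative c1 r / r - c r / r\<^sup>2) (at r)"
    unfolding Q_def by (rule derivative_eq_intros dc nz refl)+
      (use nz in \<open>simp add: diff_divide_distrib power2_eq_square\<close>)
  have dS: "(S has_real_derivative (a1 r - 2 * b1 r - c1 r) / r^3 - 3 * (a r - 2 * b r - c r) / r^4) (at r)"
    unfolding S_def by (rule derivative_eq_intros da db dc nzq refl)+
      (use nz in \<open>simp add: divide_simps, simp add: algebra_simps eval_nat_numeral\<close>)
  have "ricci g i j x = ((real CARD('n) - 2) * (1 - (h1 r / q r)\<^sup>2) - h r * y1 / q r) / r\<^sup>2 * kd i j
    + (- (real CARD('n) - 1) * q r * y1 / h r
       - ((real CARD('n) - 2) * (1 - (h1 r / q r)\<^sup>2) - h r * y1 / q r) / r\<^sup>2) / r\<^sup>2 * x $ i * x $ j"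
    by (rule ricci_radial[where P=P and Q=Q and S=S, OF _ x r dP dQ dS refl refl, THEN trans])
      (simp_all only: \<Gamma> not_False_eq_True P_def Q_def S_def abc y1 ricci_identities[OF nz])
  moreover have "K * d + (L - K) / R * a * b = L * (a * b / R) + K * (d - a * b / R)" for K L R d a b :: real
    by (simp add: algebra_simps diff_divide_distrib)
  ultimately show ?thesis by (simp only:)
qed

section \<open>Evolution of the slope under Ricci flow\<close>

text \<open>Clairaut's theorem: by the mean value theorem the second difference over a small square equals its area
times either mixed derivative at some point of the square.\<close>

lemma mixed_partials_eq:
  fixes F Ft Fr Ftr Frt :: "real \<Rightarrow> real \<Rightarrow> real"
  assumes U: "open U" "(t0, r0) \<in> U"
    and Ft: "\<And>t r. (t, r) \<in> U \<Longrightarrow> ((\<lambda>t. F t r) has_real_derivative Ft t r) (at t)"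
    and Fr: "\<And>t r. (t, r) \<in> U \<Longrightarrow> ((\<lambda>r. F t r) has_real_derivative Fr t r) (at r)"
    and Ftr: "\<And>t r. (t, r) \<in> U \<Longrightarrow> ((\<lambda>r. Ft t r) has_real_derivative Ftr t r) (at r)"
    and Frt: "\<And>t r. (t, r) \<in> U \<Longrightarrow> ((\<lambda>t. Fr t r) has_real_derivative Frt t r) (at t)"
    and cont: "continuous_on U (\<lambda>(t, r). Ftr t r)" "continuous_on U (\<lambda>(t, r). Frt t r)"
  shows "Ftr t0 r0 = Frt t0 r0"
proof -
  have "\<bar>Ftr t0 r0 - Frt t0 r0\<bar> \<le> e" if e: "e > 0" for e
  proof -
    have "isCont (\<lambda>(t, r). Ftr t r) (t0, r0)" "isCont (\<lambda>(t, r). Frt t r) (t0, r0)"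
      using cont U by (auto simp: continuous_on_eq_continuous_at)
    then have lim: "((\<lambda>p. Ftr (fst p) (snd p)) \<longlongrightarrow> Ftr t0 r0) (nhds (t0, r0))"
        "((\<lambda>p. Frt (fst p) (snd p)) \<longlongrightarrow> Frt t0 r0) (nhds (t0, r0))"
      using tendsto_at_iff_tendsto_nhds[of "\<lambda>p. Ftr (fst p) (snd p)" "(t0, r0)"]
        tendsto_at_iff_tendsto_nhds[of "\<lambda>p. Frt (fst p) (snd p)" "(t0, r0)"]
      by (simp_all add: isCont_def case_prod_beta')
    have ev: "\<forall>\<^sub>F p in nhds (t0, r0). dist (Ftr (fst p) (snd p)) (Ftr t0 r0) < e/2"
       "\<forall>\<^sub>F p in nhds (t0, r0). dist (Frt (fst p) (snd p)) (Frt t0 r0) < e/2"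
      by (rule tendstoD[OF lim(1)] tendstoD[OF lim(2)], use e in simp)+
    have "\<forall>\<^sub>F p in nhds (t0, r0). p \<in> U" using U by (rule eventually_nhds_in_open)
    with ev have "\<forall>\<^sub>F p in nhds (t0, r0). p \<in> U \<and> dist (Ftr (fst p) (snd p)) (Ftr t0 r0) < e/2
        \<and> dist (Frt (fst p) (snd p)) (Frt t0 r0) < e/2"
      by eventually_elim auto
    then obtain S where S: "open S" "(t0, r0) \<in> S" "\<And>p. p \<in> S \<Longrightarrow> p \<in> U \<and> dist (Ftr (fst p) (snd p)) (Ftr t0 r0) < e/2
        \<and> dist (Frt (fst p) (snd p)) (Frt t0 r0) < e/2"
      unfolding eventually_nhds by blast
    obtain A B where AB: "open A" "open B" "t0 \<in> A" "r0 \<in> B" "A \<times> B \<subseteq> S"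
      using S(1,2) by (auto elim!: open_prod_elim)
    obtain d1 where d1: "d1 > 0" "cball t0 d1 \<subseteq> A"
      using AB open_contains_cball by metis
    obtain d2 where d2: "d2 > 0" "cball r0 d2 \<subseteq> B"
      using AB open_contains_cball by metis
    define s where "s = min d1 d2"
    have s: "s > 0" using d1 d2 by (simp add: s_def)
    have inS: "(t, r) \<in> S" if "t0 \<le> t" "t \<le> t0 + s" "r0 \<le> r" "r \<le> r0 + s" for t r
    proof -
      have "t \<in> cball t0 d1" "r \<in> cball r0 d2" using that by (auto simp: dist_real_def s_def)
      then show ?thesis using d1 d2 AB(5) by blast
    qed
    define \<Delta> where "\<Delta> = F (t0 + s) (r0 + s) - F (t0 + s) r0 - F t0 (r0 + s) + F t0 r0"
    have "\<exists>\<tau>. t0 < \<tau> \<and> \<tau> < t0 + s \<and> (F (t0 + s) (r0 + s) - F (t0 + s) r0) - (F t0 (r0 + s) - F t0 r0)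
        = (t0 + s - t0) * (Ft \<tau> (r0 + s) - Ft \<tau> r0)"
      using s inS S(3) by (intro MVT2) (auto intro!: DERIV_diff Ft)
    then obtain \<tau> where \<tau>: "t0 < \<tau>" "\<tau> < t0 + s" "\<Delta> = s * (Ft \<tau> (r0 + s) - Ft \<tau> r0)"
      by (auto simp: \<Delta>_def)
    have "\<exists>\<rho>. r0 < \<rho> \<and> \<rho> < r0 + s \<and> Ft \<tau> (r0 + s) - Ft \<tau> r0 = (r0 + s - r0) * Ftr \<tau> \<rho>"
      using s inS S(3) \<tau> by (intro MVT2) (auto intro!: Ftr)
    then obtain \<rho> where \<rho>: "r0 < \<rho>" "\<rho> < r0 + s" "Ft \<tau> (r0 + s) - Ft \<tau> r0 = s * Ftr \<tau> \<rho>" by auto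
    have "\<exists>\<rho>. r0 < \<rho> \<and> \<rho> < r0 + s \<and> (F (t0 + s) (r0 + s) - F t0 (r0 + s)) - (F (t0 + s) r0 - F t0 r0)
        = (r0 + s - r0) * (Fr (t0 + s) \<rho> - Fr t0 \<rho>)"
      using s inS S(3) by (intro MVT2) (auto intro!: DERIV_diff Fr)
    then obtain \<rho>' where \<rho>': "r0 < \<rho>'" "\<rho>' < r0 + s" "\<Delta> = s * (Fr (t0 + s) \<rho>' - Fr t0 \<rho>')"
      by (auto simp: \<Delta>_def)
    have "\<exists>\<tau>. t0 < \<tau> \<and> \<tau> < t0 + s \<and> Fr (t0 + s) \<rho>' - Fr t0 \<rho>' = (t0 + s - t0) * Frt \<tau> \<rho>'"
      using s inS S(3) \<rho>' by (intro MVT2) (auto intro!: Frt)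
    then obtain \<tau>' where \<tau>': "t0 < \<tau>'" "\<tau>' < t0 + s" "Fr (t0 + s) \<rho>' - Fr t0 \<rho>' = s * Frt \<tau>' \<rho>'" by auto
    have "s * (s * Ftr \<tau> \<rho>) = s * (s * Frt \<tau>' \<rho>')" using \<tau> \<rho> \<rho>' \<tau>' by simp
    then have eq: "Ftr \<tau> \<rho> = Frt \<tau>' \<rho>'" using s by simp
    have "(\<tau>, \<rho>) \<in> S" "(\<tau>', \<rho>') \<in> S" using \<tau> \<rho> \<rho>' \<tau>' by (auto intro!: inS)
    from S(3)[OF this(1)] S(3)[OF this(2)]
    have "\<bar>Ftr \<tau> \<rho> - Ftr t0 r0\<bar> < e/2" "\<bar>Frt \<tau>' \<rho>' - Frt t0 r0\<bar> < e/2"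
      by (simp_all add: dist_real_def)
    then show ?thesis using eq by linarith
  qed
  then have "\<bar>Ftr t0 r0 - Frt t0 r0\<bar> \<le> 0" by (rule field_le_epsilon) auto
  then show ?thesis by simp
qed

lemma sqrt_deriv:
  assumes "(A has_real_derivative A1) (at x)" "A x > 0"
  shows "((\<lambda>x. sqrt (A x)) has_real_derivative A1 / (2 * sqrt (A x))) (at x)"
  using DERIV_chain2[OF DERIV_real_sqrt[OF assms(2)] assms(1)] by (simp add: field_simps)

lemma half_quotient_deriv:
  assumes "(a has_real_derivative a1) (at x)" "(s has_real_derivative s1) (at x)" "s x \<noteq> (0::real)"
  shows "((\<lambda>x. a x / (2 * s x)) has_real_derivative a1 / (2 * s x) - a x * s1 / (2 * (s x)\<^sup>2)) (at x)"
proof -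
  have nz: "2 * s x \<noteq> 0" using assms(3) by simp
  show ?thesis
    by (rule derivative_eq_intros assms(1,2) nz refl)+ (use assms(3) in \<open>simp add: field_simps power2_eq_square\<close>)
qed

text \<open>The equation for \<open>y = h\<^sub>r / q\<close> follows by differentiating the equation for \<open>h\<^sub>t\<close> in \<open>r\<close> and using that
\<open>htr\<close> is both the \<open>r\<close>-derivative of \<open>h\<^sub>t\<close> and the \<open>t\<close>-derivative of \<open>h\<^sub>r\<close>.\<close>

lemma slope_evolution:
  fixes h q h1 h2 h3 q1 q2 ht htr qt :: "real \<Rightarrow> real \<Rightarrow> real" and N t r :: real
  defines "y \<equiv> \<lambda>t r. h1 t r / q t r"
    and "y1 \<equiv> \<lambda>t r. (h2 t r - h1 t r * q1 t r / q t r) / q t r"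
  assumes pos: "\<And>r. r > 0 \<Longrightarrow> q t r > 0 \<and> h t r > 0" and r: "r > 0"
    and h1: "\<And>r. r > 0 \<Longrightarrow> (h t has_real_derivative h1 t r) (at r)"
    and h2: "\<And>r. r > 0 \<Longrightarrow> (h1 t has_real_derivative h2 t r) (at r)"
    and h3: "\<And>r. r > 0 \<Longrightarrow> (h2 t has_real_derivative h3 t r) (at r)"
    and q1: "\<And>r. r > 0 \<Longrightarrow> (q t has_real_derivative q1 t r) (at r)"
    and q2: "\<And>r. r > 0 \<Longrightarrow> (q1 t has_real_derivative q2 t r) (at r)"
    and h1_t: "((\<lambda>t. h1 t r) has_real_derivative htr t r) (at t)"
    and ht_r: "(ht t has_real_derivative htr t r) (at r)"
    and q_t: "((\<lambda>t. q t r) has_real_derivative qt t r) (at t)"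
    and ht: "\<And>r. r > 0 \<Longrightarrow> ht t r = y1 t r / q t r - (N - 2) * (1 - (y t r)\<^sup>2) / h t r"
    and qt: "qt t r = (N - 1) * y1 t r / h t r"
  shows "(y t has_real_derivative y1 t r) (at r)"
    and "\<exists>y2. (y1 t has_real_derivative y2) (at r) \<and> ((\<lambda>t. y t r) has_real_derivative
                slope_rhs N (h t r) (q t r) (q1 t r) (y t r) (y1 t r) y2) (at t)"
proof -
  have nz: "q t r \<noteq> 0" "h t r \<noteq> 0" using pos[OF r] by auto
  show y1: "(y t has_real_derivative y1 t r) (at r)"
    unfolding y_def y1_def
    by (rule derivative_eq_intros h1[OF r] h2[OF r] q1[OF r] nz refl)+
      (use nz in \<open>simp add: field_simps\<close>)
  define y2 where "y2 = ((h3 t r - ((h2 t r * q1 t r + h1 t r * q2 t r) * q t r - h1 t r * q1 t r * q1 t r) / (q t r)\<^sup>2) * q t r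
     - (h2 t r - h1 t r * q1 t r / q t r) * q1 t r) / (q t r)\<^sup>2"
  have y2: "(y1 t has_real_derivative y2) (at r)"
    unfolding y1_def y2_def
    by (rule derivative_eq_intros h1[OF r] h2[OF r] h3[OF r] q1[OF r] q2[OF r] nz refl)+
      (use nz in \<open>simp add: power2_eq_square algebra_simps\<close>)
  have "((\<lambda>r. y1 t r / q t r - (N - 2) * (1 - (y t r)\<^sup>2) / h t r) has_real_derivative
     (y2 * q t r - y1 t r * q1 t r) / (q t r)\<^sup>2 - (N - 2) * ((- 2 * y t r * y1 t r) * h t r - (1 - (y t r)\<^sup>2) * h1 t r) / (h t r)\<^sup>2) (at r)"
    by (rule derivative_eq_intros y1 y2 h1[OF r] q1[OF r] nz refl)+
      (simp add: power2_eq_square algebra_simps)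
  moreover have "((\<lambda>r. y1 t r / q t r - (N - 2) * (1 - (y t r)\<^sup>2) / h t r) has_real_derivative htr t r) (at r)"
    by (rule has_field_derivative_transform_within_open[OF ht_r, of "{0<..}"]) (use r ht in auto)
  ultimately have htr: "htr t r = (y2 * q t r - y1 t r * q1 t r) / (q t r)\<^sup>2
      - (N - 2) * ((- 2 * y t r * y1 t r) * h t r - (1 - (y t r)\<^sup>2) * h1 t r) / (h t r)\<^sup>2"
    by (rule DERIV_unique[symmetric])
  have h1y: "h1 t r = y t r * q t r" using nz by (simp add: y_def)
  have "((\<lambda>t. y t r) has_real_derivative (htr t r * q t r - h1 t r * qt t r) / (q t r * q t r)) (at t)"
    unfolding y_def by (rule DERIV_divide[OF h1_t q_t nz(1)])
  also have "(htr t r * q t r - h1 t r * qt t r) / (q t r * q t r) = slope_rhs N (h t r) (q t r) (q1 t r) (y t r) (y1 t r) y2"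
    unfolding htr h1y qt slope_rhs_def using nz by (simp add: divide_simps) (simp add: algebra_simps eval_nat_numeral)
  finally show "\<exists>y2. (y1 t has_real_derivative y2) (at r) \<and> ((\<lambda>t. y t r) has_real_derivative
                slope_rhs N (h t r) (q t r) (q1 t r) (y t r) (y1 t r) y2) (at t)"
    using y2 by blast
qed

lemma smooth_on_has_derivative:
  assumes "open U" "smooth_on U F" "x \<in> U" "set vs \<subseteq> Basis"
  shows "(dderivs vs F has_derivative (\<lambda>v. dderiv v (dderivs vs F) x)) (at x)"
proof -
  have "dderivs vs F differentiable (at x)"
    using assms by (auto simp: smooth_on_def differentiable_on_eq_differentiable_at)
  then obtain F' where F': "(dderivs vs F has_derivative F') (at x)" by (auto simp: differentiable_def)
  show ?thesis using F' dderiv_eq[OF F'] by simp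
qed

lemma smooth_on_continuous_dderivs:
  assumes "smooth_on U F" "set vs \<subseteq> Basis"
  shows "continuous_on U (dderivs vs F)"
  using assms by (auto simp: smooth_on_def intro: differentiable_imp_continuous_on)

lemma smooth_on_partial_time:
  fixes F :: "real \<times> 'a::euclidean_space \<Rightarrow> 'b::real_normed_vector"
  assumes "open U" "smooth_on U F" "(t, x) \<in> U" "set vs \<subseteq> Basis"
  shows "((\<lambda>t. dderivs vs F (t, x)) has_vector_derivative dderivs ((1, 0) # vs) F (t, x)) (at t)"
proof -
  have d: "((\<lambda>s. (s, x)) has_derivative (\<lambda>s. (s, 0))) (at t)"
    by (auto intro!: derivative_eq_intros)
  note D = has_derivative_compose[OF d smooth_on_has_derivative[OF assms]]
  have lin: "dderiv (s, 0) (dderivs vs F) (t, x) = s *\<^sub>R dderiv (1, 0) (dderivs vs F) (t, x)" for s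
    using linear_simps(5)[OF has_derivative_bounded_linear[OF smooth_on_has_derivative[OF assms]], of s "(1, 0)"]
    by simp
  show ?thesis
    unfolding has_vector_derivative_def dderivs.simps by (rule has_derivative_eq_rhs[OF D]) (rule ext, rule lin)
qed

lemma smooth_on_partial_space:
  fixes F :: "real \<times> 'a::euclidean_space \<Rightarrow> 'b::real_normed_vector"
  assumes "open U" "smooth_on U F" "(t, r *\<^sub>R e) \<in> U" "set vs \<subseteq> Basis"
  shows "((\<lambda>r. dderivs vs F (t, r *\<^sub>R e)) has_vector_derivative dderivs ((0, e) # vs) F (t, r *\<^sub>R e)) (at r)"
proof -
  have d: "((\<lambda>s. (t, s *\<^sub>R e)) has_derivative (\<lambda>s. (0, s *\<^sub>R e))) (at r)"
    by (auto intro!: derivative_eq_intros)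
  note D = has_derivative_compose[OF d smooth_on_has_derivative[OF assms]]
  have lin: "dderiv (0, s *\<^sub>R e) (dderivs vs F) (t, r *\<^sub>R e) = s *\<^sub>R dderiv (0, e) (dderivs vs F) (t, r *\<^sub>R e)" for s
    using linear_simps(5)[OF has_derivative_bounded_linear[OF smooth_on_has_derivative[OF assms]], of s "(0, e)"]
    by simp
  show ?thesis
    unfolding has_vector_derivative_def dderivs.simps by (rule has_derivative_eq_rhs[OF D]) (rule ext, rule lin)
qed

text \<open>For positive times the metric is smooth. Along a coordinate axis \<open>x = r e\<close>, with \<open>r > 0\<close>, its
diagonal components are \<open>q\<^sup>2\<close> in the direction \<open>e\<close> and \<open>h\<^sup>2 / r\<^sup>2\<close> in an orthogonal direction, so
\<open>q\<close> and \<open>h\<close> are smooth there and inherit evolution equations from these two components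
of the flow.\<close>

lemma ricci_flow_slope_evolution:
  fixes gbar :: "real \<Rightarrow> 'n::finite metric" and q h :: "real \<Rightarrow> real \<Rightarrow> real" and TM :: ereal
  defines "I \<equiv> {t. 0 < t \<and> ereal t < TM}"
  assumes n: "CARD('n) \<ge> 2"
    and smooth: "smooth_on {p. 0 < fst p \<and> ereal (fst p) < TM} (\<lambda>p. gbar (fst p) (snd p))"
    and flow: "\<And>t x i j. t \<in> I \<Longrightarrow> ((\<lambda>s. gbar s x $ i $ j) has_real_derivative - 2 * ricci (gbar t) i j x) (at t)"
    and rot: "\<And>t. t \<in> I \<Longrightarrow> rot_sym_form (gbar t) (q t) (h t)"
  obtains y y1 y2 q1 where
    "\<And>t r. t \<in> I \<Longrightarrow> 0 < r \<Longrightarrow> (h t has_real_derivative q t r * y t r) (at r)"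
    "\<And>t r. t \<in> I \<Longrightarrow> 0 < r \<Longrightarrow> (q t has_real_derivative q1 t r) (at r)"
    "\<And>t r. t \<in> I \<Longrightarrow> 0 < r \<Longrightarrow> (y t has_real_derivative y1 t r) (at r)"
    "\<And>t r. t \<in> I \<Longrightarrow> 0 < r \<Longrightarrow> (y1 t has_real_derivative y2 t r) (at r)"
    "\<And>t r. t \<in> I \<Longrightarrow> 0 < r \<Longrightarrow> ((\<lambda>t. h t r) has_real_derivative
                y1 t r / q t r - (real CARD('n) - 2) * (1 - (y t r)\<^sup>2) / h t r) (at t)"
    "\<And>t r. t \<in> I \<Longrightarrow> 0 < r \<Longrightarrow> ((\<lambda>t. y t r) has_real_derivative
                slope_rhs (real CARD('n)) (h t r) (q t r) (q1 t r) (y t r) (y1 t r) (y2 t r)) (at t)"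
    "continuous_on (I \<times> {0<..}) (\<lambda>(t, r). h t r)"
    "continuous_on (I \<times> {0<..}) (\<lambda>(t, r). y t r)"
proof -
  define N where "N = real CARD('n)"
  obtain m m' :: 'n where mm: "m \<noteq> m'"
    using n card_le_Suc0_iff_eq[of "UNIV :: 'n set"] by auto
  define e :: "real^'n" where "e = axis m 1"
  define F where "F p = gbar (fst p) (snd p)" for p :: "real \<times> (real^'n)"
  define U where "U = {p :: real \<times> (real^'n). 0 < fst p \<and> ereal (fst p) < TM}"
  have "I = {0<..} \<inter> ereal -` {..<TM}" by (auto simp: I_def)
  then have openI: "open I" by (simp add: open_ereal_vimage open_Int)
  have "U = I \<times> UNIV" by (auto simp: U_def I_def)
  then have openU: "open U" using openI by (simp add: open_Times)
  have smF: "smooth_on U F" using smooth by (simp add: U_def F_def[abs_def])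
  define er et where "er = (0::real, e)" and "et = (1::real, 0::real^'n)"
  have basis: "{er, et} \<subseteq> Basis"
    by (auto simp: er_def et_def e_def Basis_prod_def axis_in_Basis_iff)
  define D where "D vs i t r = dderivs vs F (t, r *\<^sub>R e) $ i $ i" for vs i t r
  have inU: "(t, x) \<in> U" if "t \<in> I" for t x using that by (auto simp: U_def I_def)
  have comp: "bounded_linear (\<lambda>M :: real^'n^'n. M $ i $ i)" for i
    by (rule bounded_linear_compose[OF bounded_linear_vec_nth bounded_linear_vec_nth])
  have dR: "(D vs i t has_real_derivative D (er # vs) i t r) (at r)"
    if "t \<in> I" "set vs \<subseteq> {er, et}" for vs i t r
    unfolding D_def er_def has_real_derivative_iff_has_vector_derivative
    by (rule bounded_linear.has_vector_derivative[OF comp smooth_on_partial_space])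
      (use openU smF inU that basis in auto)
  have dT: "((\<lambda>t. D vs i t r) has_real_derivative D (et # vs) i t r) (at t)"
    if "t \<in> I" "set vs \<subseteq> {er, et}" for vs i t r
    unfolding D_def et_def has_real_derivative_iff_has_vector_derivative
    by (rule bounded_linear.has_vector_derivative[OF comp smooth_on_partial_time])
      (use openU smF inU that basis in auto)
  have cont: "continuous_on (I \<times> UNIV) (\<lambda>(t, r). D vs i t r)" if "set vs \<subseteq> {er, et}" for vs i
  proof -
    have "continuous_on U (dderivs vs F)"
      using smooth_on_continuous_dderivs[OF smF] that basis by auto
    then have "continuous_on (I \<times> UNIV) (\<lambda>p. dderivs vs F (fst p, snd p *\<^sub>R e))"
      by (rule continuous_on_compose2) (auto intro!: continuous_intros simp: inU)
    then have "continuous_on (I \<times> UNIV) (\<lambda>p. dderivs vs F (fst p, snd p *\<^sub>R e) $ i $ i)"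
      by (rule bounded_linear.continuous_on[OF comp])
    then show ?thesis by (simp add: D_def case_prod_beta')
  qed
  define A C where "A = D [] m'" and "C = D [] m"
  define Ar Arr Arrr At Art Atr where "Ar = D [er] m'" and "Arr = D [er, er] m'"
    and "Arrr = D [er, er, er] m'" and "At = D [et] m'" and "Art = D [et, er] m'" and "Atr = D [er, et] m'"
  define Cr Crr Ct where "Cr = D [er] m" and "Crr = D [er, er] m" and "Ct = D [et] m"
  have dA: "(A t has_real_derivative Ar t r) (at r)" "(Ar t has_real_derivative Arr t r) (at r)"
    "(Arr t has_real_derivative Arrr t r) (at r)" "(At t has_real_derivative Atr t r) (at r)"
    "((\<lambda>t. A t r) has_real_derivative At t r) (at t)" "((\<lambda>t. Ar t r) has_real_derivative Art t r) (at t)"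
    "(C t has_real_derivative Cr t r) (at r)" "(Cr t has_real_derivative Crr t r) (at r)"
    "((\<lambda>t. C t r) has_real_derivative Ct t r) (at t)"
    if "t \<in> I" for t r
    unfolding A_def Ar_def Arr_def Arrr_def At_def Art_def Atr_def C_def Cr_def Crr_def Ct_def
    using that by (auto intro!: dR dT)
  have clairaut: "Atr t r = Art t r" if "t \<in> I" for t r
  proof (rule mixed_partials_eq[where U="I \<times> UNIV" and F=A and Ft=At and Fr=Ar and Ftr=Atr and Frt=Art])
    show "continuous_on (I \<times> UNIV) (\<lambda>(t, r). Atr t r)" "continuous_on (I \<times> UNIV) (\<lambda>(t, r). Art t r)"
      unfolding Atr_def Art_def by (simp_all add: cont)
  qed (use that openI in \<open>auto simp: open_Times intro: dA\<close>)
  have g: "gbar t x $ i $ j = (q t (norm x))\<^sup>2 * (x $ i * x $ j / (norm x)\<^sup>2)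
        + (h t (norm x))\<^sup>2 / (norm x)\<^sup>2 * (kd i j - x $ i * x $ j / (norm x)\<^sup>2)"
    if "t \<in> I" "x \<noteq> 0" for t x i j
    using rot[OF that(1)] that(2) unfolding rot_sym_form_def mat_1_nth by blast
  have pos: "q t r > 0" "h t r > 0" if "t \<in> I" "r > 0" for t r
    using rot[OF that(1)] that(2) by (auto simp: rot_sym_form_def)
  have e: "(r *\<^sub>R e) $ m = r" "(r *\<^sub>R e) $ m' = 0" "norm (r *\<^sub>R e) = \<bar>r\<bar>" for r
    using mm by (simp_all add: e_def) (simp_all add: axis_def)
  have en: "norm e = 1" using e(3)[of 1] by simp
  have e0: "r *\<^sub>R e \<noteq> 0" if "r > 0" for r using e(1)[of r] that by (metis less_irrefl zero_index)
  have C: "C t r = (q t r)\<^sup>2" and A: "A t r = (h t r)\<^sup>2 / r\<^sup>2" if "t \<in> I" "r > 0" for t r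
    using that by (simp_all add: C_def A_def D_def F_def g[OF that(1) e0[OF that(2)]] e en kd_def power2_eq_square
        del: vector_scaleR_component)
  define s where "s t r = sqrt (A t r)" for t r
  have s_eq: "s t r = h t r / r" and Apos: "A t r > 0" if "t \<in> I" "r > 0" for t r
    using that pos[OF that] by (auto simp: s_def A real_sqrt_divide)
  have q_eq: "q t r = sqrt (C t r)" and Cpos: "C t r > 0" if "t \<in> I" "r > 0" for t r
    using that pos[OF that] by (auto simp: C)
  have sn: "s t r \<noteq> 0" "q t r \<noteq> 0" "h t r \<noteq> 0" if "t \<in> I" "r > 0" for t r
    using pos[OF that] s_eq[OF that] that by auto
  define s1 s2 s3 st where "s1 t r = Ar t r / (2 * s t r)"
    and "s2 t r = Arr t r / (2 * s t r) - Ar t r * s1 t r / (2 * (s t r)\<^sup>2)"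
    and "s3 t r = Arrr t r / (2 * s t r) - Arr t r * s1 t r / (2 * (s t r)\<^sup>2)
         - ((Arr t r * s1 t r + Ar t r * s2 t r) * (2 * (s t r)\<^sup>2) - Ar t r * s1 t r * (4 * s t r * s1 t r)) / (2 * (s t r)\<^sup>2)\<^sup>2"
    and "st t r = At t r / (2 * s t r)" for t r
  have ds1: "(s t has_real_derivative s1 t r) (at r)" if "t \<in> I" "r > 0" for t r
    unfolding s_def s1_def by (rule sqrt_deriv[OF dA(1)[OF that(1)] Apos[OF that]])
  have dst: "((\<lambda>t. s t r) has_real_derivative st t r) (at t)" if "t \<in> I" "r > 0" for t r
    unfolding s_def st_def by (rule sqrt_deriv[OF dA(5)[OF that(1)] Apos[OF that]])
  have ds2: "(s1 t has_real_derivative s2 t r) (at r)" if "t \<in> I" "r > 0" for t r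
    unfolding s1_def[abs_def] s2_def[unfolded s1_def]
    by (rule half_quotient_deriv[OF dA(2)[OF that(1)] ds1[OF that, unfolded s1_def] sn(1)[OF that]])
  have ds3: "(s2 t has_real_derivative s3 t r) (at r)" if "t \<in> I" "r > 0" for t r
  proof -
    have *: "2 * (s t r)\<^sup>2 \<noteq> 0" using sn[OF that] by simp
    have "((\<lambda>r. Ar t r * s1 t r / (2 * (s t r)\<^sup>2)) has_real_derivative
      ((Arr t r * s1 t r + Ar t r * s2 t r) * (2 * (s t r)\<^sup>2) - Ar t r * s1 t r * (4 * s t r * s1 t r)) / (2 * (s t r)\<^sup>2)\<^sup>2) (at r)"
      by (rule derivative_eq_intros dA(2)[OF that(1)] ds2[OF that] ds1[OF that] * refl)+
        (simp add: algebra_simps power2_eq_square)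
    then show ?thesis unfolding s2_def s3_def
      by (intro DERIV_diff half_quotient_deriv[OF dA(3)[OF that(1)] ds1[OF that] sn(1)[OF that]])
  qed
  define h1 h2 h3 q1 q2 ht htr qt where "h1 t r = s t r + r * s1 t r" and "h2 t r = 2 * s1 t r + r * s2 t r"
    and "h3 t r = 3 * s2 t r + r * s3 t r" and "q1 t r = Cr t r / (2 * q t r)"
    and "q2 t r = Crr t r / (2 * q t r) - Cr t r * q1 t r / (2 * (q t r)\<^sup>2)"
    and "ht t r = r * st t r" and "htr t r = st t r + r * (Atr t r / (2 * s t r) - At t r * s1 t r / (2 * (s t r)\<^sup>2))"
    and "qt t r = Ct t r / (2 * q t r)" for t r
  have dh1: "(h t has_real_derivative h1 t r) (at r)" if "t \<in> I" "r > 0" for t r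
  proof (rule has_field_derivative_transform_within_open[of "\<lambda>r. r * s t r" _ _ "{0<..}"])
    show "((\<lambda>r. r * s t r) has_real_derivative h1 t r) (at r)"
      unfolding h1_def by (rule derivative_eq_intros ds1[OF that] refl)+ simp
  qed (use that s_eq in auto)
  have dh2: "(h1 t has_real_derivative h2 t r) (at r)" if "t \<in> I" "r > 0" for t r
    unfolding h1_def h2_def by (rule derivative_eq_intros ds1[OF that] ds2[OF that] refl)+ simp
  have dh3: "(h2 t has_real_derivative h3 t r) (at r)" if "t \<in> I" "r > 0" for t r
    unfolding h2_def h3_def by (rule derivative_eq_intros ds3[OF that] ds2[OF that] refl)+ simp
  have dq1: "(q t has_real_derivative q1 t r) (at r)" if "t \<in> I" "r > 0" for t r
  proof (rule has_field_derivative_transform_within_open[of "\<lambda>r. sqrt (C t r)" _ _ "{0<..}"])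
    show "((\<lambda>r. sqrt (C t r)) has_real_derivative q1 t r) (at r)"
      unfolding q1_def q_eq[OF that] by (rule sqrt_deriv[OF dA(7)[OF that(1)] Cpos[OF that]])
  qed (use that q_eq in auto)
  have dqt: "((\<lambda>t. q t r) has_real_derivative qt t r) (at t)" if "t \<in> I" "r > 0" for t r
  proof (rule has_field_derivative_transform_within_open[of "\<lambda>t. sqrt (C t r)" _ _ I])
    show "((\<lambda>t. sqrt (C t r)) has_real_derivative qt t r) (at t)"
      unfolding qt_def q_eq[OF that] by (rule sqrt_deriv[OF dA(9)[OF that(1)] Cpos[OF that]])
  qed (use that q_eq openI in auto)
  have dht: "((\<lambda>t. h t r) has_real_derivative ht t r) (at t)" if "t \<in> I" "r > 0" for t r
  proof (rule has_field_derivative_transform_within_open[of "\<lambda>t. r * s t r" _ _ I])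
    show "((\<lambda>t. r * s t r) has_real_derivative ht t r) (at t)"
      unfolding ht_def by (rule DERIV_cmult dst that)+
  qed (use that s_eq openI in auto)
  have dq2: "(q1 t has_real_derivative q2 t r) (at r)" if "t \<in> I" "r > 0" for t r
    unfolding q1_def[abs_def] q2_def[unfolded q1_def]
    by (rule half_quotient_deriv[OF dA(8)[OF that(1)] dq1[OF that, unfolded q1_def] sn(2)[OF that]])
  have dhtr: "(ht t has_real_derivative htr t r) (at r)" if "t \<in> I" "r > 0" for t r
  proof -
    have *: "(st t has_real_derivative Atr t r / (2 * s t r) - At t r * s1 t r / (2 * (s t r)\<^sup>2)) (at r)"
      unfolding st_def by (rule half_quotient_deriv[OF dA(4)[OF that(1)] ds1[OF that] sn(1)[OF that]])
    show ?thesis unfolding ht_def htr_def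
      by (rule derivative_eq_intros * refl)+ simp
  qed
  have dh1t: "((\<lambda>t. h1 t r) has_real_derivative htr t r) (at t)" if "t \<in> I" "r > 0" for t r
  proof -
    have "((\<lambda>t. s1 t r) has_real_derivative Art t r / (2 * s t r) - Ar t r * st t r / (2 * (s t r)\<^sup>2)) (at t)"
      unfolding s1_def by (rule half_quotient_deriv[OF dA(6)[OF that(1)] dst[OF that] sn(1)[OF that]])
    moreover have "Art t r / (2 * s t r) - Ar t r * st t r / (2 * (s t r)\<^sup>2)
        = Atr t r / (2 * s t r) - At t r * s1 t r / (2 * (s t r)\<^sup>2)"
      by (simp add: clairaut that s1_def st_def)
    ultimately show ?thesis unfolding h1_def htr_def
      by (intro DERIV_add DERIV_cmult dst that) simp
  qed
  define y y1 where "y t r = h1 t r / q t r"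
    and "y1 t r = (h2 t r - h1 t r * q1 t r / q t r) / q t r" for t r
  have ricci: "ricci (gbar t) i i (r *\<^sub>R e) = - (N - 1) * q t r * y1 t r / h t r * ((r *\<^sub>R e) $ i * (r *\<^sub>R e) $ i / r\<^sup>2)
    + ((N - 2) * (1 - (y t r)\<^sup>2) - h t r * y1 t r / q t r) / r\<^sup>2 * (kd i i - (r *\<^sub>R e) $ i * (r *\<^sub>R e) $ i / r\<^sup>2)"
    if "t \<in> I" "r > 0" for t r i
    unfolding N_def y_def
    by (rule ricci_rotationally_symmetric[where q="q t" and h="h t" and ?h1.0="h1 t" and ?h2.0="h2 t" and ?q1.0="q1 t" and ?q2.0="q2 t"])
      (use that g pos e(3) e0 in \<open>auto simp: y1_def intro: dh1 dh2 dq1 dq2 simp del: vector_scaleR_component norm_scaleR\<close>)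
  have At_eq: "At t r = - 2 * (((N - 2) * (1 - (y t r)\<^sup>2) - h t r * y1 t r / q t r) / r\<^sup>2)" if "t \<in> I" "r > 0" for t r
  proof (rule DERIV_unique)
    show "((\<lambda>t. A t r) has_real_derivative At t r) (at t)" by (rule dA) (rule that)
    show "((\<lambda>t. A t r) has_real_derivative - 2 * (((N - 2) * (1 - (y t r)\<^sup>2) - h t r * y1 t r / q t r) / r\<^sup>2)) (at t)"
      using flow[OF that(1), of "r *\<^sub>R e" m' m'] unfolding ricci[OF that] e
      by (simp add: A_def D_def F_def kd_def)
  qed
  have Ct_eq: "Ct t r = - 2 * (- (N - 1) * q t r * y1 t r / h t r)" if "t \<in> I" "r > 0" for t r
  proof (rule DERIV_unique)
    show "((\<lambda>t. C t r) has_real_derivative Ct t r) (at t)" by (rule dA) (rule that)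
    show "((\<lambda>t. C t r) has_real_derivative - 2 * (- (N - 1) * q t r * y1 t r / h t r)) (at t)"
      using flow[OF that(1), of "r *\<^sub>R e" m m] that unfolding ricci[OF that] e
      by (simp add: C_def D_def F_def kd_def power2_eq_square)
  qed
  have ht: "ht t r = y1 t r / q t r - (N - 2) * (1 - (y t r)\<^sup>2) / h t r" if "t \<in> I" "r > 0" for t r
    using that sn[OF that] unfolding ht_def st_def At_eq[OF that] s_eq[OF that]
    by (simp add: field_simps power2_eq_square)
  have qt: "qt t r = (N - 1) * y1 t r / h t r" if "t \<in> I" "r > 0" for t r
    using that sn[OF that] unfolding qt_def Ct_eq[OF that] by (simp add: field_simps)
  have ev: "(y t has_real_derivative y1 t r) (at r)" "\<exists>y2. (y1 t has_real_derivative y2) (at r) \<and> ((\<lambda>t. y t r) has_real_derivative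
                slope_rhs N (h t r) (q t r) (q1 t r) (y t r) (y1 t r) y2) (at t)" if "t \<in> I" "r > 0" for t r
    unfolding y_def y1_def
    by (rule slope_evolution[where ?h3.0=h3 and ?q2.0=q2 and ht=ht and htr=htr and qt=qt];
        use that pos dh1 dh2 dh3 dq1 dq2 dh1t dhtr dqt ht[unfolded y_def y1_def] qt[unfolded y_def y1_def] in auto)+
  define y2 where "y2 t r = (SOME y2. (y1 t has_real_derivative y2) (at r) \<and> ((\<lambda>t. y t r) has_real_derivative
                slope_rhs N (h t r) (q t r) (q1 t r) (y t r) (y1 t r) y2) (at t))" for t r
  have y2: "(y1 t has_real_derivative y2 t r) (at r)" "((\<lambda>t. y t r) has_real_derivative
                slope_rhs N (h t r) (q t r) (q1 t r) (y t r) (y1 t r) (y2 t r)) (at t)" if "t \<in> I" "r > 0" for t r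
    using someI_ex[OF ev(2)[OF that]] unfolding y2_def[symmetric] by auto
  have contA: "continuous_on (I \<times> {0<..}) (\<lambda>p. D vs i (fst p) (snd p))" if "set vs \<subseteq> {er, et}" for vs i
    using continuous_on_subset[OF cont[OF that], of "I \<times> {0<..}"] by (auto simp: case_prod_beta')
  have conts: "continuous_on (I \<times> {0<..}) (\<lambda>p. s (fst p) (snd p))"
    unfolding s_def A_def by (intro continuous_intros contA) simp
  have conth: "continuous_on (I \<times> {0<..}) (\<lambda>p. snd p * s (fst p) (snd p))"
    by (intro continuous_intros conts)
  have conty: "continuous_on (I \<times> {0<..}) (\<lambda>p. (s (fst p) (snd p) + snd p * (D [er] m' (fst p) (snd p) / (2 * s (fst p) (snd p))))
       / sqrt (D [] m (fst p) (snd p)))"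
    by (intro continuous_intros conts contA) (use sn Cpos in \<open>force simp: C_def\<close>)+
  show ?thesis
  proof (rule that[of y q1 y1 y2])
    show "continuous_on (I \<times> {0<..}) (\<lambda>(t, r). h t r)"
      by (rule continuous_on_eq[OF conth]) (auto simp: s_eq)
    show "continuous_on (I \<times> {0<..}) (\<lambda>(t, r). y t r)"
      by (rule continuous_on_eq[OF conty]) (auto simp: y_def h1_def s1_def Ar_def q_eq C_def)
  next
    fix t r assume tr: "t \<in> I" "(0::real) < r"
    show "(h t has_real_derivative q t r * y t r) (at r)"
      using dh1[OF tr] sn[OF tr] by (simp add: y_def)
    show "((\<lambda>t. h t r) has_real_derivative
                y1 t r / q t r - (real CARD('n) - 2) * (1 - (y t r)\<^sup>2) / h t r) (at t)"
      using dht[OF tr] ht[OF tr] by (simp add: N_def)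
  qed (use dq1 ev(1) y2 in \<open>auto simp: N_def\<close>)
qed

section \<open>Radial test functions\<close>

text \<open>The family \<open>x\<^sup>-\<^sup>k exp (-1/x)\<close>, extended by zero: it is closed under differentiation up to linear combinations.\<close>

definition flat_exp :: "nat \<Rightarrow> real \<Rightarrow> real" where
  "flat_exp k x = (if 0 < x then (1 / x) ^ k * exp (- (1 / x)) else 0)"

lemma flat_exp_tendsto_0: "(flat_exp k \<longlongrightarrow> 0) (at 0)"
proof -
  have "((\<lambda>x::real. x ^ k / exp x) \<longlongrightarrow> 0) at_top"
    by (rule tendsto_power_div_exp_0)
  then have "((\<lambda>x::real. inverse x ^ k / exp (inverse x)) \<longlongrightarrow> 0) (at_right 0)"
    by (rule filterlim_compose[OF _ filterlim_inverse_at_top_right])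
  then have "(flat_exp k \<longlongrightarrow> 0) (at_right 0)"
    by (rule Lim_transform_eventually)
      (auto simp: eventually_at_right_field flat_exp_def divide_inverse exp_minus intro!: exI[of _ 1])
  moreover have "(flat_exp k \<longlongrightarrow> 0) (at_left 0)"
    by (rule Lim_transform_eventually[OF tendsto_const])
      (auto simp: eventually_at_left_field flat_exp_def intro!: exI[of _ "-1"])
  ultimately show ?thesis by (simp add: filterlim_at_split)
qed

lemma flat_exp_deriv:
  "(flat_exp k has_real_derivative flat_exp (k + 2) x - real k * flat_exp (k + 1) x) (at x)"
proof -
  consider "x > 0" | "x < 0" | "x = 0" by linarith
  then show ?thesis
  proof cases
    case 1
    have nz: "x \<noteq> 0" using 1 by simp
    have "((\<lambda>x. (1 / x) ^ k * exp (- (1 / x))) has_real_derivative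
        flat_exp (k + 2) x - real k * flat_exp (k + 1) x) (at x)"
    proof (cases k)
      case 0
      show ?thesis unfolding 0
        by (rule derivative_eq_intros nz refl | simp)+ (use 1 in \<open>simp add: flat_exp_def field_simps power2_eq_square\<close>)
    next
      case (Suc l)
      show ?thesis unfolding Suc
        by (rule derivative_eq_intros nz refl | simp)+
          (use 1 in \<open>simp add: flat_exp_def field_simps power2_eq_square\<close>)
    qed
    then show ?thesis
      by (rule has_field_derivative_transform_within_open[of _ _ _ "{0<..}"]) (use 1 in \<open>auto simp: flat_exp_def\<close>)
  next
    case 2
    have "((\<lambda>x. 0) has_real_derivative 0) (at x)" by simp
    then have "(flat_exp k has_real_derivative 0) (at x)"
      by (rule has_field_derivative_transform_within_open[of _ _ _ "{..<0}"]) (use 2 in \<open>auto simp: flat_exp_def\<close>)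
    then show ?thesis using 2 by (simp add: flat_exp_def)
  next
    case 3
    have "((\<lambda>y. (flat_exp k y - flat_exp k 0) / (y - 0)) \<longlongrightarrow> 0) (at 0)"
      by (rule Lim_transform_eventually[OF flat_exp_tendsto_0[of "k + 1"]])
        (auto simp: eventually_at_filter flat_exp_def)
    then show ?thesis unfolding 3 by (simp add: flat_exp_def has_field_derivative_iff)
  qed
qed

text \<open>Infinite differentiability comes from closure under differentiation: this algebra of functions on the line
contains a compactly supported bump and the derivatives of all of its members.\<close>

inductive bump_algebra :: "(real \<Rightarrow> real) \<Rightarrow> bool" where
  const: "bump_algebra (\<lambda>x. c)"
| flat_exp: "bump_algebra (\<lambda>x. flat_exp k (c + d * x))"
| add: "bump_algebra f \<Longrightarrow> bump_algebra g \<Longrightarrow> bump_algebra (\<lambda>x. f x + g x)"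
| mult: "bump_algebra f \<Longrightarrow> bump_algebra g \<Longrightarrow> bump_algebra (\<lambda>x. f x * g x)"

lemma bump_algebra_deriv:
  "bump_algebra f \<Longrightarrow> \<exists>f'. bump_algebra f' \<and> (\<forall>x. (f has_real_derivative f' x) (at x))"
proof (induction rule: bump_algebra.induct)
  case (const c)
  show ?case by (rule exI[of _ "\<lambda>x. 0"]) (auto intro: bump_algebra.const)
next
  case (flat_exp k c d)
  have "bump_algebra (\<lambda>x. d * flat_exp (k + 2) (c + d * x) + (- d * real k) * flat_exp (k + 1) (c + d * x))"
    by (intro bump_algebra.intros)
  moreover have "((\<lambda>x. flat_exp k (c + d * x)) has_real_derivative
      d * flat_exp (k + 2) (c + d * x) + (- d * real k) * flat_exp (k + 1) (c + d * x)) (at x)" for x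
  proof -
    have "((\<lambda>x. c + d * x) has_real_derivative d) (at x)" by (auto intro!: derivative_eq_intros)
    from DERIV_chain2[OF flat_exp_deriv this, of k] show ?thesis by (simp add: algebra_simps)
  qed
  ultimately show ?case by blast
next
  case (add f g)
  then obtain f' g' where *: "bump_algebra f'" "\<And>x. (f has_real_derivative f' x) (at x)"
    "bump_algebra g'" "\<And>x. (g has_real_derivative g' x) (at x)" by blast
  show ?case
    by (rule exI[of _ "\<lambda>x. f' x + g' x"]) (auto intro: bump_algebra.add DERIV_add *)
next
  case (mult f g)
  then obtain f' g' where *: "bump_algebra f'" "\<And>x. (f has_real_derivative f' x) (at x)"
    "bump_algebra g'" "\<And>x. (g has_real_derivative g' x) (at x)" by blast
  show ?case
    by (rule exI[of _ "\<lambda>x. f' x * g x + g' x * f x"])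
      (auto intro!: bump_algebra.add bump_algebra.mult DERIV_mult * mult)
qed

text \<open>A smooth monotone transition from \<open>0\<close> to \<open>1\<close>: the normalised antiderivative of the bump
\<open>exp (-1/(1+x)) exp (-1/(1-x))\<close> on \<open>(-1,1)\<close>.\<close>

lemma smooth_step:
  obtains F \<beta> :: "real \<Rightarrow> real" where
    "\<And>x. (F has_real_derivative \<beta> x) (at x)" "bump_algebra \<beta>" "\<And>x. 0 \<le> \<beta> x"
    "\<And>x. \<bar>x\<bar> \<ge> 1 \<Longrightarrow> \<beta> x = 0" "\<And>x. x \<le> -1 \<Longrightarrow> F x = 0" "\<And>x. x \<ge> 1 \<Longrightarrow> F x = 1"
    "\<And>x. 0 \<le> F x \<and> F x \<le> 1"
proof -
  define b where "b x = flat_exp 0 (1 + 1 * x) * flat_exp 0 (1 + (-1) * x)" for x :: real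
  have b: "bump_algebra b" unfolding b_def[abs_def] by (intro bump_algebra.intros)
  have b0: "b x \<ge> 0" "\<bar>x\<bar> \<ge> 1 \<Longrightarrow> b x = 0" "\<bar>x\<bar> < 1 \<Longrightarrow> b x > 0" for x
    by (auto simp: b_def flat_exp_def)
  obtain b' where "\<And>x. (b has_real_derivative b' x) (at x)" using bump_algebra_deriv[OF b] by blast
  then have "isCont b x" for x by (rule DERIV_isCont)
  then obtain G where G: "\<And>x. (G has_vector_derivative b x) (at x)"
    using einterval_antiderivative[of "-\<infinity>" "\<infinity>" b] by auto
  then have G: "(G has_real_derivative b x) (at x)" for x
    by (simp add: has_real_derivative_iff_has_vector_derivative)
  have mono: "G x \<le> G y" if "x \<le> y" for x y
    using that G b0(1) by (intro DERIV_nonneg_imp_nondecreasing[OF that]) blast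
  have lt: "G (-1) < G 1"
  proof (rule DERIV_pos_imp_increasing_open[where f=G and a="-1" and b=1])
    show "\<exists>y. (G has_real_derivative y) (at x) \<and> y > 0" if "-1 < x" "x < 1" for x
      using that by (intro exI[of _ "b x"] conjI G b0(3)) auto
    show "continuous_on {- 1..1} G"
      using G by (intro continuous_at_imp_continuous_on ballI DERIV_isCont)
  qed simp
  have left: "G x = G (-1)" if "x \<le> -1" for x
  proof (cases "x = -1")
    case False
    have "G (-1) = G x"
    proof (rule DERIV_isconst2[of x "-1"])
      show "continuous_on {x..- 1} G" using G by (intro continuous_at_imp_continuous_on ballI DERIV_isCont)
      show "(G has_real_derivative 0) (at y)" if "x < y" "y < -1" for y
        using G[of y] b0(2)[of y] that by auto
    qed (use that False in auto)
    then show ?thesis by simp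
  qed simp
  have right: "G x = G 1" if "x \<ge> 1" for x
  proof (cases "x = 1")
    case False
    show ?thesis
    proof (rule DERIV_isconst2[of 1 x])
      show "continuous_on {1..x} G" using G by (intro continuous_at_imp_continuous_on ballI DERIV_isCont)
      show "(G has_real_derivative 0) (at y)" if "1 < y" "y < x" for y
        using G[of y] b0(2)[of y] that by auto
    qed (use that False in auto)
  qed simp
  define M where "M = G 1 - G (-1)"
  have M: "M > 0" using lt by (simp add: M_def)
  have bnd: "G (-1) \<le> G x \<and> G x \<le> G 1" for x
    using left[of x] right[of x] mono[of "-1" x] mono[of x 1] by linarith
  show thesis
  proof (rule that[of "\<lambda>x. (G x - G (-1)) / M" "\<lambda>x. (1 / M) * b x"])
    show "((\<lambda>x. (G x - G (-1)) / M) has_real_derivative 1 / M * b x) (at x)" for x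
      using DERIV_cdivide[OF DERIV_diff[OF G[of x] DERIV_const[of "G (-1)"]], of M] by simp
    show "bump_algebra (\<lambda>x. 1 / M * b x)" by (intro bump_algebra.mult bump_algebra.const b)
    show "0 \<le> 1 / M * b x" "\<bar>x\<bar> \<ge> 1 \<Longrightarrow> 1 / M * b x = 0" for x
      using M b0[of x] by auto
    show "(G x - G (-1)) / M = 0" if "x \<le> -1" for x using left[OF that] by simp
    show "(G x - G (-1)) / M = 1" if "x \<ge> 1" for x using right[OF that] M by (simp add: M_def)
    show "0 \<le> (G x - G (-1)) / M \<and> (G x - G (-1)) / M \<le> 1" for x
      using bnd[of x] M by (simp add: M_def)
  qed
qed

lemma dderivs_zero_on:
  fixes F :: "'a::euclidean_space \<Rightarrow> 'b::real_normed_vector"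
  assumes "open U" "\<And>x. x \<in> U \<Longrightarrow> F x = 0" "x \<in> U"
  shows "dderivs vs F x = 0"
  using assms(3)
proof (induction vs arbitrary: x)
  case (Cons v vs)
  have "dderiv v (dderivs vs F) x = dderiv v (\<lambda>_. 0) x"
    by (rule dderiv_cong[OF assms(1) Cons.prems]) (rule Cons.IH)
  also have "\<dots> = 0" by (simp add: dderiv_eq[where F'="\<lambda>_. 0"])
  finally show ?case by simp
qed (use assms in auto)

lemma differentiable_on_transfer:
  assumes "G differentiable_on U" "\<And>x. x \<in> U \<Longrightarrow> F x = G x"
  shows "F differentiable_on U"
  unfolding differentiable_on_def
proof
  fix x assume x: "x \<in> U"
  then obtain D where D: "(G has_derivative D) (at x within U)"
    using assms(1) by (auto simp: differentiable_on_def differentiable_def)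
  have "(F has_derivative D) (at x within U)"
    by (rule has_derivative_transform[OF x assms(2) D])
  then show "F differentiable at x within U" by (auto simp: differentiable_def)
qed

lemma smooth_on_zero:
  assumes "open U" "\<And>x. x \<in> U \<Longrightarrow> F x = 0"
  shows "smooth_on U F"
  unfolding smooth_on_def
proof (intro allI impI)
  fix vs :: "'a list"
  show "dderivs vs F differentiable_on U"
    by (rule differentiable_on_transfer[of "\<lambda>_. 0"]) (use dderivs_zero_on[OF assms] in auto)
qed

lemma smooth_on_Un:
  assumes "open U" "open V" "smooth_on U F" "smooth_on V F"
  shows "smooth_on (U \<union> V) F"
  using assms by (auto simp: smooth_on_def differentiable_on_eq_differentiable_at open_Un)

text \<open>The corresponding algebra on \<open>\<real>\<^sup>n\<close> without the origin. It contains \<open>x \<mapsto> f (c |x|\<^sup>2 + d)\<close> for every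
antiderivative \<open>f\<close> of a member of \<^const>\<open>bump_algebra\<close>, so that the step function itself is available.\<close>

inductive radial_algebra :: "(real^'n::finite \<Rightarrow> real) \<Rightarrow> bool" where
  const: "radial_algebra (\<lambda>x. c)"
| coord: "radial_algebra (\<lambda>x. x $ i)"
| powr: "radial_algebra (\<lambda>x. (x \<bullet> x) powr a)"
| bump: "bump_algebra f' \<Longrightarrow> (\<And>t. (f has_real_derivative f' t) (at t)) \<Longrightarrow>
    radial_algebra (\<lambda>x. f (c * (x \<bullet> x) + d))"
| add: "radial_algebra f \<Longrightarrow> radial_algebra g \<Longrightarrow> radial_algebra (\<lambda>x. f x + g x)"
| mult: "radial_algebra f \<Longrightarrow> radial_algebra g \<Longrightarrow> radial_algebra (\<lambda>x. f x * g x)"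

lemma radial_algebra_deriv:
  fixes f :: "real^'n::finite \<Rightarrow> real"
  shows "radial_algebra f \<Longrightarrow> \<exists>G. (\<forall>i. radial_algebra (G i)) \<and>
    (\<forall>x. x \<noteq> 0 \<longrightarrow> (f has_derivative (\<lambda>v. \<Sum>i\<in>UNIV. v $ i * G i x)) (at x))"
proof (induction rule: radial_algebra.induct)
  case (const c)
  show ?case by (rule exI[of _ "\<lambda>i x. 0"]) (auto intro: radial_algebra.const)
next
  case (coord i)
  show ?case
  proof (intro exI[of _ "\<lambda>j x. kd j i"] conjI allI impI)
    fix x :: "real^'n"
    show "((\<lambda>x. x $ i) has_derivative (\<lambda>v. \<Sum>j\<in>UNIV. v $ j * kd j i)) (at x)"
      by (simp add: bounded_linear_imp_has_derivative bounded_linear_vec_nth)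
  qed (rule radial_algebra.const)
next
  case (powr a)
  show ?case
  proof (intro exI[of _ "\<lambda>j x. a * ((x \<bullet> x) powr (a - 1) * (2 * x $ j))"] conjI allI impI)
    fix x :: "real^'n" assume x: "x \<noteq> 0"
    then have "x \<bullet> x > 0" by simp
    then have "((\<lambda>x. (x \<bullet> x) powr a) has_derivative (\<lambda>v. (2 * (x \<bullet> v)) * (a * (x \<bullet> x) powr (a - 1)))) (at x)"
      by (intro has_derivative_compose[OF _ has_field_derivative_imp_has_derivative[OF has_real_derivative_powr], THEN has_derivative_eq_rhs])
        (auto intro!: derivative_eq_intros simp: inner_commute)
    then show "((\<lambda>x. (x \<bullet> x) powr a) has_derivative (\<lambda>v. \<Sum>j\<in>UNIV. v $ j * (a * ((x \<bullet> x) powr (a - 1) * (2 * x $ j))))) (at x)"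
      by (rule has_derivative_eq_rhs) (auto simp: inner_vec_def[of x] sum_distrib_left sum_distrib_right mult_ac intro!: sum.cong)
  qed (intro radial_algebra.intros)
next
  case (bump f' f c d)
  obtain f'' where f'': "bump_algebra f''" "\<And>t. (f' has_real_derivative f'' t) (at t)"
    using bump_algebra_deriv[OF bump(1)] by blast
  show ?case
  proof (intro exI[of _ "\<lambda>j x. f' (c * (x \<bullet> x) + d) * (2 * c * x $ j)"] conjI allI impI)
    fix x :: "real^'n" assume x: "x \<noteq> 0"
    have "((\<lambda>x. f (c * (x \<bullet> x) + d)) has_derivative (\<lambda>v. (2 * c * (x \<bullet> v)) * f' (c * (x \<bullet> x) + d))) (at x)"
      by (intro has_derivative_compose[OF _ has_field_derivative_imp_has_derivative[OF bump(2)], THEN has_derivative_eq_rhs])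
        (auto intro!: derivative_eq_intros simp: inner_commute)
    then show "((\<lambda>x. f (c * (x \<bullet> x) + d)) has_derivative (\<lambda>v. \<Sum>j\<in>UNIV. v $ j * (f' (c * (x \<bullet> x) + d) * (2 * c * x $ j)))) (at x)"
      by (rule has_derivative_eq_rhs) (auto simp: inner_vec_def[of x] sum_distrib_left sum_distrib_right mult_ac intro!: sum.cong)
  qed (intro radial_algebra.mult radial_algebra.coord radial_algebra.const radial_algebra.bump[OF f''])
next
  case (add f g)
  then obtain G H where G: "\<And>i. radial_algebra (G i)" "\<And>x. x \<noteq> 0 \<Longrightarrow> (f has_derivative (\<lambda>v. \<Sum>i\<in>UNIV. v $ i * G i x)) (at x)"
    and H: "\<And>i. radial_algebra (H i)" "\<And>x. x \<noteq> 0 \<Longrightarrow> (g has_derivative (\<lambda>v. \<Sum>i\<in>UNIV. v $ i * H i x)) (at x)"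
    by blast
  show ?case
    by (rule exI[of _ "\<lambda>i x. G i x + H i x"])
      (auto intro!: radial_algebra.add G(1) H(1) has_derivative_eq_rhs[OF has_derivative_add[OF G(2) H(2)]]
        simp: sum.distrib distrib_left)
next
  case (mult f g)
  then obtain G H where G: "\<And>i. radial_algebra (G i)" "\<And>x. x \<noteq> 0 \<Longrightarrow> (f has_derivative (\<lambda>v. \<Sum>i\<in>UNIV. v $ i * G i x)) (at x)"
    and H: "\<And>i. radial_algebra (H i)" "\<And>x. x \<noteq> 0 \<Longrightarrow> (g has_derivative (\<lambda>v. \<Sum>i\<in>UNIV. v $ i * H i x)) (at x)"
    by blast
  show ?case
    by (rule exI[of _ "\<lambda>i x. f x * H i x + G i x * g x"])
      (auto intro!: radial_algebra.add radial_algebra.mult mult.hyps G(1) H(1) has_derivative_eq_rhs[OF has_derivative_mult[OF G(2) H(2)]]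
        simp: sum.distrib distrib_left sum_distrib_left sum_distrib_right mult_ac)
qed

lemma radial_algebra_smooth_on:
  assumes "radial_algebra (f :: real^'n::finite \<Rightarrow> real)"
  shows "smooth_on (- {0}) f"
proof -
  have eq: "\<exists>g. radial_algebra g \<and> (\<forall>x. x \<noteq> 0 \<longrightarrow> dderivs vs f x = g x)" if "set vs \<subseteq> Basis" for vs
    using that
  proof (induction vs)
    case Nil
    then show ?case using assms by auto
  next
    case (Cons v vs)
    then obtain g where g: "radial_algebra g" "\<And>x. x \<noteq> 0 \<Longrightarrow> dderivs vs f x = g x" by auto
    obtain G where G: "\<And>i. radial_algebra (G i)" "\<And>x. x \<noteq> 0 \<Longrightarrow> (g has_derivative (\<lambda>v. \<Sum>i\<in>UNIV. v $ i * G i x)) (at x)"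
      using radial_algebra_deriv[OF g(1)] by blast
    obtain i where i: "v = axis i 1" using Cons.prems by (auto simp: Basis_vec_def)
    have "dderivs (v # vs) f x = G i x" if "x \<noteq> 0" for x
    proof -
      have "dderivs (v # vs) f x = dderiv v g x"
        unfolding dderivs.simps by (rule dderiv_cong[of "- {0}"]) (use that g in auto)
      also have "\<dots> = (\<Sum>j\<in>UNIV. v $ j * G j x)" by (rule dderiv_eq[OF G(2)[OF that]])
      also have "\<dots> = (\<Sum>j\<in>UNIV. kd i j * G j x)" by (simp add: i axis_def kd_def eq_commute)
      finally show ?thesis by simp
    qed
    then show ?case using G(1) by blast
  qed
  show ?thesis
    unfolding smooth_on_def
  proof (intro allI impI)
    fix vs :: "(real^'n) list" assume "set vs \<subseteq> Basis"
    from eq[OF this] obtain g where g: "radial_algebra g" "\<And>x. x \<noteq> 0 \<Longrightarrow> dderivs vs f x = g x" by blast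
    have op: "open (- {0 :: real^'n})" by (simp add: open_Compl)
    have "g differentiable_on (- {0})"
      using radial_algebra_deriv[OF g(1)]
      by (auto simp: differentiable_on_eq_differentiable_at[OF op] differentiable_def)
    then show "dderivs vs f differentiable_on (- {0})"
      by (rule differentiable_on_transfer) (use g in auto)
  qed
qed

section \<open>Polar coordinates and weak first derivatives\<close>

text \<open>Polar coordinates for radial functions: the image of Lebesgue measure under the norm has the density
\<open>n \<omega>\<^sub>n r\<^sup>n\<^sup>-\<^sup>1\<close>, because both measures give \<open>\<omega>\<^sub>n a\<^sup>n\<close> to \<open>(-\<infinity>, a]\<close> for \<open>a \<ge> 0\<close>.\<close>

lemma distr_norm_lborel:
  "distr lborel borel (norm :: 'a::euclidean_space \<Rightarrow> real) =
   density lborel (\<lambda>r. ennreal (indicator {0..} r * (real DIM('a) * unit_ball_vol (real DIM('a)) * r ^ (DIM('a) - 1))))"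
    (is "?M = ?N")
proof (rule measure_eqI_generator_eq[where E="range (\<lambda>a::real. {..a})" and \<Omega>=UNIV and A="\<lambda>i. {..real i}"])
  show "Int_stable (range (\<lambda>a::real. {..a}))"
    by (auto simp: Int_stable_def)
  have em: "emeasure ?M {..a} = (if a < 0 then 0 else ennreal (unit_ball_vol (real DIM('a)) * a ^ DIM('a)))" for a
  proof -
    have "emeasure ?M {..a} = emeasure lborel ((norm :: 'a \<Rightarrow> real) -` {..a} \<inter> space lborel)"
      by (rule emeasure_distr) auto
    also have "(norm :: 'a \<Rightarrow> real) -` {..a} \<inter> space lborel = cball 0 a" by (auto simp: dist_norm)
    finally show ?thesis by (auto simp: emeasure_cball)
  qed
  show "emeasure ?M X = emeasure ?N X" if "X \<in> range (\<lambda>a::real. {..a})" for X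
  proof -
    obtain a where X: "X = {..a}" using \<open>X \<in> _\<close> by auto
    have "emeasure ?N {..a} = (\<integral>\<^sup>+r. ennreal (indicator {0..} r * (real DIM('a) * unit_ball_vol (real DIM('a)) * r ^ (DIM('a) - 1))) * indicator {..a} r \<partial>lborel)"
      by (subst emeasure_density) auto
    also have "\<dots> = (\<integral>\<^sup>+r. ennreal (real DIM('a) * unit_ball_vol (real DIM('a)) * r ^ (DIM('a) - 1)) * indicator {0..a} r \<partial>lborel)"
      by (intro nn_integral_cong) (auto simp: indicator_def)
    also have "\<dots> = (if a < 0 then 0 else ennreal (unit_ball_vol (real DIM('a)) * a ^ DIM('a)))"
    proof (cases "a < 0")
      case False
      have "(\<integral>\<^sup>+r. ennreal (real DIM('a) * unit_ball_vol (real DIM('a)) * r ^ (DIM('a) - 1)) * indicator {0..a} r \<partial>lborel)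
         = ennreal (unit_ball_vol (real DIM('a)) * a ^ DIM('a) - unit_ball_vol (real DIM('a)) * 0 ^ DIM('a))"
        by (rule nn_integral_FTC_Icc) (use False in \<open>auto intro!: derivative_eq_intros\<close>)
      then show ?thesis using False by simp
    qed simp
    finally show ?thesis unfolding X em by simp
  qed
  show "sets ?M = sigma_sets UNIV (range (\<lambda>a::real. {..a}))" "sets ?N = sigma_sets UNIV (range (\<lambda>a::real. {..a}))"
    by (auto simp: borel_eq_atMost)
  show "(\<Union>i. {..real i}) = UNIV" by (auto intro: real_arch_simple)
  show "emeasure ?M {..real i} \<noteq> \<infinity>" for i by (simp add: em)
qed auto

lemma polar_integral:
  fixes P :: "real \<Rightarrow> real"
  assumes [measurable]: "P \<in> borel_measurable borel"
  shows "(\<integral>x. P (norm (x::'a::euclidean_space)) \<partial>lborel) =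
     (\<integral>r. indicator {0..} r * (real DIM('a) * unit_ball_vol (real DIM('a)) * r ^ (DIM('a) - 1)) * P r \<partial>lborel)"
   and "integrable lborel (\<lambda>x::'a. P (norm x)) \<longleftrightarrow>
     integrable lborel (\<lambda>r. indicator {0..} r * (real DIM('a) * unit_ball_vol (real DIM('a)) * r ^ (DIM('a) - 1)) * P r)"
proof -
  have nonneg: "0 \<le> indicator {0..} r * (real DIM('a) * unit_ball_vol (real DIM('a)) * r ^ (DIM('a) - 1))" for r :: real
    by (auto simp: indicator_def)
  have "(\<integral>x. P (norm (x::'a)) \<partial>lborel) = (\<integral>r. P r \<partial>distr lborel borel (norm :: 'a \<Rightarrow> real))"
    by (subst integral_distr) auto
  then show "(\<integral>x. P (norm (x::'a)) \<partial>lborel) =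
     (\<integral>r. indicator {0..} r * (real DIM('a) * unit_ball_vol (real DIM('a)) * r ^ (DIM('a) - 1)) * P r \<partial>lborel)"
    unfolding distr_norm_lborel by (subst (asm) integral_density) (use nonneg in \<open>auto simp: mult_ac\<close>)
  have "integrable lborel (\<lambda>x::'a. P (norm x)) \<longleftrightarrow> integrable (distr lborel borel (norm :: 'a \<Rightarrow> real)) P"
    by (subst integrable_distr_eq) auto
  then show "integrable lborel (\<lambda>x::'a. P (norm x)) \<longleftrightarrow>
     integrable lborel (\<lambda>r. indicator {0..} r * (real DIM('a) * unit_ball_vol (real DIM('a)) * r ^ (DIM('a) - 1)) * P r)"
    unfolding distr_norm_lborel by (subst (asm) integrable_density) (use nonneg in \<open>auto simp: mult_ac\<close>)
qed

definition unit_index :: "'n \<Rightarrow> 'n \<Rightarrow> nat" where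
  "unit_index m = (\<lambda>i. if i = m then 1 else 0)"

lemma mi_order_unit_index: "mi_order (unit_index (m :: 'n::finite)) = 1"
  by (simp add: mi_order_def unit_index_def)

lemma mi_deriv_unit_index: "mi_deriv (unit_index (m :: 'n::finite)) \<phi> = pd m \<phi>"
proof -
  have uniq: "l = [m]" if l: "\<forall>i. count_list l i = unit_index m i" for l
  proof (cases l)
    case Nil
    then show ?thesis using l by (auto simp: unit_index_def dest: spec[of _ m])
  next
    case (Cons a l')
    have "set l \<subseteq> {m}"
    proof
      fix i assume "i \<in> set l"
      then have "count_list l i \<noteq> 0" by (simp add: count_list_0_iff)
      then show "i \<in> {m}" using l by (auto simp: unit_index_def split: if_splits)
    qed
    then have a: "a = m" "set l' \<subseteq> {m}" using Cons by auto
    have "count_list l' m = 0" using l[rule_format, of m] a Cons by (simp add: unit_index_def)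
    then have "l' = []" using a(2) by (cases l') auto
    then show ?thesis using a Cons by simp
  qed
  have "(SOME l. \<forall>i. count_list l i = unit_index m i) = [m]"
    by (rule some_equality) (auto simp: unit_index_def dest: uniq[unfolded unit_index_def])
  then show ?thesis by (simp add: mi_deriv_def pd_def)
qed

lemma integrable_loc_times_continuous:
  fixes u \<phi> :: "real^'n::finite \<Rightarrow> real"
  assumes u: "loc_integrable u" and \<phi>: "continuous_on UNIV \<phi>" and K: "compact K" "\<And>x. x \<notin> K \<Longrightarrow> \<phi> x = 0"
  shows "integrable lebesgue (\<lambda>x. u x * \<phi> x)"
proof -
  have [measurable]: "u \<in> borel_measurable lebesgue" using u by (simp add: loc_integrable_def)
  have [measurable]: "\<phi> \<in> borel_measurable lebesgue"
    using borel_measurable_continuous_onI[OF \<phi>] by (simp add: measurable_completion)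
  have "bounded (\<phi> ` K)"
    by (intro compact_imp_bounded compact_continuous_image continuous_on_subset[OF \<phi>] K) auto
  then obtain C where C: "\<And>x. x \<in> K \<Longrightarrow> \<bar>\<phi> x\<bar> \<le> C" by (auto simp: bounded_iff)
  have "integrable lebesgue (\<lambda>x. C * (indicator K x * u x))"
    using u K by (auto simp: loc_integrable_def set_integrable_def)
  then show ?thesis
  proof (rule Bochner_Integration.integrable_bound)
    show "AE x in lebesgue. norm (u x * \<phi> x) \<le> norm (C * (indicator K x * u x))"
    proof (rule AE_I2)
      fix x
      show "norm (u x * \<phi> x) \<le> norm (C * (indicator K x * u x))"
      proof (cases "x \<in> K")
        case True
        then have "\<bar>\<phi> x\<bar> \<le> \<bar>C\<bar>" using C[OF True] by linarith
        then show ?thesis using True by (simp add: abs_mult mult.commute mult_right_mono)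
      qed (use K in simp)
    qed
  qed simp
qed

lemma test_function_bounded_support:
  fixes \<phi> :: "real^'n::finite \<Rightarrow> real"
  assumes "test_function \<phi>"
  shows "continuous_on UNIV \<phi>" "continuous_on UNIV (pd m \<phi>)"
    "\<And>x. x \<notin> closure {x. \<phi> x \<noteq> 0} \<Longrightarrow> \<phi> x = 0"
    "\<And>x. x \<notin> closure {x. \<phi> x \<noteq> 0} \<Longrightarrow> pd m \<phi> x = 0"
proof -
  have s: "smooth_on UNIV \<phi>" using assms by (simp add: test_function_def)
  have b: "axis m 1 \<in> (Basis :: (real^'n) set)" by (simp add: axis_in_Basis_iff)
  show "continuous_on UNIV \<phi>" "continuous_on UNIV (pd m \<phi>)"
    using smooth_on_continuous_dderivs[OF s, of "[]"] smooth_on_continuous_dderivs[OF s, of "[axis m 1]"] b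
    by (simp_all add: pd_def)
  show 0: "\<phi> x = 0" if "x \<notin> closure {x. \<phi> x \<noteq> 0}" for x
    using that closure_subset[of "{x. \<phi> x \<noteq> 0}"] by blast
  show "pd m \<phi> x = 0" if "x \<notin> closure {x. \<phi> x \<noteq> 0}" for x
  proof -
    have "dderivs [axis m 1] \<phi> x = 0"
    proof (rule dderivs_zero_on)
      show "open (- closure {x. \<phi> x \<noteq> 0})" by (simp add: open_Compl)
      show "\<phi> y = 0" if "y \<in> - closure {x. \<phi> x \<noteq> 0}" for y
        by (rule 0) (use that in blast)
    qed (use that in blast)
    then show ?thesis by (simp add: pd_def)
  qed
qed

lemma has_weak_deriv_unit:
  fixes u :: "real^'n::finite \<Rightarrow> real"
  assumes "has_weak_deriv (unit_index m) u v" "test_function \<phi>"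
  shows "(\<integral>x. u x * pd m \<phi> x \<partial>lebesgue) = - (\<integral>x. v x * \<phi> x \<partial>lebesgue)"
  using assms unfolding has_weak_deriv_def mi_order_unit_index mi_deriv_unit_index by auto

lemma integrable_times_test_function:
  fixes u :: "real^'n::finite \<Rightarrow> real"
  assumes "loc_integrable u" "test_function \<phi>"
  shows "integrable lebesgue (\<lambda>x. u x * \<phi> x)" "integrable lebesgue (\<lambda>x. u x * pd m \<phi> x)"
proof -
  have K: "compact (closure {x. \<phi> x \<noteq> 0})" using assms(2) by (simp add: test_function_def)
  note supp = test_function_bounded_support[OF assms(2)]
  show "integrable lebesgue (\<lambda>x. u x * \<phi> x)"
    by (rule integrable_loc_times_continuous[OF assms(1) supp(1) K supp(3)])
  show "integrable lebesgue (\<lambda>x. u x * pd m \<phi> x)"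
    by (rule integrable_loc_times_continuous[OF assms(1) supp(2) K supp(4)])
qed

lemma has_weak_deriv_add_scaled:
  fixes u1 u2 :: "real^'n::finite \<Rightarrow> real"
  assumes "has_weak_deriv (unit_index m) u1 v1" "has_weak_deriv (unit_index m) u2 v2"
  shows "has_weak_deriv (unit_index m) (\<lambda>x. a * u1 x + b * u2 x) (\<lambda>x. a * v1 x + b * v2 x)"
proof -
  have loc: "loc_integrable u1" "loc_integrable u2" "loc_integrable v1" "loc_integrable v2"
    using assms by (auto simp: has_weak_deriv_def)
  have lin: "loc_integrable (\<lambda>x. a * f x + b * g x)" if "loc_integrable f" "loc_integrable g" for f g :: "real^'n \<Rightarrow> real"
    using that unfolding loc_integrable_def by (auto intro!: borel_measurable_add borel_measurable_times set_integral_add set_integrable_mult_right)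
  have "(\<integral>x. (a * u1 x + b * u2 x) * pd m \<phi> x \<partial>lebesgue) = - (\<integral>x. (a * v1 x + b * v2 x) * \<phi> x \<partial>lebesgue)"
    if \<phi>: "test_function \<phi>" for \<phi>
  proof -
    note i = integrable_times_test_function[OF loc(1) \<phi>] integrable_times_test_function[OF loc(2) \<phi>]
      integrable_times_test_function[OF loc(3) \<phi>] integrable_times_test_function[OF loc(4) \<phi>]
    have "(\<integral>x. (a * u1 x + b * u2 x) * pd m \<phi> x \<partial>lebesgue) =
       a * (\<integral>x. u1 x * pd m \<phi> x \<partial>lebesgue) + b * (\<integral>x. u2 x * pd m \<phi> x \<partial>lebesgue)"
      using i by (simp add: distrib_right mult.assoc)
    also have "\<dots> = - (a * (\<integral>x. v1 x * \<phi> x \<partial>lebesgue) + b * (\<integral>x. v2 x * \<phi> x \<partial>lebesgue))"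
      by (simp add: has_weak_deriv_unit[OF assms(1) \<phi>] has_weak_deriv_unit[OF assms(2) \<phi>])
    also have "\<dots> = - (\<integral>x. (a * v1 x + b * v2 x) * \<phi> x \<partial>lebesgue)"
      using i by (simp add: distrib_right mult.assoc)
    finally show ?thesis .
  qed
  then show ?thesis
    unfolding has_weak_deriv_def mi_order_unit_index mi_deriv_unit_index using loc by (auto intro: lin)
qed

section \<open>Oscillation of radial functions with a weak derivative\<close>

lemma bump_algebra_affine: "bump_algebra f \<Longrightarrow> bump_algebra (\<lambda>x. f (c + d * x))"
proof (induction rule: bump_algebra.induct)
  case (flat_exp k c' d')
  have "bump_algebra (\<lambda>x. flat_exp k ((c' + d' * c) + (d' * d) * x))" by (rule bump_algebra.flat_exp)
  then show ?case by (simp add: algebra_simps)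
qed (auto intro: bump_algebra.intros)

text \<open>The test functions \<open>x\<^sub>i x\<^sub>j x\<^sub>m |x|\<^sup>-\<^sup>n\<^sup>-\<^sup>2 \<theta>(|x|\<^sup>2)\<close>. The exponent is chosen such that
\<open>x |x|\<^sup>-\<^sup>n\<close> is divergence free, which leaves only the derivative of \<open>\<theta>\<close> in \<open>sum_pd_radial_test\<close>.\<close>

definition radial_test :: "(real \<Rightarrow> real) \<Rightarrow> 'n \<Rightarrow> 'n \<Rightarrow> 'n \<Rightarrow> real^'n::finite \<Rightarrow> real" where
  "radial_test \<theta> i j m x =
     x $ i * x $ j * x $ m * ((x \<bullet> x) powr (- (real CARD('n) + 2) / 2) * \<theta> (x \<bullet> x))"

lemma radial_test_eq_0:
  assumes "norm x < sqrt a" "0 < a" "\<And>t. t \<le> a \<Longrightarrow> \<theta> t = 0"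
  shows "radial_test \<theta> i j m x = 0"
proof -
  have "(norm x)\<^sup>2 < (sqrt a)\<^sup>2" using assms(1) by (intro power_strict_mono) auto
  then have "x \<bullet> x \<le> a" using assms(2) by (simp add: power2_norm_eq_inner)
  then show ?thesis by (simp add: radial_test_def assms(3))
qed

text \<open>Smooth off the origin as a member of \<^const>\<open>radial_algebra\<close>, and zero near the origin because
\<open>\<theta>\<close> vanishes on \<open>(-\<infinity>, a]\<close>.\<close>

lemma test_function_radial_test:
  fixes i j m :: "'n::finite"
  assumes "bump_algebra \<theta>'" "\<And>t. (\<theta> has_real_derivative \<theta>' t) (at t)"
    and "0 < a" and supp: "\<And>t. t \<le> a \<or> b \<le> t \<Longrightarrow> \<theta> t = 0"
  shows "test_function (radial_test \<theta> i j m)"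
proof -
  have "radial_algebra (\<lambda>x::real^'n. x $ i * x $ j * x $ m * ((x \<bullet> x) powr (- (real CARD('n) + 2) / 2) * \<theta> (1 * (x \<bullet> x) + 0)))"
    by (intro radial_algebra.mult radial_algebra.coord radial_algebra.powr radial_algebra.bump[OF assms(1,2)])
  then have "radial_algebra (radial_test \<theta> i j m)" by (simp add: radial_test_def[abs_def])
  then have "smooth_on (- {0}) (radial_test \<theta> i j m)" by (rule radial_algebra_smooth_on)
  moreover have "smooth_on (ball 0 (sqrt a)) (radial_test \<theta> i j m)"
    by (rule smooth_on_zero) (use assms in \<open>auto intro: radial_test_eq_0\<close>)
  ultimately have "smooth_on (- {0} \<union> ball 0 (sqrt a)) (radial_test \<theta> i j m)"
    by (intro smooth_on_Un) (auto simp: open_Compl)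
  moreover have "- {0} \<union> ball (0::real^'n) (sqrt a) = UNIV" using assms(3) by auto
  ultimately have "smooth_on UNIV (radial_test \<theta> i j m)" by simp
  moreover have "{x. radial_test \<theta> i j m x \<noteq> 0} \<subseteq> cball 0 (sqrt \<bar>b\<bar>)"
  proof
    fix x assume "x \<in> {x. radial_test \<theta> i j m x \<noteq> 0}"
    then have "\<not> b \<le> x \<bullet> x" using supp by (auto simp: radial_test_def)
    then have "(norm x)\<^sup>2 \<le> \<bar>b\<bar>" by (simp add: power2_norm_eq_inner)
    then show "x \<in> cball 0 (sqrt \<bar>b\<bar>)" by (simp add: real_le_rsqrt)
  qed
  then have "bounded {x. radial_test \<theta> i j m x \<noteq> 0}" by (rule bounded_subset[OF bounded_cball])
  ultimately show ?thesis by (simp add: test_function_def)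
qed

lemma sum_pd_radial_test:
  fixes x :: "real^'n::finite"
  assumes \<theta>: "\<And>t. (\<theta> has_real_derivative \<theta>' t) (at t)" and x: "x \<noteq> 0"
  shows "(\<Sum>m\<in>UNIV. pd m (radial_test \<theta> i j m) x) =
    2 * (x $ i * x $ j) * (norm x powr (- real CARD('n)) * \<theta>' ((norm x)\<^sup>2))"
proof -
  define n where "n = real CARD('n)"
  define \<alpha> where "\<alpha> = - (n + 2) / 2"
  define r where "r = norm x"
  have r: "r > 0" using x by (simp add: r_def)
  define f where "f s = (s\<^sup>2) powr \<alpha> * \<theta> (s\<^sup>2)" for s
  define f1 where "f1 = 2 * \<alpha> * (r\<^sup>2) powr \<alpha> / r * \<theta> (r\<^sup>2) + (r\<^sup>2) powr \<alpha> * (2 * r * \<theta>' (r\<^sup>2))"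
  have r2: "r\<^sup>2 > 0" using r by simp
  have sq: "((\<lambda>s. s\<^sup>2) has_real_derivative 2 * r) (at r)" by (auto intro!: derivative_eq_intros)
  have "((\<lambda>s. (s\<^sup>2) powr \<alpha>) has_real_derivative 2 * \<alpha> * (r\<^sup>2) powr \<alpha> / r) (at r)"
    using DERIV_chain2[OF has_real_derivative_powr[OF r2] sq, of \<alpha>] r r2
    by (simp add: powr_diff power2_eq_square field_simps)
  moreover have "((\<lambda>s. \<theta> (s\<^sup>2)) has_real_derivative \<theta>' (r\<^sup>2) * (2 * r)) (at r)"
    by (rule DERIV_chain2[OF \<theta> sq])
  ultimately have df: "(f has_real_derivative f1) (at r)"
    unfolding f_def f1_def using DERIV_mult by (fastforce simp: mult_ac)
  have pd: "pd m (radial_test \<theta> i j m) x = (kd m i * x $ j + kd m j * x $ i) * x $ m * f r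
      + x $ i * x $ j * f r + x $ i * x $ j * f1 / r * (x $ m * x $ m)" for m
  proof -
    have "radial_test \<theta> i j m = (\<lambda>y. y $ i * y $ j * y $ m * f (norm y))"
      by (auto simp: radial_test_def f_def \<alpha>_def n_def power2_norm_eq_inner)
    then show ?thesis
      by (simp only:) (rule pd_eqI, auto intro!: derivative_eq_intros df[unfolded r_def, THEN radial_deriv[OF x]]
        simp: r_def algebra_simps kd_def simp del: vector_add_component vector_scaleR_component)
  qed
  have "(\<Sum>m\<in>UNIV. pd m (radial_test \<theta> i j m) x) =
     (\<Sum>m\<in>UNIV. x $ j * f r * (kd m i * x $ m) + x $ i * f r * (kd m j * x $ m)
      + x $ i * x $ j * f r * kd m m + x $ i * x $ j * f1 / r * (x $ m * x $ m))"
    by (intro sum.cong refl) (simp add: pd kd_def algebra_simps)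
  also have "\<dots> = x $ j * f r * x $ i + x $ i * f r * x $ j + x $ i * x $ j * f r * n + x $ i * x $ j * f1 / r * r\<^sup>2"
    by (simp only: sum.distrib sum_distrib_left[symmetric] sum_kd sum_kd_diag sum_coord_sq n_def r_def)
  also have "\<dots> = (x $ i * x $ j) * ((n + 2) * f r + r * f1)"
    using r by (simp add: field_simps power2_eq_square)
  also have "(n + 2) * f r + r * f1 = 2 * (r\<^sup>2 * (r\<^sup>2) powr \<alpha>) * \<theta>' (r\<^sup>2)"
    using r by (simp add: f_def f1_def \<alpha>_def field_simps power2_eq_square)
  also have "r\<^sup>2 * (r\<^sup>2) powr \<alpha> = r powr (- n)"
  proof -
    have "r\<^sup>2 = r powr 2" using r by simp
    then have "r\<^sup>2 * (r\<^sup>2) powr \<alpha> = r powr 2 * r powr (2 * \<alpha>)" by (simp add: powr_powr)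
    also have "\<dots> = r powr (2 + 2 * \<alpha>)" by (rule powr_add[symmetric])
    also have "2 + 2 * \<alpha> = - n" by (simp add: \<alpha>_def field_simps)
    finally show ?thesis .
  qed
  finally show ?thesis by (simp add: n_def r_def mult_ac)
qed

text \<open>The definition of the weak derivatives tested against \<^const>\<open>radial_test\<close> and summed over all indices: by
\<open>sum_pd_radial_test\<close> only the radial function \<open>p\<close> survives on one side, and polar coordinates turn the
integral into a one-dimensional one.\<close>

lemma radial_weak_identity:
  fixes w :: "'n::finite \<Rightarrow> 'n \<Rightarrow> real^'n \<Rightarrow> real" and v :: "'n \<Rightarrow> 'n \<Rightarrow> 'n \<Rightarrow> real^'n \<Rightarrow> real"
  assumes wd: "\<And>i j m. has_weak_deriv (unit_index m) (w i j) (v i j m)"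
    and p: "continuous_on {0<..} p"
    and wp: "\<And>x. x \<noteq> 0 \<Longrightarrow> (\<Sum>i\<in>UNIV. \<Sum>j\<in>UNIV. w i j x * (x $ i * x $ j)) = p (norm x) * (norm x)\<^sup>2"
    and \<theta>: "bump_algebra \<theta>'" "\<And>t. (\<theta> has_real_derivative \<theta>' t) (at t)"
    and a: "0 < a" and supp: "\<And>t. t \<le> a \<or> b \<le> t \<Longrightarrow> \<theta> t = 0"
  shows "real CARD('n) * unit_ball_vol (real CARD('n)) *
      (\<integral>r. indicator {0<..} r * (2 * r * \<theta>' (r\<^sup>2)) * p r \<partial>lborel)
    = - (\<Sum>i\<in>UNIV. \<Sum>j\<in>UNIV. \<Sum>m\<in>UNIV. (\<integral>x. v i j m x * radial_test \<theta> i j m x \<partial>lebesgue))"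
proof -
  define n where "n = CARD('n)"
  have n: "n > 0" by (simp add: n_def)
  note test = test_function_radial_test[OF \<theta> a supp]
  have loc: "loc_integrable (w i j)" for i j using wd[of undefined i j] by (simp add: has_weak_deriv_def)
  have int: "integrable lebesgue (\<lambda>x. w i j x * pd m (radial_test \<theta> i j m) x)" for i j m
    by (rule integrable_times_test_function(2)[OF loc test])
  define R where "R r = indicator {0<..} r *\<^sub>R (2 * p r * r powr (2 - real n) * \<theta>' (r\<^sup>2))" for r :: real
  obtain \<theta>'' where "\<And>t. (\<theta>' has_real_derivative \<theta>'' t) (at t)" using bump_algebra_deriv[OF \<theta>(1)] by blast
  then have c\<theta>: "continuous_on S \<theta>'" for S
    by (intro continuous_at_imp_continuous_on ballI DERIV_isCont)
  have R[measurable]: "R \<in> borel_measurable borel"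
    unfolding R_def by (rule borel_measurable_continuous_on_indicator)
      (auto intro!: continuous_intros p continuous_on_compose2[OF c\<theta>[of UNIV]])
  have pt: "(\<Sum>i\<in>UNIV. \<Sum>j\<in>UNIV. \<Sum>m\<in>UNIV. w i j x * pd m (radial_test \<theta> i j m) x) = R (norm x)" for x
  proof (cases "x = 0")
    case True
    have "pd m (radial_test \<theta> i j m) 0 = 0" for i j m :: 'n
    proof -
      have "pd m (radial_test \<theta> i j m) (0::real^'n) = pd m (\<lambda>_. 0) 0"
        by (rule pd_cong[of "ball 0 (sqrt a)"]) (use a supp in \<open>auto intro: radial_test_eq_0\<close>)
      then show ?thesis by (simp add: pd_eqI)
    qed
    then show ?thesis by (simp add: True R_def)
  next
    case False
    define r where "r = norm x"
    have r: "r > 0" using False by (simp add: r_def)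
    have "(\<Sum>i\<in>UNIV. \<Sum>j\<in>UNIV. \<Sum>m\<in>UNIV. w i j x * pd m (radial_test \<theta> i j m) x)
      = (\<Sum>i\<in>UNIV. \<Sum>j\<in>UNIV. (w i j x * (x $ i * x $ j)) * (2 * (r powr (- real n) * \<theta>' (r\<^sup>2))))"
      by (simp only: sum_distrib_left[symmetric] sum_pd_radial_test[OF \<theta>(2) False] n_def r_def mult_ac)
    also have "\<dots> = (p r * r\<^sup>2) * (2 * (r powr (- real n) * \<theta>' (r\<^sup>2)))"
      by (simp only: sum_distrib_right[symmetric] wp[OF False] r_def)
    also have "\<dots> = 2 * p r * (r powr 2 * r powr (- real n)) * \<theta>' (r\<^sup>2)"
      using r by simp
    also have "r powr 2 * r powr (- real n) = r powr (2 - real n)" by (simp add: powr_add[symmetric])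
    also have "2 * p r * r powr (2 - real n) * \<theta>' (r\<^sup>2) = R r" using r by (simp add: R_def)
    finally show ?thesis by (simp add: r_def)
  qed
  have "- (\<Sum>i\<in>UNIV. \<Sum>j\<in>UNIV. \<Sum>m\<in>UNIV. (\<integral>x. v i j m x * radial_test \<theta> i j m x \<partial>lebesgue))
     = (\<Sum>i\<in>UNIV. \<Sum>j\<in>UNIV. \<Sum>m\<in>UNIV. (\<integral>x. w i j x * pd m (radial_test \<theta> i j m) x \<partial>lebesgue))"
    by (simp add: has_weak_deriv_unit[OF wd test] sum_negf)
  also have "\<dots> = (\<integral>x. (\<Sum>i\<in>UNIV. \<Sum>j\<in>UNIV. \<Sum>m\<in>UNIV. w i j x * pd m (radial_test \<theta> i j m) x) \<partial>lebesgue)"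
    by (simp add: Bochner_Integration.integral_sum int Bochner_Integration.integrable_sum)
  also have "\<dots> = (\<integral>x. R (norm (x::real^'n)) \<partial>lborel)"
    unfolding pt by (rule integral_completion) measurable
  also have "\<dots> = (\<integral>r. indicator {0..} r * (real n * unit_ball_vol (real n) * r ^ (n - 1)) * R r \<partial>lborel)"
    by (subst polar_integral(1)) (simp_all add: n_def)
  also have "\<dots> = (\<integral>r. real n * unit_ball_vol (real n) * (indicator {0<..} r * (2 * r * \<theta>' (r\<^sup>2)) * p r) \<partial>lborel)"
  proof (intro Bochner_Integration.integral_cong refl)
    fix r :: real
    show "indicator {0..} r * (real n * unit_ball_vol (real n) * r ^ (n - 1)) * R r =
       real n * unit_ball_vol (real n) * (indicator {0<..} r * (2 * r * \<theta>' (r\<^sup>2)) * p r)"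
    proof (cases "r > 0")
      case True
      have "r ^ (n - 1) * r powr (2 - real n) = r powr (real (n - 1)) * r powr (2 - real n)"
        using True by (simp add: powr_realpow)
      also have "\<dots> = r" using True n by (simp add: powr_add[symmetric] of_nat_diff)
      finally have "r ^ (n - 1) * r powr (2 - real n) = r" .
      moreover have "indicator {0..} r * (real n * unit_ball_vol (real n) * r ^ (n - 1)) * R r
         = real n * unit_ball_vol (real n) * (r ^ (n - 1) * r powr (2 - real n)) * (2 * \<theta>' (r\<^sup>2)) * p r"
        using True by (simp add: R_def)
      ultimately show ?thesis using True by (simp add: mult_ac)
    qed (simp add: R_def)
  qed
  also have "\<dots> = real n * unit_ball_vol (real n) * (\<integral>r. indicator {0<..} r * (2 * r * \<theta>' (r\<^sup>2)) * p r \<partial>lborel)"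
    by (rule integral_mult_right_zero)
  finally show ?thesis by (simp add: n_def)
qed

text \<open>The weight \<open>\<kappa>\<close> is the derivative of \<open>F ((r\<^sup>2 - r0\<^sup>2) / e)\<close>, hence nonnegative of total mass
\<open>F 1 - F (-1) = 1\<close> and concentrated where \<open>|r\<^sup>2 - r0\<^sup>2| \<le> e\<close>: averaging against it nearly evaluates at \<open>r0\<close>.\<close>

lemma mollified_value:
  fixes F \<beta> p :: "real \<Rightarrow> real"
  assumes F: "\<And>x. (F has_real_derivative \<beta> x) (at x)" "bump_algebra \<beta>" "\<And>x. 0 \<le> \<beta> x"
    "\<And>x. \<bar>x\<bar> \<ge> 1 \<Longrightarrow> \<beta> x = 0" "F (-1) = 0" "F 1 = 1"
    and p: "continuous_on {0<..} p" and r0: "r0 > 0" and e: "0 < e" "e < r0\<^sup>2"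
    and near: "\<And>r. r > 0 \<Longrightarrow> \<bar>r\<^sup>2 - r0\<^sup>2\<bar> \<le> e \<Longrightarrow> \<bar>p r - p r0\<bar> \<le> \<eta>"
  defines "\<kappa> \<equiv> \<lambda>r. 2 * r * (1 / e * \<beta> ((r\<^sup>2 - r0\<^sup>2) / e))"
  shows "integrable lborel (\<lambda>r. indicator {0<..} r * \<kappa> r * p r)"
    "\<bar>(\<integral>r. indicator {0<..} r * \<kappa> r * p r \<partial>lborel) - p r0\<bar> \<le> \<eta>"
proof -
  define a b where "a = sqrt (r0\<^sup>2 - e)" and "b = sqrt (r0\<^sup>2 + e)"
  have ab: "0 < a" "a \<le> b" "a\<^sup>2 = r0\<^sup>2 - e" "b\<^sup>2 = r0\<^sup>2 + e" using e by (auto simp: a_def b_def)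
  obtain \<beta>' where "\<And>t. (\<beta> has_real_derivative \<beta>' t) (at t)" using bump_algebra_deriv[OF F(2)] by blast
  then have c\<beta>: "continuous_on S \<beta>" for S
    by (intro continuous_at_imp_continuous_on ballI DERIV_isCont)
  have c\<kappa>: "continuous_on S \<kappa>" for S
    unfolding \<kappa>_def by (intro continuous_intros continuous_on_compose2[OF c\<beta>[of UNIV]]) (use e in auto)
  have out: "\<kappa> r = 0" if "r > 0" "r \<notin> {a..b}" for r
  proof -
    have "r\<^sup>2 < a\<^sup>2 \<or> b\<^sup>2 < r\<^sup>2"
      using that ab power_strict_mono[of r a 2] power_strict_mono[of b r 2] by force
    then have "e \<le> \<bar>r\<^sup>2 - r0\<^sup>2\<bar>" using ab by linarith
    then have "1 \<le> \<bar>(r\<^sup>2 - r0\<^sup>2) / e\<bar>" using e by (simp add: abs_divide)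
    then show ?thesis by (simp add: \<kappa>_def F(4))
  qed
  have inn: "\<bar>r\<^sup>2 - r0\<^sup>2\<bar> \<le> e" if "r \<in> {a..b}" for r
  proof -
    have "a\<^sup>2 \<le> r\<^sup>2" "r\<^sup>2 \<le> b\<^sup>2" using that ab power_mono[of a r 2] power_mono[of r b 2] by auto
    then show ?thesis using ab by linarith
  qed
  have eq: "indicator {0<..} r * \<kappa> r * p r = \<kappa> r * p r * indicator {a..b} r" for r
    using out[of r] ab(1) by (cases "r \<in> {a..b}") (auto simp: indicator_def)
  have "{a..b} \<subseteq> {0<..}" using ab by auto
  note cp = continuous_on_subset[OF p this]
  have i1: "integrable lborel (\<lambda>r. g r * indicator {a..b} r)" if "continuous_on {a..b} g" for g :: "real \<Rightarrow> real"
    using borel_integrable_compact[OF compact_Icc that] by (simp add: mult.commute)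
  have ip: "integrable lborel (\<lambda>r. \<kappa> r * p r * indicator {a..b} r)"
    by (intro i1 continuous_intros c\<kappa> cp)
  then show "integrable lborel (\<lambda>r. indicator {0<..} r * \<kappa> r * p r)" by (simp add: eq)
  have i\<kappa>: "integrable lborel (\<lambda>r. \<kappa> r * indicator {a..b} r)"
    by (intro i1 c\<kappa>)
  have one: "(\<integral>r. \<kappa> r * indicator {a..b} r \<partial>lborel) = 1"
  proof -
    have "(\<integral>r. \<kappa> r * indicator {a..b} r \<partial>lborel) = F ((b\<^sup>2 - r0\<^sup>2) / e) - F ((a\<^sup>2 - r0\<^sup>2) / e)"
    proof (rule integral_FTC_Icc_real[OF ab(2)])
      fix x
      have "((\<lambda>r. (r\<^sup>2 - r0\<^sup>2) / e) has_real_derivative 2 * x / e) (at x)"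
        by (rule DERIV_cdivide) (auto intro!: derivative_eq_intros)
      from DERIV_chain2[OF F(1) this]
      show "((\<lambda>r. F ((r\<^sup>2 - r0\<^sup>2) / e)) has_real_derivative \<kappa> x) (at x)"
        by (simp add: \<kappa>_def mult_ac)
      show "isCont \<kappa> x" using c\<kappa>[of UNIV] by (simp add: continuous_on_eq_continuous_at)
    qed
    then show ?thesis using ab e F(5,6) by simp
  qed
  have "(\<integral>r. indicator {0<..} r * \<kappa> r * p r \<partial>lborel) - p r0
     = (\<integral>r. \<kappa> r * p r * indicator {a..b} r - p r0 * (\<kappa> r * indicator {a..b} r) \<partial>lborel)"
    using ip i\<kappa> by (simp add: eq one)
  also have "\<bar>\<dots>\<bar> \<le> (\<integral>r. \<eta> * (\<kappa> r * indicator {a..b} r) \<partial>lborel)"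
  proof (rule integral_abs_bound[THEN order_trans], rule integral_mono)
    show "integrable lborel (\<lambda>r. \<bar>\<kappa> r * p r * indicator {a..b} r - p r0 * (\<kappa> r * indicator {a..b} r)\<bar>)"
      using ip i\<kappa> by auto
    show "integrable lborel (\<lambda>r. \<eta> * (\<kappa> r * indicator {a..b} r))" using i\<kappa> by simp
    fix r
    show "\<bar>\<kappa> r * p r * indicator {a..b} r - p r0 * (\<kappa> r * indicator {a..b} r)\<bar> \<le> \<eta> * (\<kappa> r * indicator {a..b} r)"
    proof (cases "r \<in> {a..b}")
      case True
      then have r: "r > 0" "\<bar>p r - p r0\<bar> \<le> \<eta>" using near[of r] inn[OF True] ab by auto
      have "\<kappa> r \<ge> 0" using F(3) e r by (simp add: \<kappa>_def)
      then have "\<kappa> r * \<bar>p r - p r0\<bar> \<le> \<kappa> r * \<eta>" using r by (intro mult_left_mono) auto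
      moreover have "\<bar>\<kappa> r * p r - p r0 * \<kappa> r\<bar> = \<kappa> r * \<bar>p r - p r0\<bar>"
      proof -
        have "\<kappa> r * p r - p r0 * \<kappa> r = \<kappa> r * (p r - p r0)" by (simp add: algebra_simps)
        then show ?thesis using \<open>\<kappa> r \<ge> 0\<close> by (simp add: abs_mult)
      qed
      ultimately show ?thesis using True by (simp add: mult.commute)
    qed simp
  qed
  also have "\<dots> = \<eta>" using i\<kappa> one by simp
  finally show "\<bar>(\<integral>r. indicator {0<..} r * \<kappa> r * p r \<partial>lborel) - p r0\<bar> \<le> \<eta>" .
qed

definition tail_density :: "real \<Rightarrow> (real^'n \<Rightarrow> real) \<Rightarrow> real^'n::finite \<Rightarrow> real" where
  "tail_density \<rho> v x =
     indicator {x. \<rho> < norm x} x * (\<bar>v x\<bar> * norm x powr (1 - real CARD('n)))"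

text \<open>The oscillation of the radial-radial component \<open>p\<close> of a tensor field is bounded by the weak derivatives of
its Cartesian components. Take for \<open>\<theta>\<close> a smoothed indicator function of the interval between
\<open>r1\<^sup>2\<close> and \<open>r2\<^sup>2\<close>, with a sign: its derivative is the difference of two approximate point masses, and the test
functions are bounded by \<open>|x|\<^sup>1\<^sup>-\<^sup>n\<close> on \<open>|x| > \<rho>\<close> and vanish elsewhere.\<close>

lemma radial_oscillation_bound:
  fixes w :: "'n::finite \<Rightarrow> 'n \<Rightarrow> real^'n \<Rightarrow> real" and v :: "'n \<Rightarrow> 'n \<Rightarrow> 'n \<Rightarrow> real^'n \<Rightarrow> real"
  assumes wd: "\<And>i j m. has_weak_deriv (unit_index m) (w i j) (v i j m)"
    and p: "continuous_on {0<..} p"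
    and wp: "\<And>x. x \<noteq> 0 \<Longrightarrow> (\<Sum>i\<in>UNIV. \<Sum>j\<in>UNIV. w i j x * (x $ i * x $ j)) = p (norm x) * (norm x)\<^sup>2"
    and \<rho>: "0 < \<rho>" "\<rho> < r1" "\<rho> < r2"
    and int: "\<And>i j m. integrable lebesgue (tail_density \<rho> (v i j m))"
  shows "real CARD('n) * unit_ball_vol (real CARD('n)) * \<bar>p r1 - p r2\<bar> \<le>
    (\<Sum>i\<in>UNIV. \<Sum>j\<in>UNIV. \<Sum>m\<in>UNIV.
      (\<integral>x. tail_density \<rho> (v i j m) x \<partial>lebesgue))"
    (is "?c * _ \<le> ?B")
proof -
  have c: "?c > 0" by (simp add: unit_ball_vol_pos)
  obtain F \<beta> where F: "\<And>x. (F has_real_derivative \<beta> x) (at x)" "bump_algebra \<beta>" "\<And>x. 0 \<le> \<beta> x"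
    "\<And>x. \<bar>x\<bar> \<ge> 1 \<Longrightarrow> \<beta> x = 0" "\<And>x. x \<le> -1 \<Longrightarrow> F x = 0" "\<And>x. x \<ge> 1 \<Longrightarrow> F x = 1"
    "\<And>x. 0 \<le> F x \<and> F x \<le> 1" by (rule smooth_step) blast
  have key: "?c * \<bar>p r1 - p r2\<bar> \<le> ?B + d" if d: "d > 0" for d
  proof -
    define \<eta> where "\<eta> = d / (2 * ?c)"
    have \<eta>: "\<eta> > 0" using d c unfolding \<eta>_def by (intro divide_pos_pos) auto
    have ex: "\<exists>e>0. \<forall>e'. 0 < e' \<and> e' \<le> e \<longrightarrow> (\<forall>r>0. \<bar>r\<^sup>2 - r0\<^sup>2\<bar> \<le> e' \<longrightarrow> \<bar>p r - p r0\<bar> \<le> \<eta>)" if "r0 > 0" for r0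
    proof -
      have "isCont p r0" using p that by (simp add: continuous_on_eq_continuous_at)
      then obtain s where s: "s > 0" "\<And>r. dist r r0 < s \<Longrightarrow> dist (p r) (p r0) < \<eta>"
        using \<eta> by (auto simp: continuous_at_eps_delta)
      have "\<bar>p r - p r0\<bar> \<le> \<eta>" if "r > 0" "\<bar>r\<^sup>2 - r0\<^sup>2\<bar> \<le> s * r0 / 2" for r
      proof -
        have "\<bar>r - r0\<bar> * r0 \<le> \<bar>r - r0\<bar> * (r + r0)" using \<open>r > 0\<close> by (intro mult_left_mono) auto
        also have "\<dots> = \<bar>r\<^sup>2 - r0\<^sup>2\<bar>" using \<open>r > 0\<close> \<open>r0 > 0\<close>
          by (simp add: power2_eq_square square_diff_square_factored abs_mult mult.commute)
        also have "\<dots> < s * r0" using that s \<open>r0 > 0\<close> by (smt (verit) field_sum_of_halves mult_pos_pos)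
        finally have "\<bar>r - r0\<bar> < s" using \<open>r0 > 0\<close> by simp
        then show ?thesis using s(2)[of r] by (simp add: dist_real_def)
      qed
      then show ?thesis using s \<open>r0 > 0\<close> by (intro exI[of _ "s * r0 / 2"]) auto
    qed
    have r12: "r1 > 0" "r2 > 0" using \<rho> by auto
    obtain e1 where e1: "e1 > 0" "\<And>e' r. 0 < e' \<Longrightarrow> e' \<le> e1 \<Longrightarrow> r > 0 \<Longrightarrow> \<bar>r\<^sup>2 - r1\<^sup>2\<bar> \<le> e' \<Longrightarrow> \<bar>p r - p r1\<bar> \<le> \<eta>"
      using ex[OF r12(1)] by blast
    obtain e2 where e2: "e2 > 0" "\<And>e' r. 0 < e' \<Longrightarrow> e' \<le> e2 \<Longrightarrow> r > 0 \<Longrightarrow> \<bar>r\<^sup>2 - r2\<^sup>2\<bar> \<le> e' \<Longrightarrow> \<bar>p r - p r2\<bar> \<le> \<eta>"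
      using ex[OF r12(2)] by blast
    define e where "e = min (min e1 e2) (min ((r1\<^sup>2 - \<rho>\<^sup>2) / 2) ((r2\<^sup>2 - \<rho>\<^sup>2) / 2))"
    have \<rho>2: "\<rho>\<^sup>2 < r1\<^sup>2" "\<rho>\<^sup>2 < r2\<^sup>2" using \<rho> by (auto intro: power_strict_mono)
    then have e: "e > 0" "e \<le> e1" "e \<le> e2" using e1 e2 by (auto simp: e_def)
    have "min (min e1 e2) (min A B) \<le> A" "min (min e1 e2) (min A B) \<le> B" for A B :: real
      by auto
    then have "e \<le> (r1\<^sup>2 - \<rho>\<^sup>2) / 2" "e \<le> (r2\<^sup>2 - \<rho>\<^sup>2) / 2"
      unfolding e_def by blast+
    then have "2 * e \<le> r1\<^sup>2 - \<rho>\<^sup>2" "2 * e \<le> r2\<^sup>2 - \<rho>\<^sup>2" by simp_all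
    then have e': "\<rho>\<^sup>2 < r1\<^sup>2 - e" "\<rho>\<^sup>2 < r2\<^sup>2 - e" using \<rho>2 e(1) by linarith+
    have er: "e < r1\<^sup>2" "e < r2\<^sup>2" using e' zero_le_power2[of \<rho>] by linarith+
    define \<theta> where "\<theta> t = F ((t - r1\<^sup>2) / e) - F ((t - r2\<^sup>2) / e)" for t
    define \<theta>' where "\<theta>' t = 1 / e * \<beta> ((t - r1\<^sup>2) / e) - 1 / e * \<beta> ((t - r2\<^sup>2) / e)" for t
    have ba: "bump_algebra (\<lambda>t. \<beta> ((t - \<tau>) / e))" for \<tau>
      using bump_algebra_affine[OF F(2), of "- \<tau> / e" "1 / e"] by (simp add: diff_divide_distrib)
    have "bump_algebra (\<lambda>t. 1 / e * \<beta> ((t - r1\<^sup>2) / e) + (- 1 / e) * \<beta> ((t - r2\<^sup>2) / e))"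
      by (intro bump_algebra.add bump_algebra.mult bump_algebra.const ba)
    then have \<theta>1: "bump_algebra \<theta>'" by (simp add: \<theta>'_def[abs_def])
    have dF: "((\<lambda>t. F ((t - \<tau>) / e)) has_real_derivative 1 / e * \<beta> ((t - \<tau>) / e)) (at t)" for \<tau> t
    proof -
      have "((\<lambda>t. (t - \<tau>) / e) has_real_derivative 1 / e) (at t)"
        by (rule DERIV_cdivide) (auto intro!: derivative_eq_intros)
      from DERIV_chain2[OF F(1) this] show ?thesis by (simp add: mult.commute)
    qed
    have \<theta>2: "(\<theta> has_real_derivative \<theta>' t) (at t)" for t
      unfolding \<theta>_def \<theta>'_def by (intro DERIV_diff dF)
    define a b where "a = min (r1\<^sup>2 - e) (r2\<^sup>2 - e)" and "b = max (r1\<^sup>2 + e) (r2\<^sup>2 + e)"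
    have a: "a > 0" "\<rho>\<^sup>2 < a" using er e' by (auto simp: a_def)
    have supp: "\<theta> t = 0" if "t \<le> a \<or> b \<le> t" for t
      using that
    proof
      assume "t \<le> a"
      then have "(t - r1\<^sup>2) / e \<le> -1" "(t - r2\<^sup>2) / e \<le> -1" using e by (auto simp: a_def field_simps)
      then show ?thesis by (simp add: \<theta>_def F(5))
    next
      assume "b \<le> t"
      then have "(t - r1\<^sup>2) / e \<ge> 1" "(t - r2\<^sup>2) / e \<ge> 1" using e by (auto simp: b_def field_simps)
      then show ?thesis by (simp add: \<theta>_def F(6))
    qed
    have F1: "F (-1) = 0" "F 1 = 1" using F(5)[of "-1"] F(6)[of 1] by auto
    note mol1 = mollified_value[OF F(1-4) F1 p r12(1) e(1) er(1) e1(2)[OF e(1,2)]]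
    note mol2 = mollified_value[OF F(1-4) F1 p r12(2) e(1) er(2) e2(2)[OF e(1,3)]]
    define J where "J \<tau> = (\<integral>r. indicator {0<..} r * (2 * r * (1 / e * \<beta> ((r\<^sup>2 - \<tau>) / e))) * p r \<partial>lborel)" for \<tau>
    have "(\<integral>r. indicator {0<..} r * (2 * r * \<theta>' (r\<^sup>2)) * p r \<partial>lborel) =
      (\<integral>r. indicator {0<..} r * (2 * r * (1 / e * \<beta> ((r\<^sup>2 - r1\<^sup>2) / e))) * p r
         - indicator {0<..} r * (2 * r * (1 / e * \<beta> ((r\<^sup>2 - r2\<^sup>2) / e))) * p r \<partial>lborel)"
      by (intro Bochner_Integration.integral_cong refl) (simp add: \<theta>'_def algebra_simps)
    also have "\<dots> = J (r1\<^sup>2) - J (r2\<^sup>2)"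
      unfolding J_def by (rule Bochner_Integration.integral_diff[OF mol1(1) mol2(1)])
    finally have J: "?c * (J (r1\<^sup>2) - J (r2\<^sup>2)) = - (\<Sum>i\<in>UNIV. \<Sum>j\<in>UNIV. \<Sum>m\<in>UNIV. (\<integral>x. v i j m x * radial_test \<theta> i j m x \<partial>lebesgue))"
      using radial_weak_identity[OF wd p wp \<theta>1 \<theta>2 a(1) supp] by simp
    have vi: "\<bar>\<integral>x. v i j m x * radial_test \<theta> i j m x \<partial>lebesgue\<bar> \<le>
       (\<integral>x. tail_density \<rho> (v i j m) x \<partial>lebesgue)" for i j m
    proof (rule integral_abs_bound[THEN order_trans], rule integral_mono[OF _ int])
      have "loc_integrable (v i j m)" using wd by (simp add: has_weak_deriv_def)
      then show "integrable lebesgue (\<lambda>x. \<bar>v i j m x * radial_test \<theta> i j m x\<bar>)"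
        by (intro integrable_abs integrable_times_test_function(1) test_function_radial_test[OF \<theta>1 \<theta>2 a(1) supp])
      fix x
      have t: "\<bar>radial_test \<theta> i j m x\<bar> \<le> indicator {x. \<rho> < norm x} x * norm x powr (1 - real CARD('n))"
      proof (cases "\<rho> < norm x")
        case False
        then have "(norm x)\<^sup>2 \<le> \<rho>\<^sup>2" by (intro power_mono) auto
        then have "x \<bullet> x \<le> a" using a by (simp add: power2_norm_eq_inner)
        then show ?thesis by (simp add: radial_test_def supp)
      next
        case True
        define r where "r = norm x"
        have r: "r > 0" using True \<rho>(1) unfolding r_def by linarith
        have T1: "\<bar>\<theta> (x \<bullet> x)\<bar> \<le> 1"
          using F(7)[of "(x \<bullet> x - r1\<^sup>2) / e"] F(7)[of "(x \<bullet> x - r2\<^sup>2) / e"] by (simp add: \<theta>_def abs_le_iff)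
        have T2: "(x \<bullet> x) powr (- (real CARD('n) + 2) / 2) = r powr (- (real CARD('n) + 2))"
        proof -
          have "x \<bullet> x = r powr 2" using r by (simp add: r_def power2_norm_eq_inner)
          then have "(x \<bullet> x) powr (- (real CARD('n) + 2) / 2) = r powr (2 * (- (real CARD('n) + 2) / 2))"
            by (simp only: powr_powr)
          also have "2 * (- (real CARD('n) + 2) / 2) = - (real CARD('n) + 2)" by simp
          finally show ?thesis .
        qed
        have T3: "\<bar>x $ i\<bar> * \<bar>x $ j\<bar> * \<bar>x $ m\<bar> \<le> r * r * r"
          unfolding r_def by (intro mult_mono component_le_norm_cart) auto
        have "\<bar>radial_test \<theta> i j m x\<bar> = (\<bar>x $ i\<bar> * \<bar>x $ j\<bar> * \<bar>x $ m\<bar>) * (r powr (- (real CARD('n) + 2)) * \<bar>\<theta> (x \<bullet> x)\<bar>)"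
          unfolding radial_test_def T2 by (simp only: abs_mult abs_of_nonneg[OF powr_ge_zero])
        also have "\<dots> \<le> (r * r * r) * (r powr (- (real CARD('n) + 2)) * 1)"
          by (intro mult_mono[OF T3] mult_left_mono T1) (use r in auto)
        also have "r * r * r = r powr 3" using r by (simp add: powr_numeral power3_eq_cube)
        also have "r powr 3 * (r powr (- (real CARD('n) + 2)) * 1) = r powr (1 - real CARD('n))"
          unfolding mult_1_right powr_add[symmetric] by simp
        finally show ?thesis using True by (simp add: r_def)
      qed
      have "\<bar>v i j m x * radial_test \<theta> i j m x\<bar> \<le> \<bar>v i j m x\<bar> * (indicator {x. \<rho> < norm x} x * norm x powr (1 - real CARD('n)))"
        unfolding abs_mult by (intro mult_left_mono t) auto
      then show "\<bar>v i j m x * radial_test \<theta> i j m x\<bar> \<le> tail_density \<rho> (v i j m) x"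
        by (simp add: tail_density_def mult_ac)
    qed
    have "?c * \<bar>J (r1\<^sup>2) - J (r2\<^sup>2)\<bar> = \<bar>?c * (J (r1\<^sup>2) - J (r2\<^sup>2))\<bar>" using c by (simp add: abs_mult)
    also have "\<dots> \<le> ?B"
      unfolding J abs_minus_cancel by (intro order_trans[OF sum_abs] sum_mono vi)
    finally have JB: "?c * \<bar>J (r1\<^sup>2) - J (r2\<^sup>2)\<bar> \<le> ?B" .
    have "\<bar>p r1 - p r2\<bar> \<le> \<bar>J (r1\<^sup>2) - J (r2\<^sup>2)\<bar> + 2 * \<eta>"
      using mol1(2) mol2(2) unfolding J_def[symmetric] by linarith
    then have "?c * \<bar>p r1 - p r2\<bar> \<le> ?c * (\<bar>J (r1\<^sup>2) - J (r2\<^sup>2)\<bar> + 2 * \<eta>)"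
      using c by (intro mult_left_mono) auto
    also have "\<dots> = ?c * \<bar>J (r1\<^sup>2) - J (r2\<^sup>2)\<bar> + d"
    proof -
      have "C * (X + 2 * (d / (2 * C))) = C * X + d" if "C > 0" for C X :: real
        using that by (simp add: field_simps)
      from this[OF c] show ?thesis unfolding \<eta>_def .
    qed
    finally show ?thesis using JB by linarith
  qed
  show ?thesis by (rule field_le_epsilon) (rule key)
qed

section \<open>Weighted spaces and the radial coefficient\<close>

lemma integrable_powr_tail:
  assumes "e < -1" "0 < (\<rho>::real)"
  shows "integrable lborel (\<lambda>r. indicator {\<rho><..} r * r powr e)"
proof -
  have "(\<lambda>r. r powr e) integrable_on {\<rho>..}"
    using has_integral_powr_to_inf[OF assms] by (auto simp: integrable_on_def)
  then have "(\<lambda>r. r powr e) absolutely_integrable_on {\<rho>..}"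
    by (intro nonnegative_absolutely_integrable_1) auto
  then have "integrable lebesgue (\<lambda>r. indicator {\<rho>..} r * r powr e)"
    by (simp add: set_integrable_def)
  then have "integrable lborel (\<lambda>r. indicator {\<rho>..} r * r powr e)"
    by (subst (asm) integrable_completion) auto
  then show ?thesis
    by (rule Bochner_Integration.integrable_bound) (auto simp: indicator_def)
qed

text \<open>By the inequality \<open>A B \<le> A\<^sup>2 + B\<^sup>2\<close>, with the weight distributed over the two factors, it suffices
that \<open>|x|\<^sup>2\<^sup>-\<^sup>2\<^sup>n\<close> divided by the weight is integrable on \<open>|x| > \<rho>\<close>. In polar coordinates this is
\<open>O(r powr (2\<delta> - 1))\<close>, which is where \<open>\<delta> < 0\<close> is used.\<close>

lemma weighted_tail_bound:
  fixes \<delta> \<rho> :: real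
  assumes \<delta>: "\<delta> < 0" and \<rho>: "0 < \<rho>"
  obtains C where "\<And>(v :: real^'n::finite \<Rightarrow> real) K. v \<in> borel_measurable lebesgue \<Longrightarrow>
      (\<integral>\<^sup>+x. ennreal (\<bar>v x\<bar>\<^sup>2 * wt x powr (- 2 * (\<delta> - 1) - real CARD('n))) \<partial>lebesgue) \<le> ennreal K \<Longrightarrow> 0 \<le> K \<Longrightarrow>
      integrable lebesgue (tail_density \<rho> v) \<and>
      (\<integral>x. tail_density \<rho> v x \<partial>lebesgue) \<le> C + K"
proof -
  define n where "n = CARD('n)"
  have n: "n > 0" by (simp add: n_def)
  define b where "b = - 2 * (\<delta> - 1) - real n"
  define P where "P r = indicator {\<rho><..} r * (r powr (2 - 2 * real n) * sqrt (1 + r\<^sup>2) powr (- b))" for r :: real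
  have P[measurable]: "P \<in> borel_measurable borel" unfolding P_def by measurable
  have "integrable lborel (\<lambda>r. indicator {0..} r * (real n * unit_ball_vol (real n) * r ^ (n - 1)) * P r)"
  proof -
    define K where "K = max 1 (sqrt (1 + 1 / \<rho>\<^sup>2) powr (- b))"
    have wK: "sqrt (1 + r\<^sup>2) powr (- b) \<le> K * r powr (- b)" if r: "r > \<rho>" for r
    proof -
      have r0: "r > 0" using r \<rho> by simp
      have "sqrt (1 + r\<^sup>2) = sqrt (r\<^sup>2 * (1 + 1 / r\<^sup>2))" using r0 by (simp add: field_simps)
      also have "\<dots> = r * sqrt (1 + 1 / r\<^sup>2)" using r0 by (simp only: real_sqrt_mult real_sqrt_abs abs_of_pos)
      finally have eq: "sqrt (1 + r\<^sup>2) powr (- b) = r powr (- b) * sqrt (1 + 1 / r\<^sup>2) powr (- b)"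
        using r0 by (simp add: powr_mult)
      have one: "1 \<le> sqrt (1 + 1 / r\<^sup>2)" by simp
      have "sqrt (1 + 1 / r\<^sup>2) powr (- b) \<le> K"
      proof (cases "b \<le> 0")
        case True
        have "1 / r\<^sup>2 \<le> 1 / \<rho>\<^sup>2" using r \<rho> by (intro divide_left_mono power_mono) auto
        then have "sqrt (1 + 1 / r\<^sup>2) powr (- b) \<le> sqrt (1 + 1 / \<rho>\<^sup>2) powr (- b)"
          using True by (intro powr_mono2) auto
        then show ?thesis by (simp add: K_def)
      next
        case False
        then have "sqrt (1 + 1 / r\<^sup>2) powr (- b) \<le> sqrt (1 + 1 / r\<^sup>2) powr 0"
          using one by (intro powr_mono) auto
        also have "\<dots> = 1"
        proof -
          have "sqrt (1 + 1 / r\<^sup>2) \<noteq> 0" using one by linarith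
          then show ?thesis by (simp only: powr_zero_eq_one if_False)
        qed
        finally show ?thesis by (simp add: K_def)
      qed
      then have "r powr (- b) * sqrt (1 + 1 / r\<^sup>2) powr (- b) \<le> r powr (- b) * K"
        by (intro mult_left_mono) auto
      then show ?thesis using eq by (simp add: mult.commute)
    qed
    have K: "K > 0" by (simp add: K_def)
    have c: "real n * unit_ball_vol (real n) \<ge> 0" by simp
    have "integrable lborel (\<lambda>r. (real n * unit_ball_vol (real n) * K) * (indicator {\<rho><..} r * r powr (2 * \<delta> - 1)))"
      using integrable_powr_tail[of "2 * \<delta> - 1" \<rho>] \<delta> \<rho> by simp
    then show ?thesis
    proof (rule Bochner_Integration.integrable_bound)
      show "AE r in lborel. norm (indicator {0..} r * (real n * unit_ball_vol (real n) * r ^ (n - 1)) * P r)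
         \<le> norm ((real n * unit_ball_vol (real n) * K) * (indicator {\<rho><..} r * r powr (2 * \<delta> - 1)))"
      proof (rule AE_I2)
        fix r :: real
        show "norm (indicator {0..} r * (real n * unit_ball_vol (real n) * r ^ (n - 1)) * P r)
           \<le> norm ((real n * unit_ball_vol (real n) * K) * (indicator {\<rho><..} r * r powr (2 * \<delta> - 1)))"
        proof (cases "r > \<rho>")
          case True
          then have r0: "r > 0" using \<rho> by simp
          have "r ^ (n - 1) = r powr (real n - 1)" using r0 n by (simp add: powr_realpow[symmetric] of_nat_diff)
          then have "r ^ (n - 1) * (r powr (2 - 2 * real n) * sqrt (1 + r\<^sup>2) powr (- b))
            \<le> r powr (real n - 1) * (r powr (2 - 2 * real n) * (K * r powr (- b)))"
            using wK[OF True] by (intro mult_mono mult_left_mono) auto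
          also have "\<dots> = K * (r powr (real n - 1) * r powr (2 - 2 * real n) * r powr (- b))" by (simp add: mult_ac)
          also have "r powr (real n - 1) * r powr (2 - 2 * real n) * r powr (- b) = r powr (2 * \<delta> - 1)"
            unfolding powr_add[symmetric] by (simp add: b_def algebra_simps)
          finally have "real n * unit_ball_vol (real n) * (r ^ (n - 1) * (r powr (2 - 2 * real n) * sqrt (1 + r\<^sup>2) powr (- b)))
            \<le> real n * unit_ball_vol (real n) * (K * r powr (2 * \<delta> - 1))"
            using c by (rule mult_left_mono)
          then show ?thesis using True r0 K by (simp add: P_def abs_mult mult_ac)
        qed (simp add: P_def)
      qed
    qed measurable
  qed
  then have "integrable lborel (\<lambda>x::real^'n. P (norm x))"
    by (subst polar_integral(2)[OF P]) (simp_all add: n_def)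
  then have iP: "integrable lebesgue (\<lambda>x::real^'n. P (norm x))"
    by (rule integrable_completion[THEN iffD2, rotated]) measurable
  define C where "C = (\<integral>x. P (norm (x::real^'n)) \<partial>lebesgue)"
  show thesis
  proof (rule that[of C])
    fix v :: "real^'n \<Rightarrow> real" and K
    assume [measurable]: "v \<in> borel_measurable lebesgue"
      and N: "(\<integral>\<^sup>+x. ennreal (\<bar>v x\<bar>\<^sup>2 * wt x powr (- 2 * (\<delta> - 1) - real CARD('n))) \<partial>lebesgue) \<le> ennreal K"
      and K: "0 \<le> K"
    have wt_b: "(\<lambda>x::real^'n. wt x powr b) \<in> borel_measurable borel" unfolding wt_def by measurable
    have [measurable]: "(\<lambda>x::real^'n. wt x powr b) \<in> borel_measurable lebesgue"
      by (rule measurable_completion) (use wt_b in simp)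
    have [measurable]: "(\<lambda>x::real^'n. indicator {x. \<rho> < norm x} x * norm x powr (1 - real n)) \<in> borel_measurable lebesgue"
      by (rule measurable_completion) measurable
    have N': "(\<integral>\<^sup>+x. ennreal (\<bar>v x\<bar>\<^sup>2 * wt x powr b) \<partial>lebesgue) \<le> ennreal K"
      using N by (simp add: b_def n_def)
    have i2: "integrable lebesgue (\<lambda>x. \<bar>v x\<bar>\<^sup>2 * wt x powr b)"
      by (rule integrableI_nonneg) (use N' in \<open>auto intro: le_less_trans\<close>)
    have "ennreal (\<integral>x. \<bar>v x\<bar>\<^sup>2 * wt x powr b \<partial>lebesgue) \<le> ennreal K"
      using N' nn_integral_eq_integral[OF i2] by simp
    then have I2: "(\<integral>x. \<bar>v x\<bar>\<^sup>2 * wt x powr b \<partial>lebesgue) \<le> K" using K by (simp add: ennreal_le_iff)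
    have pt: "indicator {x. \<rho> < norm x} x * (\<bar>v x\<bar> * norm x powr (1 - real n)) \<le> P (norm x) + \<bar>v x\<bar>\<^sup>2 * wt x powr b" for x
    proof (cases "\<rho> < norm x")
      case True
      define A B where "A = \<bar>v x\<bar> * wt x powr (b / 2)" and "B = norm x powr (1 - real n) * wt x powr (- (b / 2))"
      have w: "wt x > 0" unfolding wt_def by (simp add: add_pos_nonneg)
      have "wt x powr (b / 2) * wt x powr (- (b / 2)) = 1" using w by (simp add: powr_add[symmetric])
      then have "\<bar>v x\<bar> * norm x powr (1 - real n) = A * B" by (simp add: A_def B_def)
      also have "\<dots> \<le> A\<^sup>2 + B\<^sup>2"
      proof -
        have "0 \<le> A * B" by (simp add: A_def B_def)
        then show ?thesis using sum_squares_bound[of A B] by linarith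
      qed
      also have "A\<^sup>2 = \<bar>v x\<bar>\<^sup>2 * (wt x powr (b / 2) * wt x powr (b / 2))"
        by (simp only: A_def power_mult_distrib power2_eq_square[of "wt x powr (b / 2)"])
      also have "wt x powr (b / 2) * wt x powr (b / 2) = wt x powr b"
        unfolding powr_add[symmetric] by simp
      also have "B\<^sup>2 = P (norm x)"
      proof -
        have "norm x powr (1 - real n) * norm x powr (1 - real n) = norm x powr (2 - 2 * real n)"
          unfolding powr_add[symmetric] by simp
        moreover have "wt x powr (- (b / 2)) * wt x powr (- (b / 2)) = wt x powr (- b)"
          unfolding powr_add[symmetric] by simp
        ultimately show ?thesis using True by (simp add: B_def P_def power2_eq_square wt_def mult_ac)
      qed
      finally show ?thesis using True by simp
    qed (simp add: P_def)
    have i1: "integrable lebesgue (\<lambda>x. indicator {x. \<rho> < norm x} x * (\<bar>v x\<bar> * norm x powr (1 - real n)))"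
    proof (rule Bochner_Integration.integrable_bound[OF Bochner_Integration.integrable_add[OF iP i2]])
      have "(\<lambda>x. (indicator {x. \<rho> < norm x} x * norm x powr (1 - real n)) * \<bar>v x\<bar>) \<in> borel_measurable lebesgue"
        by measurable
      then show "(\<lambda>x. indicator {x. \<rho> < norm x} x * (\<bar>v x\<bar> * norm x powr (1 - real n))) \<in> borel_measurable lebesgue"
        by (simp add: mult_ac)
      show "AE x in lebesgue. norm (indicator {x. \<rho> < norm x} x * (\<bar>v x\<bar> * norm x powr (1 - real n)))
           \<le> norm (P (norm x) + \<bar>v x\<bar>\<^sup>2 * wt x powr b)"
        using pt by (intro AE_I2) (simp add: abs_mult P_def)
    qed
    have "(\<integral>x. indicator {x. \<rho> < norm x} x * (\<bar>v x\<bar> * norm x powr (1 - real n)) \<partial>lebesgue)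
        \<le> (\<integral>x. P (norm x) + \<bar>v x\<bar>\<^sup>2 * wt x powr b \<partial>lebesgue)"
      by (rule integral_mono[OF i1 Bochner_Integration.integrable_add[OF iP i2] pt])
    also have "\<dots> \<le> C + K" using iP i2 I2 by (simp add: C_def)
    finally show "integrable lebesgue (tail_density \<rho> v) \<and>
      (\<integral>x. tail_density \<rho> v x \<partial>lebesgue) \<le> C + K"
      using i1 by (simp add: n_def tail_density_def[abs_def])
  qed
qed

text \<open>Needed because a sum over an infinite index set would be zero and \<^const>\<open>Hk_sqnorm\<close> would bound nothing.\<close>

lemma finite_multi_indices: "finite {I :: 'n::finite \<Rightarrow> nat. mi_order I \<le> k}"
proof (rule finite_subset)
  show "{I. mi_order I \<le> k} \<subseteq> (UNIV :: 'n set) \<rightarrow>\<^sub>E {..k}"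
  proof
    fix I :: "'n \<Rightarrow> nat" assume "I \<in> {I. mi_order I \<le> k}"
    moreover have "I i \<le> mi_order I" for i unfolding mi_order_def by (rule member_le_sum) auto
    ultimately show "I \<in> UNIV \<rightarrow>\<^sub>E {..k}" by (auto intro: order_trans)
  qed
qed (rule finite_PiE, auto)

lemma Hk_sqnorm_first_order:
  fixes u :: "real^'n::finite \<Rightarrow> real"
  assumes "k \<ge> 1"
  shows "(\<integral>\<^sup>+x. ennreal (\<bar>weak_deriv (unit_index m) u x\<bar>\<^sup>2 * wt x powr (- 2 * (\<delta> - 1) - real CARD('n))) \<partial>lebesgue)
     \<le> Hk_sqnorm k \<delta> u"
proof -
  have "(\<integral>\<^sup>+x. ennreal (\<bar>weak_deriv (unit_index m) u x\<bar>\<^sup>2 *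
        wt x powr (- 2 * (\<delta> - real (mi_order (unit_index m))) - real CARD('n))) \<partial>lebesgue) \<le> Hk_sqnorm k \<delta> u"
    unfolding Hk_sqnorm_def
    by (rule member_le_sum) (use assms finite_multi_indices in \<open>auto simp: mi_order_unit_index\<close>)
  then show ?thesis by (simp add: mi_order_unit_index)
qed

lemma Hk_has_weak_deriv:
  assumes "u \<in> Hk k \<delta>" "k \<ge> 1"
  shows "has_weak_deriv (unit_index m) u (weak_deriv (unit_index m) u)"
proof -
  have "\<exists>v. has_weak_deriv (unit_index m) u v"
    using assms by (auto simp: Hk_def Hk_loc_def mi_order_unit_index dest: spec[of _ "unit_index m"])
  then show ?thesis unfolding weak_deriv_def by (rule someI_ex)
qed

lemma has_weak_deriv_measurable:
  "has_weak_deriv I u v \<Longrightarrow> v \<in> borel_measurable lebesgue"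
  by (simp add: has_weak_deriv_def loc_integrable_def)

text \<open>The property of a function that the oscillation estimate uses: for some weak derivative in direction \<open>m\<close> the
absolute value has an integral of at most \<open>K\<close> against \<open>|x|\<^sup>1\<^sup>-\<^sup>n\<close> outside the ball of radius \<open>\<rho>\<close>. Since it only asks for the existence
of a weak derivative, it is compatible with linear combinations.\<close>

definition weak_tail_bound :: "real \<Rightarrow> 'n \<Rightarrow> (real^'n::finite \<Rightarrow> real) \<Rightarrow> real \<Rightarrow> bool" where
  "weak_tail_bound \<rho> m u K \<longleftrightarrow> (\<exists>v. has_weak_deriv (unit_index m) u v \<and>
     integrable lebesgue (tail_density \<rho> v) \<and> (\<integral>x. tail_density \<rho> v x \<partial>lebesgue) \<le> K)"

lemma weak_tail_bound_Hk:
  assumes \<delta>: "\<delta> < 0" and k: "k \<ge> 1" and \<rho>: "0 < \<rho>"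
  obtains C where "\<And>(m :: 'n::finite) u v K. has_weak_deriv (unit_index m) u v \<Longrightarrow>
    Hk_sqnorm k \<delta> u \<le> ennreal K \<Longrightarrow> 0 \<le> K \<Longrightarrow> weak_tail_bound \<rho> m u (C + K)"
proof -
  obtain C where C: "\<And>(v :: real^'n \<Rightarrow> real) K. v \<in> borel_measurable lebesgue \<Longrightarrow>
      (\<integral>\<^sup>+x. ennreal (\<bar>v x\<bar>\<^sup>2 * wt x powr (- 2 * (\<delta> - 1) - real CARD('n))) \<partial>lebesgue) \<le> ennreal K \<Longrightarrow> 0 \<le> K \<Longrightarrow>
      integrable lebesgue (tail_density \<rho> v) \<and> (\<integral>x. tail_density \<rho> v x \<partial>lebesgue) \<le> C + K"
    by (rule weighted_tail_bound[OF \<delta> \<rho>]) blast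
  show thesis
  proof (rule that)
    fix m :: 'n and u v K
    assume v: "has_weak_deriv (unit_index m) u v" and K: "Hk_sqnorm k \<delta> u \<le> ennreal K" "0 \<le> K"
    have w: "has_weak_deriv (unit_index m) u (weak_deriv (unit_index m) u)"
      unfolding weak_deriv_def by (rule someI[of "has_weak_deriv (unit_index m) u", OF v])
    show "weak_tail_bound \<rho> m u (C + K)"
      unfolding weak_tail_bound_def
      using w C[OF has_weak_deriv_measurable[OF w] order_trans[OF Hk_sqnorm_first_order[OF k] K(1)] K(2)] by blast
  qed
qed

lemma weak_tail_bound_add_scaled:
  fixes u1 u2 :: "real^'n::finite \<Rightarrow> real"
  assumes "weak_tail_bound \<rho> m u1 K1" "weak_tail_bound \<rho> m u2 K2" and s: "s \<ge> 0"
  shows "weak_tail_bound \<rho> m (\<lambda>x. s * u1 x + s * u2 x) (s * (K1 + K2))"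
proof -
  obtain v1 v2 where v1: "has_weak_deriv (unit_index m) u1 v1" "integrable lebesgue (tail_density \<rho> v1)"
      "(\<integral>x. tail_density \<rho> v1 x \<partial>lebesgue) \<le> K1"
    and v2: "has_weak_deriv (unit_index m) u2 v2" "integrable lebesgue (tail_density \<rho> v2)"
      "(\<integral>x. tail_density \<rho> v2 x \<partial>lebesgue) \<le> K2"
    using assms by (auto simp: weak_tail_bound_def)
  define v where "v x = s * v1 x + s * v2 x" for x
  define t where "t x = s * tail_density \<rho> v1 x + s * tail_density \<rho> v2 x" for x
  have wd: "has_weak_deriv (unit_index m) (\<lambda>x. s * u1 x + s * u2 x) v"
    unfolding v_def[abs_def] by (rule has_weak_deriv_add_scaled[OF v1(1) v2(1)])
  have it: "integrable lebesgue t" unfolding t_def using v1 v2 by simp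
  have le: "tail_density \<rho> v x \<le> t x" for x
  proof -
    have "\<bar>v x\<bar> \<le> s * \<bar>v1 x\<bar> + s * \<bar>v2 x\<bar>"
      unfolding v_def using s abs_triangle_ineq[of "s * v1 x" "s * v2 x"] by (simp add: abs_mult)
    then have "tail_density \<rho> v x \<le> indicator {x. \<rho> < norm x} x *
        ((s * \<bar>v1 x\<bar> + s * \<bar>v2 x\<bar>) * norm x powr (1 - real CARD('n)))"
      unfolding tail_density_def by (intro mult_left_mono mult_right_mono) auto
    then show ?thesis by (simp add: tail_density_def t_def algebra_simps)
  qed
  have iv: "integrable lebesgue (tail_density \<rho> v)"
  proof (rule Bochner_Integration.integrable_bound[OF it])
    have [measurable]: "(\<lambda>x::real^'n. indicator {x. \<rho> < norm x} x * norm x powr (1 - real CARD('n))) \<in> borel_measurable lebesgue"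
      by (rule measurable_completion) measurable
    have [measurable]: "v \<in> borel_measurable lebesgue" by (rule has_weak_deriv_measurable[OF wd])
    have "(\<lambda>x. (indicator {x. \<rho> < norm x} x * norm x powr (1 - real CARD('n))) * \<bar>v x\<bar>) \<in> borel_measurable lebesgue"
      by measurable
    then show "tail_density \<rho> v \<in> borel_measurable lebesgue" by (simp add: tail_density_def[abs_def] mult_ac)
    have "0 \<le> tail_density \<rho> v x" for x by (simp add: tail_density_def)
    then show "AE x in lebesgue. norm (tail_density \<rho> v x) \<le> norm (t x)"
      using le by (intro AE_I2) (smt (verit) real_norm_def)
  qed
  have "(\<integral>x. tail_density \<rho> v x \<partial>lebesgue) \<le> (\<integral>x. t x \<partial>lebesgue)"
    by (rule integral_mono[OF iv it le])
  also have "\<dots> = s * ((\<integral>x. tail_density \<rho> v1 x \<partial>lebesgue) + (\<integral>x. tail_density \<rho> v2 x \<partial>lebesgue))"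
    unfolding t_def using v1 v2 by (simp add: distrib_left)
  also have "\<dots> \<le> s * (K1 + K2)" using s v1 v2 by (intro mult_left_mono add_mono) auto
  finally show ?thesis unfolding weak_tail_bound_def using wd iv by blast
qed

lemma radial_oscillation_weak_tail_bound:
  fixes w :: "'n::finite \<Rightarrow> 'n \<Rightarrow> real^'n \<Rightarrow> real"
  assumes w: "\<And>i j m. weak_tail_bound \<rho> m (w i j) (K i j)"
    and p: "continuous_on {0<..} p"
    and wp: "\<And>x. x \<noteq> 0 \<Longrightarrow> (\<Sum>i\<in>UNIV. \<Sum>j\<in>UNIV. w i j x * (x $ i * x $ j)) = p (norm x) * (norm x)\<^sup>2"
    and \<rho>: "0 < \<rho>" "\<rho> < r1" "\<rho> < r2"
  shows "unit_ball_vol (real CARD('n)) * \<bar>p r1 - p r2\<bar> \<le> (\<Sum>i\<in>UNIV. \<Sum>j\<in>UNIV. K i j)"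
proof -
  define v where "v i j m = (SOME v. has_weak_deriv (unit_index m) (w i j) v \<and>
     integrable lebesgue (tail_density \<rho> v) \<and> (\<integral>x. tail_density \<rho> v x \<partial>lebesgue) \<le> K i j)" for i j m
  have v: "has_weak_deriv (unit_index m) (w i j) (v i j m)" "integrable lebesgue (tail_density \<rho> (v i j m))"
    "(\<integral>x. tail_density \<rho> (v i j m) x \<partial>lebesgue) \<le> K i j" for i j m
    using someI_ex[OF w[of m i j, unfolded weak_tail_bound_def]] unfolding v_def[symmetric] by blast+
  have "real CARD('n) * unit_ball_vol (real CARD('n)) * \<bar>p r1 - p r2\<bar> \<le>
      (\<Sum>i\<in>UNIV. \<Sum>j\<in>UNIV. \<Sum>m\<in>UNIV. (\<integral>x. tail_density \<rho> (v i j m) x \<partial>lebesgue))"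
    by (rule radial_oscillation_bound[OF v(1) p wp \<rho> v(2)])
  also have "\<dots> \<le> (\<Sum>i\<in>UNIV. \<Sum>j\<in>UNIV. \<Sum>m\<in>(UNIV::'n set). K i j)"
    by (intro sum_mono v(3))
  finally show ?thesis by (simp add: sum_distrib_left[symmetric] mult.assoc)
qed

text \<open>The radial-radial component: the angular part of the metric annihilates \<open>x\<close>.\<close>

lemma sum_rot_sym:
  fixes x :: "real^'n::finite"
  assumes "rot_sym_form g q h" "x \<noteq> 0"
  shows "(\<Sum>i\<in>UNIV. \<Sum>j\<in>UNIV. g x $ i $ j * (x $ i * x $ j)) = (q (norm x))\<^sup>2 * (norm x)\<^sup>2"
proof -
  define r where "r = norm x"
  have r: "r > 0" using assms by (simp add: r_def)
  define H where "H = (h r)\<^sup>2 / r\<^sup>2"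
  have g: "g x $ i $ j = (q r)\<^sup>2 * (x $ i * x $ j / r\<^sup>2) + H * (kd i j - x $ i * x $ j / r\<^sup>2)" for i j
    using assms unfolding rot_sym_form_def mat_1_nth r_def H_def by blast
  have "(\<Sum>i\<in>UNIV. \<Sum>j\<in>UNIV. g x $ i $ j * (x $ i * x $ j))
    = (\<Sum>i\<in>UNIV. \<Sum>j\<in>UNIV. (((q r)\<^sup>2 - H) / r\<^sup>2 * (x $ i * x $ i)) * (x $ j * x $ j) + (H * x $ i) * (kd i j * x $ j))"
    by (intro sum.cong refl) (use r in \<open>simp add: g field_simps power2_eq_square\<close>)
  also have "\<dots> = (\<Sum>i\<in>UNIV. (((q r)\<^sup>2 - H) / r\<^sup>2 * r\<^sup>2) * (x $ i * x $ i) + H * (x $ i * x $ i))"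
  proof (intro sum.cong refl)
    fix i
    have "(\<Sum>j\<in>UNIV. (((q r)\<^sup>2 - H) / r\<^sup>2 * (x $ i * x $ i)) * (x $ j * x $ j) + (H * x $ i) * (kd i j * x $ j))
      = (((q r)\<^sup>2 - H) / r\<^sup>2 * (x $ i * x $ i)) * r\<^sup>2 + (H * x $ i) * x $ i"
      by (simp only: sum.distrib sum_distrib_left[symmetric] sum_kd sum_coord_sq r_def)
    then show "(\<Sum>j\<in>UNIV. (((q r)\<^sup>2 - H) / r\<^sup>2 * (x $ i * x $ i)) * (x $ j * x $ j) + (H * x $ i) * (kd i j * x $ j))
      = (((q r)\<^sup>2 - H) / r\<^sup>2 * r\<^sup>2) * (x $ i * x $ i) + H * (x $ i * x $ i)"
      by (simp only: mult_ac)
  qed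
  also have "\<dots> = (((q r)\<^sup>2 - H) / r\<^sup>2 * r\<^sup>2) * r\<^sup>2 + H * r\<^sup>2"
    by (simp only: sum.distrib sum_distrib_left[symmetric] sum_coord_sq r_def)
  also have "\<dots> = (q r)\<^sup>2 * r\<^sup>2" using r by (simp add: field_simps)
  finally show ?thesis by (simp only: r_def)
qed

lemma sum_euclidean:
  fixes x :: "real^'n::finite"
  shows "(\<Sum>i\<in>UNIV. \<Sum>j\<in>UNIV. mat 1 $ i $ j * (x $ i * x $ j)) = (norm x)\<^sup>2"
proof -
  have "(\<Sum>i\<in>UNIV. \<Sum>j\<in>UNIV. mat 1 $ i $ j * (x $ i * x $ j)) = (\<Sum>i\<in>UNIV. \<Sum>j\<in>UNIV. kd i j * (x $ i * x $ j))"
    by (simp add: mat_1_nth)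
  also have "\<dots> = (norm x)\<^sup>2" by (simp only: sum_kd sum_coord_sq)
  finally show ?thesis .
qed

text \<open>The oscillation of \<open>a\<^sup>2\<close> on \<open>[1,\<infinity>)\<close> is bounded by weak derivatives of the metric in the weighted space,
and on \<open>[0,1]\<close> the function \<open>a\<close> is continuous.\<close>

lemma asymptotically_flat_radial_coefficient_bounded:
  fixes g :: "'n::finite metric"
  assumes \<delta>: "\<delta> < 0" and k: "k \<ge> 1"
    and Hk: "\<And>i j. (\<lambda>x. g x $ i $ j - mat 1 $ i $ j) \<in> Hk k \<delta>"
    and rot: "rot_sym_form g a h"
  shows "\<exists>M. \<forall>r\<ge>0. (a r)\<^sup>2 \<le> M"
proof -
  define w where "w i j x = g x $ i $ j - mat 1 $ i $ j" for i j x
  have w: "w i j \<in> Hk k \<delta>" for i j using Hk[of i j] by (simp add: w_def[abs_def])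
  define K where "K i j = enn2real (Hk_sqnorm k \<delta> (w i j))" for i j
  have K: "Hk_sqnorm k \<delta> (w i j) \<le> ennreal (K i j)" "0 \<le> K i j" for i j
    using w[of i j] by (auto simp: Hk_def K_def)
  obtain C where C: "\<And>(m :: 'n) u v K. has_weak_deriv (unit_index m) u v \<Longrightarrow>
    Hk_sqnorm k \<delta> u \<le> ennreal K \<Longrightarrow> 0 \<le> K \<Longrightarrow> weak_tail_bound (1/2) m u (C + K)"
    by (rule weak_tail_bound_Hk[OF \<delta> k, of "1/2"]) (simp, blast)
  note bound = C[OF Hk_has_weak_deriv[OF w k] K]
  have cont: "continuous_on {0..} a" using rot by (simp add: rot_sym_form_def)
  have p: "continuous_on {0<..} (\<lambda>r. (a r)\<^sup>2 - 1)"
    by (intro continuous_intros continuous_on_subset[OF cont]) auto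
  define c where "c = unit_ball_vol (real CARD('n))"
  have c: "c > 0" by (simp add: c_def unit_ball_vol_pos)
  define B where "B = (\<Sum>i\<in>UNIV. \<Sum>j\<in>UNIV. C + K i j)"
  have osc: "c * \<bar>((a r)\<^sup>2 - 1) - ((a 1)\<^sup>2 - 1)\<bar> \<le> B" if "r \<ge> 1" for r
    unfolding c_def B_def
  proof (rule radial_oscillation_weak_tail_bound[OF bound p])
    fix x :: "real^'n" assume "x \<noteq> 0"
    then show "(\<Sum>i\<in>UNIV. \<Sum>j\<in>UNIV. w i j x * (x $ i * x $ j)) = ((a (norm x))\<^sup>2 - 1) * (norm x)\<^sup>2"
      by (simp add: w_def left_diff_distrib sum_subtractf sum_rot_sym[OF rot] sum_euclidean)
  qed (use that in auto)
  have far: "(a r)\<^sup>2 \<le> (a 1)\<^sup>2 + B / c" if "r \<ge> 1" for r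
  proof -
    have "\<bar>(a r)\<^sup>2 - (a 1)\<^sup>2\<bar> \<le> B / c" using osc[OF that] c by (simp add: field_simps)
    then show ?thesis by linarith
  qed
  have "bounded ((\<lambda>r. (a r)\<^sup>2) ` {0..1})"
    by (intro compact_imp_bounded compact_continuous_image continuous_intros continuous_on_subset[OF cont]) auto
  then obtain M where M: "\<And>r. 0 \<le> r \<Longrightarrow> r \<le> 1 \<Longrightarrow> (a r)\<^sup>2 \<le> M"
    unfolding bounded_iff by fastforce
  show ?thesis
  proof (intro exI[of _ "max M ((a 1)\<^sup>2 + B / c)"] allI impI)
    fix r :: real assume "r \<ge> 0"
    then show "(a r)\<^sup>2 \<le> max M ((a 1)\<^sup>2 + B / c)"
      using far[of r] M[of r] by (cases "r \<ge> 1") auto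
  qed
qed

text \<open>For small \<open>s > 0\<close> write \<open>g(s) - g(0) = s (D + v\<^sub>0)\<close>, where \<open>v\<^sub>0\<close> is the time derivative at \<open>0\<close> and
\<open>D\<close> is small in the weighted norm. The first derivatives of \<open>D\<close> and \<open>v\<^sub>0\<close> are bounded there uniformly in \<open>s\<close>, so the
oscillation of the increment of \<open>q\<^sup>2\<close> is \<open>O(s)\<close>.\<close>

lemma radial_coefficient_increment:
  fixes g :: "real \<Rightarrow> 'n::finite metric"
  assumes \<delta>: "\<delta> < 0" and k: "k \<ge> 1" and T: "0 < T" and \<rho>: "0 < \<rho>"
    and C1: "\<And>i j. C1_curve_Hk k \<delta> T (\<lambda>t x. g t x $ i $ j - mat 1 $ i $ j)"
    and rot: "\<And>t. t \<in> time_ivl T \<Longrightarrow> rot_sym_form (g t) (q t) (h t)"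
  obtains B where "\<forall>\<^sub>F s in at 0 within time_ivl T. \<forall>r>\<rho>. \<forall>r'>\<rho>.
    \<bar>((q s r)\<^sup>2 - (q 0 r)\<^sup>2) - ((q s r')\<^sup>2 - (q 0 r')\<^sup>2)\<bar> \<le> B * s"
proof -
  define u where "u i j t x = g t x $ i $ j - mat 1 $ i $ j" for i j t x
  have T0: "0 \<in> time_ivl T" using T by (simp add: time_ivl_def zero_ereal_def[symmetric])
  define is_deriv where "is_deriv i j v \<longleftrightarrow> (\<forall>t \<in> time_ivl T. u i j t \<in> Hk k \<delta>) \<and> v \<in> Hk k \<delta> \<and>
     ((\<lambda>s. Hk_sqnorm k \<delta> (\<lambda>x. (u i j s x - u i j 0 x) / (s - 0) - v x)) \<longlongrightarrow> 0) (at 0 within time_ivl T)" for i j v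
  define v0 where "v0 i j = (SOME v. is_deriv i j v)" for i j
  have v0_is: "is_deriv i j (v0 i j)" for i j
  proof -
    obtain v where v: "\<forall>t \<in> time_ivl T. u i j t \<in> Hk k \<delta> \<and> v t \<in> Hk k \<delta> \<and>
     ((\<lambda>s. Hk_sqnorm k \<delta> (\<lambda>x. (u i j s x - u i j t x) / (s - t) - v t x)) \<longlongrightarrow> 0) (at t within time_ivl T)"
      using C1[of i j] unfolding C1_curve_Hk_def u_def by blast
    then have "is_deriv i j (v 0)" using T0 unfolding is_deriv_def by blast
    then show ?thesis unfolding v0_def by (rule someI[where P="is_deriv i j"])
  qed
  have u: "\<And>i j t. t \<in> time_ivl T \<Longrightarrow> u i j t \<in> Hk k \<delta>" and v0: "\<And>i j. v0 i j \<in> Hk k \<delta>"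
    and lim: "\<And>i j. ((\<lambda>s. Hk_sqnorm k \<delta> (\<lambda>x. (u i j s x - u i j 0 x) / (s - 0) - v0 i j x)) \<longlongrightarrow> 0) (at 0 within time_ivl T)"
    using v0_is unfolding is_deriv_def by blast+
  define D where "D i j s x = (u i j s x - u i j 0 x) / s - v0 i j x" for i j s x
  have limD: "((\<lambda>s. Hk_sqnorm k \<delta> (D i j s)) \<longlongrightarrow> 0) (at 0 within time_ivl T)" for i j
    using lim[of i j] by (simp add: D_def[abs_def])
  have small: "\<forall>\<^sub>F s in at 0 within time_ivl T. \<forall>i j. Hk_sqnorm k \<delta> (D i j s) < 1"
    by (intro eventually_all_finite order_tendstoD(2)[OF limD]) simp
  define K0 where "K0 i j = enn2real (Hk_sqnorm k \<delta> (v0 i j))" for i j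
  have K0: "Hk_sqnorm k \<delta> (v0 i j) \<le> ennreal (K0 i j)" "0 \<le> K0 i j" for i j
    using v0[of i j] by (auto simp: K0_def Hk_def)
  obtain C where C: "\<And>(m :: 'n) u v K. has_weak_deriv (unit_index m) u v \<Longrightarrow>
    Hk_sqnorm k \<delta> u \<le> ennreal K \<Longrightarrow> 0 \<le> K \<Longrightarrow> weak_tail_bound \<rho> m u (C + K)"
    by (rule weak_tail_bound_Hk[OF \<delta> k \<rho>]) blast
  define c where "c = unit_ball_vol (real CARD('n))"
  have c: "c > 0" by (simp add: c_def unit_ball_vol_pos)
  define B where "B = (\<Sum>i\<in>UNIV. \<Sum>j\<in>UNIV. (C + 1) + (C + K0 i j)) / c"
  show thesis
  proof (rule that[of B])
    have "\<forall>\<^sub>F s in at 0 within time_ivl T. s \<in> time_ivl T \<and> s \<noteq> 0"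
      by (simp add: eventually_at_filter)
    with small show "\<forall>\<^sub>F s in at 0 within time_ivl T. \<forall>r>\<rho>. \<forall>r'>\<rho>.
        \<bar>((q s r)\<^sup>2 - (q 0 r)\<^sup>2) - ((q s r')\<^sup>2 - (q 0 r')\<^sup>2)\<bar> \<le> B * s"
    proof eventually_elim
      case (elim s)
      then have s: "s > 0" and sT: "s \<in> time_ivl T" by (auto simp: time_ivl_def)
      have dD: "\<exists>v. has_weak_deriv (unit_index m) (D i j s) v" for i j m
      proof -
        have "D i j s = (\<lambda>x. 1 * ((1/s) * u i j s x + (-1/s) * u i j 0 x) + (-1) * v0 i j x)"
          using s by (auto simp: D_def field_simps)
        moreover note has_weak_deriv_add_scaled[OF Hk_has_weak_deriv[OF u[OF sT, of i j] k, of m]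
            Hk_has_weak_deriv[OF u[OF T0, of i j] k, of m], where a="1/s" and b="-1/s"]
        note has_weak_deriv_add_scaled[OF this Hk_has_weak_deriv[OF v0[of i j] k], where a=1 and b="-1"]
        ultimately show ?thesis by auto
      qed
      have bD: "weak_tail_bound \<rho> m (D i j s) (C + 1)" for i j m
        using C[of m "D i j s" _ 1] dD[of m i j] elim(1) by (auto simp: less_imp_le)
      define w where "w i j x = s * D i j s x + s * v0 i j x" for i j x
      have bound: "weak_tail_bound \<rho> m (w i j) (s * ((C + 1) + (C + K0 i j)))" for i j m
        unfolding w_def[abs_def]
        by (rule weak_tail_bound_add_scaled[OF bD C[OF Hk_has_weak_deriv[OF v0 k] K0]]) (use s in simp)
      have w: "w i j x = u i j s x - u i j 0 x" for i j x
        using s by (simp add: w_def D_def field_simps)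
      have contq: "continuous_on {0<..} (q t)" if "t \<in> time_ivl T" for t
        using rot[OF that] by (auto simp: rot_sym_form_def intro: continuous_on_subset)
      have p: "continuous_on {0<..} (\<lambda>r. (q s r)\<^sup>2 - (q 0 r)\<^sup>2)"
        by (intro continuous_intros contq sT T0)
      have wp: "(\<Sum>i\<in>UNIV. \<Sum>j\<in>UNIV. w i j x * (x $ i * x $ j)) = ((q s (norm x))\<^sup>2 - (q 0 (norm x))\<^sup>2) * (norm x)\<^sup>2"
        if "x \<noteq> 0" for x
        by (simp add: w u_def left_diff_distrib sum_subtractf sum_rot_sym[OF rot[OF sT] that] sum_rot_sym[OF rot[OF T0] that])
      show ?case
      proof (intro allI impI)
        fix r r' assume r: "\<rho> < r" "\<rho> < r'"
        have "c * \<bar>((q s r)\<^sup>2 - (q 0 r)\<^sup>2) - ((q s r')\<^sup>2 - (q 0 r')\<^sup>2)\<bar>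
           \<le> (\<Sum>i\<in>UNIV. \<Sum>j\<in>UNIV. s * ((C + 1) + (C + K0 i j)))"
          unfolding c_def by (rule radial_oscillation_weak_tail_bound[OF bound p wp \<rho> r])
        also have "\<dots> = c * (B * s)"
          using c by (simp add: B_def sum_distrib_left[symmetric])
        finally show "\<bar>((q s r)\<^sup>2 - (q 0 r)\<^sup>2) - ((q s r')\<^sup>2 - (q 0 r')\<^sup>2)\<bar> \<le> B * s"
          using c by simp
      qed
    qed
  qed
qed

section \<open>Absence of minimal hyperspheres\<close>

text \<open>At the origin the metric has no preferred direction: the limits of \<open>q\<^sup>2\<close> and of \<open>h\<^sup>2 / r\<^sup>2\<close> along two
orthogonal axes are the same component of \<open>g\<close> at \<open>0\<close>. Hence \<open>f = 1\<close> at \<open>r = 0\<close>.\<close>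

lemma rot_sym_form_origin:
  fixes g :: "'n::finite metric"
  assumes n: "CARD('n) \<ge> 2" and rot: "rot_sym_form g q h" and cont: "continuous_on UNIV g"
  shows "h 0 = 0" "vector_derivative h (at 0 within {0..}) = q 0"
proof -
  obtain m m' :: 'n where mm: "m \<noteq> m'"
    using n card_le_Suc0_iff_eq[of "UNIV :: 'n set"] by auto
  have lim_g: "((\<lambda>r. g (r *\<^sub>R axis i 1) $ m $ m) \<longlongrightarrow> g 0 $ m $ m) (at_right (0::real))" for i
  proof -
    have "continuous_on UNIV (\<lambda>r::real. g (r *\<^sub>R axis i 1) $ m $ m)"
      by (intro continuous_on_component continuous_on_compose2[OF cont] continuous_intros) auto
    then have "isCont (\<lambda>r::real. g (r *\<^sub>R axis i 1) $ m $ m) 0"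
      by (simp add: continuous_on_eq_continuous_at)
    then show ?thesis by (simp add: isCont_def filterlim_at_split)
  qed
  have pos: "q r > 0" "h r > 0" if "r > 0" for r using rot that by (auto simp: rot_sym_form_def)
  have g_q: "g (r *\<^sub>R axis m 1) $ m $ m = (q r)\<^sup>2"
    and g_h: "g (r *\<^sub>R axis m' 1) $ m $ m = (h r / r)\<^sup>2" if r: "r > 0" for r
  proof -
    have e: "(r *\<^sub>R axis i (1::real)) $ m = (if m = i then r else 0)" "norm (r *\<^sub>R axis i (1::real) :: real^'n) = r"
      "r *\<^sub>R axis i (1::real) \<noteq> (0 :: real^'n)" for i
      using r by (simp_all add: axis_eq_0_iff) (simp_all add: axis_def)
    have form: "g x $ m $ m = (q (norm x))\<^sup>2 * (x $ m * x $ m / (norm x)\<^sup>2)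
        + (h (norm x))\<^sup>2 / (norm x)\<^sup>2 * (1 - x $ m * x $ m / (norm x)\<^sup>2)" if "x \<noteq> 0" for x
    proof -
      have "g x $ m $ m = (q (norm x))\<^sup>2 * (x $ m * x $ m / (norm x)\<^sup>2)
        + (h (norm x))\<^sup>2 / (norm x)\<^sup>2 * (mat 1 $ m $ m - x $ m * x $ m / (norm x)\<^sup>2)"
        using rot that unfolding rot_sym_form_def by blast
      then show ?thesis by (simp add: mat_def)
    qed
    show "g (r *\<^sub>R axis m 1) $ m $ m = (q r)\<^sup>2"
      unfolding form[OF e(3)] e using r by (simp add: power2_eq_square)
    show "g (r *\<^sub>R axis m' 1) $ m $ m = (h r / r)\<^sup>2"
      unfolding form[OF e(3)] e using mm by (simp add: power_divide)
  qed
  have at0: "at (0::real) within {0..} = at_right 0" by (rule at_within_Ici_at_right)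
  have cq: "(q \<longlongrightarrow> q 0) (at_right 0)" and ch: "(h \<longlongrightarrow> h 0) (at_right 0)"
    using rot by (auto simp: rot_sym_form_def continuous_on_def at0[symmetric])
  have "(q \<longlongrightarrow> sqrt (g 0 $ m $ m)) (at_right 0)"
    by (rule Lim_transform_eventually[OF tendsto_real_sqrt[OF lim_g[of m]]])
      (use pos in \<open>auto simp: eventually_at_right_field g_q less_imp_le intro!: exI[of _ 1]\<close>)
  with cq have q0: "q 0 = sqrt (g 0 $ m $ m)"
    by (rule tendsto_unique[OF trivial_limit_at_right_real])
  have lim_h: "((\<lambda>r. h r / r) \<longlongrightarrow> q 0) (at_right 0)"
    unfolding q0
    by (rule Lim_transform_eventually[OF tendsto_real_sqrt[OF lim_g[of m']]])
      (use pos in \<open>auto simp: eventually_at_right_field g_h less_imp_le intro!: exI[of _ 1]\<close>)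
  have "((\<lambda>r. r * (h r / r)) \<longlongrightarrow> 0 * q 0) (at_right 0)"
    by (intro tendsto_mult lim_h tendsto_ident_at)
  then have "(h \<longlongrightarrow> 0 * q 0) (at_right 0)"
    by (rule Lim_transform_eventually) (auto simp: eventually_at_right_field intro!: exI[of _ 1])
  with ch have "h 0 = 0 * q 0"
    by (rule tendsto_unique[OF trivial_limit_at_right_real])
  then show h0: "h 0 = 0" by simp
  have "(h has_real_derivative q 0) (at 0 within {0..})"
    using lim_h by (simp add: has_field_derivative_iff at0 h0)
  then have "(h has_vector_derivative q 0) (at 0 within {0..})"
    by (simp add: has_real_derivative_iff_has_vector_derivative)
  then show "vector_derivative h (at 0 within {0..}) = q 0"
    by (intro vector_derivative_within) (simp_all add: at0)
qed

lemma slope_bounds_imp_linear_bounds: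
  fixes f f' :: "real \<Rightarrow> real"
  assumes "continuous_on {0..} f" "f 0 = 0" and d: "\<And>x. x > 0 \<Longrightarrow> (f has_real_derivative f' x) (at x)"
    and bnd: "\<And>x. x > 0 \<Longrightarrow> Cm \<le> f' x \<and> f' x \<le> Cp" and r: "r > 0"
  shows "Cm * r \<le> f r \<and> f r \<le> Cp * r"
proof -
  have "\<exists>l z. 0 < z \<and> z < r \<and> (f has_real_derivative l) (at z) \<and> f r - f 0 = (r - 0) * l"
    by (rule MVT[OF r]) (use assms(1) d in \<open>auto intro: continuous_on_subset simp: real_differentiable_def\<close>)
  then obtain l z where z: "0 < z" "(f has_real_derivative l) (at z)" "f r = r * l"
    using assms(2) by auto
  then have "l = f' z" using d[of z] DERIV_unique by blast
  then have "Cm \<le> l" "l \<le> Cp" using bnd z by auto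
  then show ?thesis using z(3) r by (simp add: mult.commute)
qed

lemma dr_eq:
  assumes "(h t has_real_derivative d) (at r)" "r > 0"
  shows "dr h t r = d"
proof -
  have "at r within {0..} = at r" by (rule at_within_interior) (use assms(2) in auto)
  then show ?thesis
    unfolding dr_def using assms(1) by (auto intro: vector_derivative_at simp: has_real_derivative_iff_has_vector_derivative)
qed

text \<open>At \<open>r = 1\<close> the coefficient \<open>q\<^sup>2\<close> is continuous in time, being a component of the metric at a fixed
point; the bound on the oscillation of its increment carries this to all \<open>r\<close> in \<open>[1/R, R]\<close>.\<close>

lemma radial_coefficient_initial_bound:
  fixes g :: "real \<Rightarrow> 'n::finite metric"
  assumes \<delta>: "\<delta> < 0" and k: "k \<ge> 1" and T: "0 < T" and R: "R > 1"
    and C1: "\<And>i j. C1_curve_Hk k \<delta> T (\<lambda>t x. g t x $ i $ j - mat 1 $ i $ j)"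
    and flow: "\<And>x i j. ((\<lambda>s. g s x $ i $ j) has_real_derivative G x i j) (at 0 within time_ivl T)"
    and rot: "\<And>t. t \<in> time_ivl T \<Longrightarrow> rot_sym_form (g t) (q t) (h t)"
    and M: "\<And>r. r > 0 \<Longrightarrow> (q 0 r)\<^sup>2 \<le> M"
  shows "\<exists>t1>0. \<forall>t r. 0 < t \<and> t \<le> t1 \<and> t \<in> time_ivl T \<and> 1/R \<le> r \<and> r \<le> R \<longrightarrow> (q t r)\<^sup>2 \<le> M + 1"
proof -
  define \<rho> where "\<rho> = 1 / (2 * R)"
  have \<rho>: "0 < \<rho>" "\<rho> < 1" "\<rho> < 1 / R" using R by (auto simp: \<rho>_def field_simps)
  have T0: "0 \<in> time_ivl T" using T by (simp add: time_ivl_def zero_ereal_def[symmetric])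
  obtain B where B: "\<forall>\<^sub>F s in at 0 within time_ivl T. \<forall>r>\<rho>. \<forall>r'>\<rho>.
    \<bar>((q s r)\<^sup>2 - (q 0 r)\<^sup>2) - ((q s r')\<^sup>2 - (q 0 r')\<^sup>2)\<bar> \<le> B * s"
    by (rule radial_coefficient_increment[OF \<delta> k T \<rho>(1) C1 rot])
  have "((\<lambda>s. B * s) \<longlongrightarrow> B * 0) (at 0 within time_ivl T)" by (intro tendsto_intros)
  then have Bs: "\<forall>\<^sub>F s in at 0 within time_ivl T. B * s < 1/2" by (intro order_tendstoD(2)) auto
  fix m :: 'n
  define e :: "real^'n" where "e = axis m 1"
  have e: "norm e = 1" "e \<noteq> 0" "e $ m = 1" by (simp_all add: e_def axis_eq_0_iff)
  have val: "g t e $ m $ m = (q t 1)\<^sup>2" if "t \<in> time_ivl T" for t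
  proof -
    have "g t e $ m $ m = (q t (norm e))\<^sup>2 * (e $ m * e $ m / (norm e)\<^sup>2)
        + (h t (norm e))\<^sup>2 / (norm e)\<^sup>2 * (mat 1 $ m $ m - e $ m * e $ m / (norm e)\<^sup>2)"
      using rot[OF that] e(2) unfolding rot_sym_form_def by blast
    then show ?thesis by (simp add: e mat_def)
  qed
  have "((\<lambda>s. g s e $ m $ m) \<longlongrightarrow> g 0 e $ m $ m) (at 0 within time_ivl T)"
    using DERIV_continuous[OF flow] by (simp add: continuous_within)
  then have "\<forall>\<^sub>F s in at 0 within time_ivl T. g s e $ m $ m < g 0 e $ m $ m + 1/2"
    by (rule order_tendstoD(2)) simp
  with B Bs have "\<forall>\<^sub>F s in at 0 within time_ivl T. B * s < 1/2 \<and> g s e $ m $ m < g 0 e $ m $ m + 1/2 \<and>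
     (\<forall>r>\<rho>. \<forall>r'>\<rho>. \<bar>((q s r)\<^sup>2 - (q 0 r)\<^sup>2) - ((q s r')\<^sup>2 - (q 0 r')\<^sup>2)\<bar> \<le> B * s)"
    by eventually_elim auto
  then obtain d where d: "d > 0" "\<And>s. s \<in> time_ivl T \<Longrightarrow> s \<noteq> 0 \<Longrightarrow> dist s 0 < d \<Longrightarrow> B * s < 1/2 \<and> g s e $ m $ m < g 0 e $ m $ m + 1/2 \<and>
     (\<forall>r>\<rho>. \<forall>r'>\<rho>. \<bar>((q s r)\<^sup>2 - (q 0 r)\<^sup>2) - ((q s r')\<^sup>2 - (q 0 r')\<^sup>2)\<bar> \<le> B * s)"
    unfolding eventually_at by blast
  show ?thesis
  proof (intro exI[of _ "d/2"] conjI allI impI)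
    fix t r assume tr: "0 < t \<and> t \<le> d/2 \<and> t \<in> time_ivl T \<and> 1/R \<le> r \<and> r \<le> R"
    then have r: "\<rho> < r" "0 < r" using \<rho> by auto
    have "B * t < 1/2" "(q t 1)\<^sup>2 < (q 0 1)\<^sup>2 + 1/2"
      "\<bar>((q t r)\<^sup>2 - (q 0 r)\<^sup>2) - ((q t 1)\<^sup>2 - (q 0 1)\<^sup>2)\<bar> \<le> B * t"
      using d(2)[of t] tr d(1) r \<rho>(2) by (auto simp: val T0)
    then show "(q t r)\<^sup>2 \<le> M + 1" using M[OF r(2)] by linarith
  qed (use d in simp)
qed

theorem corollary4p4:
  fixes ghat :: "'n::finite metric"
    and gbar :: "real \<Rightarrow> 'n metric"
    and a :: "real \<Rightarrow> real"
    and q h :: "real \<Rightarrow> real \<Rightarrow> real"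
    and k :: nat and \<delta> :: real and TM Ttilde :: ereal
  assumes "CARD('n) \<ge> 3"
    and "\<delta> < 0"
    and "real k > real CARD('n) / 2 + 4"
    and "riemannian_metric ghat"
    and "asymptotically_flat k \<delta> ghat"
    and "rot_sym_form ghat a (\<lambda>r. r)"
    and no_minimal: "\<not> (\<exists>S. minimal_hypersphere ghat S)"
    and "maximal_AF_ricci_flow k \<delta> ghat TM gbar"
    and "\<And>t. t \<in> time_ivl TM \<Longrightarrow> rot_sym_form (gbar t) (q t) (h t)"
    and "\<And>r. r \<ge> 0 \<Longrightarrow> q 0 r = a r"
    and "\<And>r. r \<ge> 0 \<Longrightarrow> h 0 r = r"
    and "largest_slope_time h TM Ttilde"
  shows "\<not> minimal_hypersphere_forms (f_coeff q h) Ttilde"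
proof -
  note n = assms(1) and \<delta> = assms(2) and rot = assms(9) and q0 = assms(10) and h0 = assms(11)
  have k: "k \<ge> 1" "k - 2 \<ge> 1" using n assms(3) by linarith+
  have n2: "CARD('n) \<ge> 2" using n by simp
  have RF: "AF_ricci_flow k \<delta> ghat TM gbar" using assms(8) by (simp add: maximal_AF_ricci_flow_def)
  then have TM: "0 < TM" and smooth: "smooth_on {p. 0 < fst p \<and> ereal (fst p) < TM} (\<lambda>p. gbar (fst p) (snd p))"
    and flow: "\<And>t x i j. t \<in> time_ivl TM \<Longrightarrow>
        ((\<lambda>s. gbar s x $ i $ j) has_real_derivative - 2 * ricci (gbar t) i j x) (at t within time_ivl TM)"
    and C1: "\<And>i j. C1_curve_Hk (k - 2) \<delta> TM (\<lambda>t x. gbar t x $ i $ j - mat 1 $ i $ j)"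
    and metric: "\<And>t. t \<in> time_ivl TM \<Longrightarrow> continuous_on UNIV (gbar t)"
    unfolding AF_ricci_flow_def riemannian_metric_def by auto
  have TM0: "0 \<in> time_ivl TM" using TM by (simp add: time_ivl_def zero_ereal_def[symmetric])
  have Tt: "0 < Ttilde" "Ttilde \<le> TM" and slope: "slope_bounded_until h Ttilde"
    using assms(12) by (auto simp: largest_slope_time_def)
  define I where "I = {t. 0 < t \<and> ereal t < TM}"
  have I_sub: "t \<in> time_ivl TM" if "t \<in> I" for t using that by (auto simp: I_def time_ivl_def)
  have "I = {0<..} \<inter> ereal -` {..<TM}" by (auto simp: I_def)
  then have openI: "open I" by (simp add: open_ereal_vimage open_Int)
  have flowI: "((\<lambda>s. gbar s x $ i $ j) has_real_derivative - 2 * ricci (gbar t) i j x) (at t)" if "t \<in> I" for t x i j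
  proof -
    have "at t within time_ivl TM = at t"
      by (rule at_within_interior) (use that openI I_sub in \<open>auto simp: interior_def\<close>)
    then show ?thesis using flow[OF I_sub[OF that], of x i j] by simp
  qed
  have TtI: "t \<in> I" if "0 < t" "ereal t < Ttilde" for t
    using that Tt by (auto simp: I_def)
  have Tt_sub: "t \<in> time_ivl TM" if "t \<in> time_ivl Ttilde" for t
    using that Tt by (auto simp: time_ivl_def)
  obtain y y1 y2 q1 where
    h_r: "\<And>t r. t \<in> I \<Longrightarrow> 0 < r \<Longrightarrow> (h t has_real_derivative q t r * y t r) (at r)"
    and q_r: "\<And>t r. t \<in> I \<Longrightarrow> 0 < r \<Longrightarrow> (q t has_real_derivative q1 t r) (at r)"
    and y_r: "\<And>t r. t \<in> I \<Longrightarrow> 0 < r \<Longrightarrow> (y t has_real_derivative y1 t r) (at r)"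
    and y_rr: "\<And>t r. t \<in> I \<Longrightarrow> 0 < r \<Longrightarrow> (y1 t has_real_derivative y2 t r) (at r)"
    and h_t: "\<And>t r. t \<in> I \<Longrightarrow> 0 < r \<Longrightarrow> ((\<lambda>t. h t r) has_real_derivative
                y1 t r / q t r - (real CARD('n) - 2) * (1 - (y t r)\<^sup>2) / h t r) (at t)"
    and y_t: "\<And>t r. t \<in> I \<Longrightarrow> 0 < r \<Longrightarrow> ((\<lambda>t. y t r) has_real_derivative
                slope_rhs (real CARD('n)) (h t r) (q t r) (q1 t r) (y t r) (y1 t r) (y2 t r)) (at t)"
    and cont_h: "continuous_on (I \<times> {0<..}) (\<lambda>(t, r). h t r)"
    and cont_y: "continuous_on (I \<times> {0<..}) (\<lambda>(t, r). y t r)"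
  proof (rule ricci_flow_slope_evolution[OF n2 smooth, of q h, folded I_def])
    show "((\<lambda>s. gbar s x $ i $ j) has_real_derivative - 2 * ricci (gbar t) i j x) (at t)" if "t \<in> I" for t x i j
      by (rule flowI[OF that])
    show "rot_sym_form (gbar t) (q t) (h t)" if "t \<in> I" for t
      by (rule rot[OF I_sub[OF that]])
  qed (rule that, assumption+)
  have pos: "q t r > 0" "h t r > 0" if "t \<in> time_ivl TM" "r > 0" for t r
    using rot[OF that(1)] that(2) by (auto simp: rot_sym_form_def)
  have cont0: "continuous_on {0..} (h t)" if "t \<in> time_ivl TM" for t
    using rot[OF that] by (simp add: rot_sym_form_def)
  have origin: "h t 0 = 0" "dr h t 0 = q t 0" if "t \<in> time_ivl TM" for t
    using rot_sym_form_origin[OF n2 rot[OF that] metric[OF that]] by (simp_all add: dr_def)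
  have dr_y: "dr h t r = q t r * y t r" if "t \<in> I" "r > 0" for t r
    by (rule dr_eq[where h=h, OF h_r[OF that] that(2)])
  have has_dr: "(h t has_real_derivative dr h t r) (at r)" if "t \<in> time_ivl Ttilde" "r > 0" for t r
  proof (cases "t = 0")
    case True
    have "((\<lambda>r. r) has_real_derivative 1) (at r)" by (rule DERIV_ident)
    then have "(h 0 has_real_derivative 1) (at r)"
      by (rule has_field_derivative_transform_within_open[of _ _ _ "{0<..}"]) (use that h0 in auto)
    then show ?thesis using True dr_eq[where h=h] that(2) by simp
  next
    case False
    then have "t \<in> I" using that TtI by (auto simp: time_ivl_def)
    then show ?thesis using h_r[OF _ that(2)] dr_y[OF _ that(2)] by simp
  qed
  obtain M where M: "\<And>r. r \<ge> 0 \<Longrightarrow> (a r)\<^sup>2 \<le> M"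
    using asymptotically_flat_radial_coefficient_bounded[OF \<delta> k(1) _ assms(6)] assms(5)
    unfolding asymptotically_flat_def by blast
  have Mq: "(q 0 r)\<^sup>2 \<le> M" if "r > 0" for r using M[of r] q0[of r] that by simp
  have M0: "0 \<le> M" using Mq[of 1] by (meson order_trans zero_le_power2 zero_less_one)
  obtain T0 where T0: "0 < T0" "ereal T0 < Ttilde"
    using ereal_dense2[OF Tt(1)] by (auto simp: zero_ereal_def)
  then have "T0 \<in> time_ivl Ttilde" by (simp add: time_ivl_def)
  then obtain Cm0 Cp0 where "0 < Cm0" "\<forall>t\<in>{0..T0}. \<forall>r>0. Cm0 \<le> dr h t r \<and> dr h t r \<le> Cp0"
    using slope unfolding slope_bounded_until_def by blast
  then have Cm0: "0 < Cm0" "\<And>t r. 0 \<le> t \<Longrightarrow> t \<le> T0 \<Longrightarrow> 0 < r \<Longrightarrow> Cm0 \<le> dr h t r" by auto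
  \<comment> \<open>The time \<open>T0\<close> is fixed once and for all, so that \<open>c\<close> does not depend on the time up to which
    the slope is estimated.\<close>
  define c where "c = min (1/2) (Cm0 / sqrt (M + 1))"
  have c: "0 < c" using Cm0 M0 by (simp add: c_def)
  have c_half: "c \<le> 1/2" unfolding c_def by (rule min.cobounded1)
  have main: "c \<le> y t r" if t: "0 < t" "ereal t < Ttilde" and r: "0 < r" for t r
  proof -
    define T where "T = t"
    have T: "T \<in> time_ivl Ttilde" using t by (simp add: T_def time_ivl_def)
    then obtain Cm Cp where "0 < Cm" "\<forall>t\<in>{0..T}. \<forall>r>0. Cm \<le> dr h t r \<and> dr h t r \<le> Cp"
      using slope unfolding slope_bounded_until_def by blast
    then have C: "0 < Cm" "\<And>t r. 0 \<le> t \<Longrightarrow> t \<le> T \<Longrightarrow> 0 < r \<Longrightarrow> Cm \<le> dr h t r \<and> dr h t r \<le> Cp" by auto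
    have inT: "s \<in> time_ivl Ttilde" "s \<in> I" "s \<in> time_ivl TM" if "0 < s" "s \<le> T" for s
    proof -
      have "ereal s < Ttilde" using that t le_less_trans[of "ereal s" "ereal t" Ttilde] by (simp add: T_def)
      then show "s \<in> time_ivl Ttilde" "s \<in> I" using that TtI by (auto simp: time_ivl_def)
      then show "s \<in> time_ivl TM" using Tt_sub by blast
    qed
    have qy: "q s r > 0 \<and> y s r > 0" if "0 < s" "s \<le> T" "0 < r" for s r
    proof -
      have "0 < q s r * y s r" using C(1) C(2)[of s r] that dr_y[OF inT(2)[OF that(1,2)] that(3)] by simp
      then show ?thesis using pos[OF inT(3)[OF that(1,2)] that(3)] by (simp add: zero_less_mult_iff)
    qed
    have IT: "{0<..T} \<times> {0<..} \<subseteq> I \<times> {0<..}" using inT by auto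
    have init: "\<exists>t1>0. \<forall>t r. 0 < t \<and> t \<le> t1 \<and> t \<le> T \<and> 1/R \<le> r \<and> r \<le> R \<longrightarrow> c \<le> y t r" if R: "R > 1" for R
    proof -
      obtain t1 where t1: "t1 > 0" "\<And>t r. 0 < t \<Longrightarrow> t \<le> t1 \<Longrightarrow> t \<in> time_ivl TM \<Longrightarrow> 1/R \<le> r \<Longrightarrow> r \<le> R \<Longrightarrow> (q t r)\<^sup>2 \<le> M + 1"
        using radial_coefficient_initial_bound[where R=R and M=M, OF \<delta> k(2) TM R C1 flow[OF TM0] rot Mq] by blast
      show ?thesis
      proof (intro exI[of _ "min t1 T0"] conjI allI impI)
        fix s r assume "0 < s \<and> s \<le> min t1 T0 \<and> s \<le> T \<and> 1/R \<le> r \<and> r \<le> R"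
        then have s: "0 < s" "s \<le> t1" "s \<le> T0" "s \<le> T" "1/R \<le> r" "r \<le> R" by auto
        have "0 < 1/R" using R by simp
        then have r: "0 < r" using s by linarith
        have "q s r \<le> sqrt (M + 1)" using t1(2)[of s r] s inT(3)[of s] by (intro real_le_rsqrt) auto
        then have "q s r * y s r \<le> sqrt (M + 1) * y s r" using qy[OF s(1,4) r] by (intro mult_right_mono) auto
        moreover have "Cm0 \<le> q s r * y s r" using Cm0(2)[of s r] s r dr_y[OF inT(2)[OF s(1,4)] r] by simp
        ultimately have "Cm0 \<le> y s r * sqrt (M + 1)" by (simp add: mult.commute)
        moreover have "sqrt (M + 1) > 0" using M0 by simp
        ultimately have "Cm0 / sqrt (M + 1) \<le> y s r" by (simp add: pos_divide_le_eq)
        then show "c \<le> y s r" by (simp add: c_def)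
      qed (use t1 T0 in simp)
    qed
    show ?thesis
    proof (rule slope_lower_bound[where h=h and q=q and y=y and ?q1.0=q1 and ?y1.0=y1 and ?y2.0=y2
          and N="real CARD('n)" and Cm=Cm and Cp=Cp and T=T])
      show "Cm * r \<le> h s r \<and> h s r \<le> Cp * r" if "0 < s" "s \<le> T" "0 < r" for s r
      proof (rule slope_bounds_imp_linear_bounds[OF cont0 origin(1) has_dr _ that(3)])
        show "s \<in> time_ivl TM" "s \<in> time_ivl TM" "s \<in> time_ivl Ttilde" using inT[OF that(1,2)] by auto
        show "Cm \<le> dr h s x \<and> dr h s x \<le> Cp" if "x > 0" for x
          using C(2)[of s x] that \<open>0 < s\<close> \<open>s \<le> T\<close> by simp
      qed
    qed (use n c c_half C qy h_r q_r y_r y_rr h_t y_t inT init t r continuous_on_subset[OF cont_h IT]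
        continuous_on_subset[OF cont_y IT] in \<open>auto simp: T_def\<close>)
  qed
  \<comment> \<open>The three bounds are for \<open>r = 0\<close>, for positive times and for \<open>t = 0\<close>.\<close>
  define K where "K = Max {1, 1 / c, sqrt M / Cm0}"
  have "\<bar>f_coeff q h t r\<bar> \<le> K" if t: "t \<in> time_ivl Ttilde" and r: "r \<ge> 0" for t r
  proof -
    have tM: "t \<in> time_ivl TM" by (rule Tt_sub[OF t])
    obtain Cm Cp where "0 < Cm" "\<forall>t\<in>{0..t}. \<forall>r>0. Cm \<le> dr h t r \<and> dr h t r \<le> Cp"
      using slope t unfolding slope_bounded_until_def by blast
    moreover have "0 \<le> t" using t by (simp add: time_ivl_def)
    ultimately have C: "0 < Cm" "\<And>r. 0 < r \<Longrightarrow> Cm \<le> dr h t r \<and> dr h t r \<le> Cp" by auto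
    have grow: "Cm * s \<le> h t s" if "s > 0" for s
      using slope_bounds_imp_linear_bounds[OF cont0[OF tM] origin(1)[OF tM] has_dr[OF t] C(2) that] by simp
    have "r \<in> h t ` {0..}"
    proof -
      have "\<exists>x\<ge>0. x \<le> r / Cm \<and> h t x = r"
      proof (rule IVT')
        show "h t 0 \<le> r" using origin(1)[OF tM] r by simp
        show "r \<le> h t (r / Cm)" using grow[of "r / Cm"] C(1) r origin(1)[OF tM] by (cases "r = 0") auto
        show "0 \<le> r / Cm" using C r by simp
        show "continuous_on {0..r / Cm} (h t)" by (rule continuous_on_subset[OF cont0[OF tM]]) auto
      qed
      then show ?thesis by auto
    qed
    then have rho: "rho h t r \<ge> 0" "h t (rho h t r) = r"
      using inv_into_into[of r "h t" "{0..}"] f_inv_into_f[of r "h t" "{0..}"] by (auto simp: rho_def)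
    show ?thesis
    proof (cases "rho h t r = 0")
      case True
      then have "\<bar>f_coeff q h t r\<bar> \<le> 1" by (simp add: f_coeff_def origin(2)[OF tM])
      also have "1 \<le> K" by (simp add: K_def)
      finally show ?thesis .
    next
      case False
      then have s: "rho h t r > 0" using rho by simp
      define s where "s = rho h t r"
      have s: "s > 0" using s by (simp add: s_def)
      have f: "f_coeff q h t r = q t s / dr h t s" by (simp add: f_coeff_def s_def)
      show ?thesis
      proof (cases "t = 0")
        case True
        have "q 0 s \<le> sqrt M" using Mq[OF s] by (rule real_le_rsqrt)
        moreover have "Cm0 \<le> dr h 0 s" using Cm0(2)[of 0 s] T0 s by simp
        ultimately have "\<bar>q 0 s / dr h 0 s\<bar> \<le> sqrt M / Cm0"
          using Cm0(1) pos[OF TM0 s] M0 by (simp add: frac_le)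
        also have "\<dots> \<le> K" by (simp add: K_def)
        finally show ?thesis using f True by simp
      next
        case False
        then have t': "0 < t" "ereal t < Ttilde" using t by (auto simp: time_ivl_def)
        have "f_coeff q h t r = 1 / y t s"
          unfolding f dr_y[OF TtI[OF t'] s] using pos[OF tM s] by simp
        also have "\<bar>1 / y t s\<bar> \<le> 1 / c" using main[OF t' s] c by (simp add: frac_le)
        also have "1 / c \<le> K" by (simp add: K_def)
        finally show ?thesis .
      qed
    qed
  qed
  then have "bounded ((\<lambda>(t, r). f_coeff q h t r) ` (time_ivl Ttilde \<times> {0..}))"
    unfolding bounded_iff by (intro exI[of _ K]) auto
  then show ?thesis by (simp add: minimal_hypersphere_forms_def)
qed

end
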